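(* Let $X$ be a metric graph, let $\mathbb{F}$ be a field, and let $A=\{a_1,\dots,a_n\}$ be a lexicographically minimal base for $H_1(X,\mathbb{F})$ with lengths $l_i=\operatorname{length}(a_i)$. Then the $H_1(\_,\mathbb{F})$-persistence of $X$ is isomorphic to: (1) $\bigoplus_{i=1}^n\mathbb{I}_{(0,\,l_i/3]}$ for the persistence $\{H_1(\mathrm{Rips}(X,r),\mathbb{F})\}_{r>0}$ via the open Rips filtration; (2) $\bigoplus_{i=1}^n\mathbb{I}_{(0,\,l_i/3)}$ for the persistence $\{H_1(\overline{\mathrm{Rips}}(X,r),\mathbb{F})\}_{r>0}$ via the closed Rips filtration; (3) $\bigoplus_{i=1}^n\mathbb{I}_{(0,\,l_i/4]}$ for the persistence $\{H_1(\mathrm{Cech}(X,r),\mathbb{F})\}_{r>0}$ via the open Čech filtration; (4) $\bigoplus_{i=1}^n\mathbb{I}_{(0,\,l_i/4)}$ for the persistence $\{H_1(\overline{\mathrm{Cech}}(X,r),\mathbb{F})\}_{r>0}$ via the closed Čech filtration.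
   Context: A metric graph is a geodesic space obtained by assigning to each edge of a finite (connected) graph a positive length, with the induced shortest-path metric. The following simplicial complexes have vertex set $X$; a finite nonempty $\sigma\subset X$ is a simplex of $\mathrm{Rips}(X,r)$ iff $\operatorname{diam}\sigma<r$, of $\overline{\mathrm{Rips}}(X,r)$ iff $\operatorname{diam}\sigma\le r$, of $\mathrm{Cech}(X,r)$ iff $\bigcap_{z\in\sigma}B(z,r)\ne\emptyset$ (open balls), of $\overline{\mathrm{Cech}}(X,r)$ iff $\bigcap_{z\in\sigma}\overline B(z,r)\neq\emptyset$ (closed balls). Bonding maps are induced by inclusions. With $n=\dim H_1(X,\mathbb F)$, a collection of loops $a_1,\dots,a_n$ with $\operatorname{length}(a_i)\le\operatorname{length}(a_j)$ for $i<j$ is a base for $H_1(X,\mathbb F)$ if the classes generate $H_1(X,\mathbb F)$; it is lexicographically minimal if its length vector is lexicographically minimal among the length vectors of all bases. For an interval $I\subset(0,\infty)$ the interval module $\mathbb I_{I}$ is $\mathbb F$ at parameters $r\in I$ and $0$ at $r\notin I$, with identity bonding maps between parameters in $I$ and zero maps otherwise. An isomorphism of persistences is a family of isomorphisms, one for each $r>0$, commuting with bonding maps. *)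

theory Defs
  imports
    "Graph_Theory.Digraph_Component"
    "HOL-Library.Extended_Nonnegative_Real"
    "HOL-Library.Set_Algebras"
    "HOL-Analysis.Abstract_Metric_Spaces"
    "HOL-Homology.Homology"
    "Jordan_Normal_Form.Missing_VectorSpace"
begin

section \<open>Metric graphs\<close>

text \<open>
  A finite connected graph is a finite, weakly connected \<open>pre_digraph\<close> (loops and parallel edges
  are allowed); the direction of an arc \<open>e\<close> only serves to parametrise the edge by \<open>{0..len e}\<close>.
\<close>

locale metric_graph = fin_digraph G for G :: "('v, 'e) pre_digraph" (structure) +
  fixes len :: "'e \<Rightarrow> real"
  assumes connected: "Digraph_Component.connected G"
    and len_pos: "e \<in> arcs G \<Longrightarrow> 0 < len e"

datatype ('v, 'e) graph_point = Vertex 'v | Inner 'e real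

definition edge_point :: "('v, 'e) pre_digraph \<Rightarrow> ('e \<Rightarrow> real) \<Rightarrow> 'e \<Rightarrow> real \<Rightarrow> ('v, 'e) graph_point"
  where "edge_point G len e t =
    (if t \<le> 0 then Vertex (tail G e) else if len e \<le> t then Vertex (head G e) else Inner e t)"

definition graph_points :: "('v, 'e) pre_digraph \<Rightarrow> ('e \<Rightarrow> real) \<Rightarrow> ('v, 'e) graph_point set"
  where "graph_points G len =
    Vertex ` verts G \<union> {Inner e t | e t. e \<in> arcs G \<and> 0 < t \<and> t < len e}"

text \<open>\<open>graph_path G len x L y\<close>: a concatenation of finitely many segments, each contained in one
  closed edge, leads from \<open>x\<close> to \<open>y\<close> and has total length \<open>L\<close>.\<close>

inductive graph_path ::
    "('v, 'e) pre_digraph \<Rightarrow> ('e \<Rightarrow> real) \<Rightarrow> ('v, 'e) graph_point \<Rightarrow> real \<Rightarrow> ('v, 'e) graph_point \<Rightarrow> bool"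
  for G len where
  refl: "x \<in> graph_points G len \<Longrightarrow> graph_path G len x 0 x"
| step: "graph_path G len x L (edge_point G len e s) \<Longrightarrow> e \<in> arcs G \<Longrightarrow>
    s \<in> {0..len e} \<Longrightarrow> t \<in> {0..len e} \<Longrightarrow>
    graph_path G len x (L + \<bar>t - s\<bar>) (edge_point G len e t)"

text \<open>The value 0 outside the carrier is required by \<^locale>\<open>Metric_space\<close>, whose symmetry and
  nonnegativity axioms are not relativised.\<close>

definition graph_dist ::
    "('v, 'e) pre_digraph \<Rightarrow> ('e \<Rightarrow> real) \<Rightarrow> ('v, 'e) graph_point \<Rightarrow> ('v, 'e) graph_point \<Rightarrow> real"
  where "graph_dist G len x y =
    (if x \<in> graph_points G len \<and> y \<in> graph_points G len then Inf {L. graph_path G len x L y} else 0)"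

definition metric_graph_space ::
    "('v, 'e) pre_digraph \<Rightarrow> ('e \<Rightarrow> real) \<Rightarrow> ('v, 'e) graph_point metric"
  where "metric_graph_space G len = metric (graph_points G len, graph_dist G len)"

context metric_graph
begin

lemma edge_point_in: "e \<in> arcs G \<Longrightarrow> edge_point G len e t \<in> graph_points G len"
  by (auto simp: edge_point_def graph_points_def)

lemma graph_path_in:
  "graph_path G len x L y \<Longrightarrow> x \<in> graph_points G len \<and> y \<in> graph_points G len \<and> 0 \<le> L"
  by (induction rule: graph_path.induct) (auto simp: edge_point_in)

lemma graph_path_trans:
  assumes "graph_path G len y L' z" "graph_path G len x L y"
  shows "graph_path G len x (L + L') z"
  using assms
proof (induction rule: graph_path.induct)
  case (step y L' e s t)
  from graph_path.step[OF step.IH[OF step.prems] step.hyps(2-4)] show ?case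
    by (simp add: add.assoc)
qed simp

lemma graph_path_edge:
  assumes "e \<in> arcs G" "s \<in> {0..len e}" "t \<in> {0..len e}"
  shows "graph_path G len (edge_point G len e s) \<bar>t - s\<bar> (edge_point G len e t)"
  using graph_path.step[OF graph_path.refl[OF edge_point_in[OF assms(1)]] assms] by simp

lemma graph_path_sym: "graph_path G len x L y \<Longrightarrow> graph_path G len y L x"
proof (induction rule: graph_path.induct)
  case (step x L e s t)
  from graph_path_trans[OF step.IH graph_path_edge[OF step.hyps(2,4,3)]] show ?case
    by (simp add: abs_minus_commute add.commute)
qed (rule graph_path.refl)

lemma edge_point_0: "edge_point G len e 0 = Vertex (tail G e)"
  by (simp add: edge_point_def)

lemma edge_point_len: "e \<in> arcs G \<Longrightarrow> edge_point G len e (len e) = Vertex (head G e)"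
  using len_pos[of e] by (simp add: edge_point_def)

lemma graph_path_arc:
  "e \<in> arcs G \<Longrightarrow> \<exists>L. graph_path G len (Vertex (tail G e)) L (Vertex (head G e))"
  using graph_path_edge[of e 0 "len e"] len_pos[of e] edge_point_len[of e]
  by (auto simp: edge_point_0)

lemma graph_path_vertices:
  assumes "u \<in> verts G" "v \<in> verts G"
  shows "\<exists>L. graph_path G len (Vertex u) L (Vertex v)"
proof -
  let ?M = "with_proj (mk_symmetric G)"
  have "u \<rightarrow>\<^sup>*\<^bsub>?M\<^esub> v"
    using connected assms by (auto simp: connected_def strongly_connected_def)
  then have "(u, v) \<in> rtrancl_on (verts G) (arcs_ends ?M)"
    by (simp add: reachable_def mk_symmetric_def)
  then show ?thesis
  proof (induction rule: rtrancl_on_induct)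
    case base
    then show ?case using assms graph_path.refl[of "Vertex u" G len] by (auto simp: graph_points_def)
  next
    case (step v w)
    then obtain L where L: "graph_path G len (Vertex u) L (Vertex v)" by blast
    from step obtain e where e: "e \<in> arcs G"
      "v = tail G e \<and> w = head G e \<or> v = head G e \<and> w = tail G e"
      by (auto simp: arcs_ends_def arc_to_ends_def mk_symmetric_def)
    then obtain L' where "graph_path G len (Vertex v) L' (Vertex w)"
      using graph_path_arc[OF e(1)] graph_path_sym by blast
    with L show ?case using graph_path_trans by blast
  qed
qed

lemma graph_path_vertex:
  assumes "x \<in> graph_points G len"
  shows "\<exists>v\<in>verts G. \<exists>L. graph_path G len x L (Vertex v)"
proof (cases x)
  case (Vertex v)
  then show ?thesis using assms graph_path.refl[OF assms] by (auto simp: graph_points_def)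
next
  case (Inner e t)
  with assms have e: "e \<in> arcs G" "0 < t" "t < len e" by (auto simp: graph_points_def)
  then have "graph_path G len (edge_point G len e t) \<bar>0 - t\<bar> (edge_point G len e 0)"
    by (intro graph_path_edge) auto
  then have "graph_path G len x t (Vertex (tail G e))"
    using e Inner by (simp add: edge_point_def)
  then show ?thesis using e tail_in_verts by blast
qed

lemma graph_path_exists:
  assumes "x \<in> graph_points G len" "y \<in> graph_points G len"
  shows "\<exists>L. graph_path G len x L y"
proof -
  obtain u L where u: "u \<in> verts G" "graph_path G len x L (Vertex u)"
    using graph_path_vertex[OF assms(1)] by auto
  obtain v L' where v: "v \<in> verts G" "graph_path G len y L' (Vertex v)"
    using graph_path_vertex[OF assms(2)] by auto
  obtain M where "graph_path G len (Vertex u) M (Vertex v)"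
    using graph_path_vertices u(1) v(1) by auto
  then show ?thesis using graph_path_trans graph_path_sym u(2) v(2) by meson
qed

lemma graph_path_bdd: "bdd_below {L. graph_path G len x L y}"
  using graph_path_in by (intro bdd_belowI[of _ 0]) auto

lemma graph_path_lipschitz:
  fixes f :: "('v, 'e) graph_point \<Rightarrow> real"
  assumes "graph_path G len x L y"
    and "\<And>e s t. e \<in> arcs G \<Longrightarrow> s \<in> {0..len e} \<Longrightarrow> t \<in> {0..len e} \<Longrightarrow>
      f (edge_point G len e t) - f (edge_point G len e s) \<le> \<bar>t - s\<bar>"
  shows "f y - f x \<le> L"
  using assms(1)
proof (induction rule: graph_path.induct)
  case (step x L e s t)
  then show ?case using assms(2)[OF step.hyps(2-4)] by linarith
qed simp

lemma graph_dist_lipschitz: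
  fixes f :: "('v, 'e) graph_point \<Rightarrow> real"
  assumes "x \<in> graph_points G len" "y \<in> graph_points G len"
    and "\<And>e s t. e \<in> arcs G \<Longrightarrow> s \<in> {0..len e} \<Longrightarrow> t \<in> {0..len e} \<Longrightarrow>
      f (edge_point G len e t) - f (edge_point G len e s) \<le> \<bar>t - s\<bar>"
  shows "f y - f x \<le> graph_dist G len x y"
proof -
  have "f y - f x \<le> Inf {L. graph_path G len x L y}"
    using graph_path_exists[OF assms(1,2)] graph_path_lipschitz[OF _ assms(3)]
    by (intro cInf_greatest) auto
  then show ?thesis using assms by (simp add: graph_dist_def)
qed

lemma graph_dist_commute: "graph_dist G len x y = graph_dist G len y x"
proof -
  have "{L. graph_path G len x L y} = {L. graph_path G len y L x}"
    using graph_path_sym by blast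
  then show ?thesis by (simp add: graph_dist_def)
qed

lemma graph_dist_pos_Inner:
  assumes x: "Inner e0 t0 \<in> graph_points G len" and y: "y \<in> graph_points G len"
    and ne: "y \<noteq> Inner e0 t0"
  shows "0 < graph_dist G len (Inner e0 t0) y"
proof -
  define m where "m = min t0 (len e0 - t0)"
  have e0: "e0 \<in> arcs G" "0 < t0" "t0 < len e0" using x by (auto simp: graph_points_def)
  then have m: "0 < m" by (simp add: m_def)
  define f where "f z = (case z of Vertex v \<Rightarrow> m
    | Inner e t \<Rightarrow> if e = e0 then min m \<bar>t - t0\<bar> else m)" for z :: "('v, 'e) graph_point"
  have f: "f (edge_point G len e t) = (if e = e0 then min m \<bar>t - t0\<bar> else m)"
    if "e \<in> arcs G" "t \<in> {0..len e}" for e t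
    using that e0 by (auto simp: f_def edge_point_def m_def)
  have "f y - f (Inner e0 t0) \<le> graph_dist G len (Inner e0 t0) y"
    by (rule graph_dist_lipschitz[OF x y]) (auto simp: f)
  moreover have "f (Inner e0 t0) = 0" using m by (simp add: f_def)
  moreover have "0 < f y" using ne m by (auto simp: f_def split: graph_point.split)
  ultimately show ?thesis by linarith
qed

lemma graph_dist_pos_Vertex:
  assumes x: "Vertex v \<in> graph_points G len" and y: "Vertex w \<in> graph_points G len"
    and ne: "w \<noteq> v"
  shows "0 < graph_dist G len (Vertex v) (Vertex w)"
proof -
  define m where "m = Min (insert 1 (len ` arcs G))"
  have m: "0 < m" using len_pos by (simp add: m_def)
  have m_le: "m \<le> len e" if "e \<in> arcs G" for e using that by (simp add: m_def)
  define h where "h u = (if u = v then 0 else m)" for u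
  have h: "0 \<le> h u" "h u \<le> m" for u using m by (auto simp: h_def)
  define f where "f z = (case z of Vertex u \<Rightarrow> h u
    | Inner e t \<Rightarrow> min (h (tail G e) + t) (h (head G e) + (len e - t)))"
    for z :: "('v, 'e) graph_point"
  have f: "f (edge_point G len e t) = min (h (tail G e) + t) (h (head G e) + (len e - t))"
    if "e \<in> arcs G" "t \<in> {0..len e}" for e t
    using that m_le[OF that(1)] h[of "tail G e"] h[of "head G e"] len_pos[OF that(1)]
    by (auto simp: f_def edge_point_def min_def)
  have "f (Vertex w) - f (Vertex v) \<le> graph_dist G len (Vertex v) (Vertex w)"
    by (rule graph_dist_lipschitz[OF x y]) (auto simp: f)
  then show ?thesis using m ne by (simp add: f_def h_def)
qed

lemma Metric_space_graph_dist: "Metric_space (graph_points G len) (graph_dist G len)"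
proof
  fix x y z
  show "0 \<le> graph_dist G len x y"
    using graph_path_exists[of x y] graph_path_in
    by (auto simp: graph_dist_def intro!: cInf_greatest)
  show "graph_dist G len x y = graph_dist G len y x" by (rule graph_dist_commute)
  assume x: "x \<in> graph_points G len" and y: "y \<in> graph_points G len"
  show "graph_dist G len x y = 0 \<longleftrightarrow> x = y"
  proof
    assume 0: "graph_dist G len x y = 0"
    show "x = y"
    proof (rule ccontr)
      assume ne: "x \<noteq> y"
      have "0 < graph_dist G len x y"
      proof (cases x)
        case (Inner e t)
        then show ?thesis using graph_dist_pos_Inner x y ne by metis
      next
        case v: (Vertex v)
        show ?thesis
        proof (cases y)
          case (Inner e t)
          then show ?thesis using graph_dist_pos_Inner x y ne graph_dist_commute by metis
        next
          case (Vertex w)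
          then show ?thesis using graph_dist_pos_Vertex x y ne v by metis
        qed
      qed
      with 0 show False by simp
    qed
  next
    assume "x = y"
    then have "Inf {L. graph_path G len x L y} \<le> 0"
      using x graph_path.refl by (intro cInf_lower graph_path_bdd) auto
    moreover have "0 \<le> Inf {L. graph_path G len x L y}"
      using graph_path_exists[OF x y] graph_path_in by (intro cInf_greatest) auto
    ultimately show "graph_dist G len x y = 0" using x y by (simp add: graph_dist_def)
  qed
  assume z: "z \<in> graph_points G len"
  have "Inf {L. graph_path G len x L z} - L' \<le> L"
    if "graph_path G len x L y" "graph_path G len y L' z" for L L'
  proof -
    have "Inf {L. graph_path G len x L z} \<le> L + L'"
      using graph_path_trans[OF that(2,1)] by (intro cInf_lower graph_path_bdd) auto
    then show ?thesis by simp
  qed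
  then have "Inf {L. graph_path G len x L z} - L' \<le> Inf {L. graph_path G len x L y}"
    if "graph_path G len y L' z" for L'
    using graph_path_exists[OF x y] that by (intro cInf_greatest) auto
  then have "Inf {L. graph_path G len x L z} - Inf {L. graph_path G len x L y}
      \<le> Inf {L. graph_path G len y L z}"
    using graph_path_exists[OF y z] by (intro cInf_greatest) (auto simp: algebra_simps)
  then show "graph_dist G len x z \<le> graph_dist G len x y + graph_dist G len y z"
    using x y z by (simp add: graph_dist_def)
qed

lemma mspace_metric_graph_space: "mspace (metric_graph_space G len) = graph_points G len"
  and mdist_metric_graph_space: "mdist (metric_graph_space G len) = graph_dist G len"
  unfolding metric_graph_space_def
  using Metric_space.mspace_metric[OF Metric_space_graph_dist]
    Metric_space.mdist_metric[OF Metric_space_graph_dist] by auto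

end


section \<open>Homology with coefficients in a field\<close>

abbreviation field_ring :: "'f::field ring"
  where "field_ring \<equiv> \<lparr>carrier = UNIV, mult = (*), one = 1, zero = 0, add = (+)\<rparr>"

text \<open>
  \<open>S p\<close> is the set of generators in degree \<open>p\<close>, and \<open>d p k\<close> maps a generator of degree \<open>p\<close> to its
  \<open>k\<close>-th face. This covers singular simplices (with \<^const>\<open>singular_face\<close>) as well as the ordered
  simplices of a simplicial complex.
\<close>

definition chain_space :: "(nat \<Rightarrow> 'x set) \<Rightarrow> nat \<Rightarrow> ('x \<Rightarrow>\<^sub>0 'f::field) set"
  where "chain_space S p = {c. Poly_Mapping.keys c \<subseteq> S p}"

definition boundary :: "(nat \<Rightarrow> nat \<Rightarrow> 'x \<Rightarrow> 'x) \<Rightarrow> nat \<Rightarrow> ('x \<Rightarrow>\<^sub>0 'f::field) \<Rightarrow> ('x \<Rightarrow>\<^sub>0 'f)"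
  where "boundary d p c =
    (if p = 0 then 0 else
     (\<Sum>\<sigma>\<in>Poly_Mapping.keys c. \<Sum>k\<le>p.
        Poly_Mapping.single (d p k \<sigma>) ((-1) ^ k * Poly_Mapping.lookup c \<sigma>)))"

definition cycles :: "(nat \<Rightarrow> 'x set) \<Rightarrow> (nat \<Rightarrow> nat \<Rightarrow> 'x \<Rightarrow> 'x) \<Rightarrow> nat \<Rightarrow> ('x \<Rightarrow>\<^sub>0 'f::field) set"
  where "cycles S d p = {c \<in> chain_space S p. boundary d p c = 0}"

definition boundaries :: "(nat \<Rightarrow> 'x set) \<Rightarrow> (nat \<Rightarrow> nat \<Rightarrow> 'x \<Rightarrow> 'x) \<Rightarrow> nat \<Rightarrow> ('x \<Rightarrow>\<^sub>0 'f::field) set"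
  where "boundaries S d p = boundary d (Suc p) ` chain_space S (Suc p)"

text \<open>The vector space of cosets \<open>z +o B\<close> of the boundaries \<open>B\<close>, for \<open>z\<close> a cycle. Adding \<open>B\<close> in the
  scalar multiplication matters only for the scalar 0. The fields \<open>mult\<close> and \<open>one\<close> of the
  record have no meaning for a module.\<close>

definition homology ::
    "(nat \<Rightarrow> 'x set) \<Rightarrow> (nat \<Rightarrow> nat \<Rightarrow> 'x \<Rightarrow> 'x) \<Rightarrow> nat \<Rightarrow> ('f::field, ('x \<Rightarrow>\<^sub>0 'f) set) module"
  where "homology S d p =
    \<lparr>carrier = (\<lambda>z. z +o boundaries S d p) ` cycles S d p,
     mult = (\<lambda>_ _. boundaries S d p), one = boundaries S d p,
     zero = boundaries S d p,
     add = (+),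
     smult = (\<lambda>c C. Poly_Mapping.map ((*) c) ` C + boundaries S d p)\<rparr>"

abbreviation singular_homology ::
    "nat \<Rightarrow> 'a metric \<Rightarrow> ('f::field, (((nat \<Rightarrow> real) \<Rightarrow> 'a) \<Rightarrow>\<^sub>0 'f) set) module"
  where "singular_homology p X \<equiv>
    homology (\<lambda>q. singular_simplex_set q (mtopology_of X)) singular_face p"


section \<open>Lexicographically minimal bases\<close>

definition is_loop :: "'a metric \<Rightarrow> (real \<Rightarrow> 'a) \<Rightarrow> bool"
  where "is_loop X a \<longleftrightarrow> pathin (mtopology_of X) a \<and> a 0 = a 1"

definition path_length :: "'a metric \<Rightarrow> (real \<Rightarrow> 'a) \<Rightarrow> ennreal"
  where "path_length X a =
    (SUP ts \<in> {ts. sorted ts \<and> set ts \<subseteq> {0..1}}.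
       \<Sum>i<length ts - 1. ennreal (mdist X (a (ts ! i)) (a (ts ! Suc i))))"

text \<open>The singular 1-simplex of a loop uses the barycentric coordinate \<open>x 1\<close>, which runs from 0
  at the initial vertex to 1 at the final vertex of the standard 1-simplex.\<close>

definition loop_class :: "'a metric \<Rightarrow> (real \<Rightarrow> 'a) \<Rightarrow> (((nat \<Rightarrow> real) \<Rightarrow> 'a) \<Rightarrow>\<^sub>0 'f::field) set"
  where "loop_class X a =
    Poly_Mapping.single (restrict (\<lambda>x. a (x 1)) (standard_simplex 1)) 1
      +o boundaries (\<lambda>q. singular_simplex_set q (mtopology_of X)) singular_face 1"

definition is_loop_base :: "'f::field itself \<Rightarrow> 'a metric \<Rightarrow> (real \<Rightarrow> 'a) list \<Rightarrow> bool"
  where "is_loop_base _ X as \<longleftrightarrow>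
    (let H = (singular_homology 1 X :: ('f, _) module) in
      length as = vectorspace.dim field_ring H \<and>
      (\<forall>a\<in>set as. is_loop X a) \<and>
      sorted (map (path_length X) as) \<and>
      LinearCombinations.module.span field_ring H (loop_class X ` set as) = carrier H)"

definition lex_minimal_base :: "'f::field itself \<Rightarrow> 'a metric \<Rightarrow> (real \<Rightarrow> 'a) list \<Rightarrow> bool"
  where "lex_minimal_base F X as \<longleftrightarrow>
    is_loop_base F X as \<and>
    (\<forall>bs. is_loop_base F X bs \<longrightarrow>
      \<not> ord_class.lexordp (map (path_length X) bs) (map (path_length X) as))"


section \<open>Rips and Cech filtrations\<close>

text \<open>Only used for finite nonempty sets, where the supremum is a maximum.\<close>

definition diam :: "'a metric \<Rightarrow> 'a set \<Rightarrow> real"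
  where "diam X \<sigma> = (SUP (x, y) \<in> \<sigma> \<times> \<sigma>. mdist X x y)"

definition rips :: "'a metric \<Rightarrow> real \<Rightarrow> 'a set set"
  where "rips X r = {\<sigma>. finite \<sigma> \<and> \<sigma> \<noteq> {} \<and> \<sigma> \<subseteq> mspace X \<and> diam X \<sigma> < r}"

definition closed_rips :: "'a metric \<Rightarrow> real \<Rightarrow> 'a set set"
  where "closed_rips X r = {\<sigma>. finite \<sigma> \<and> \<sigma> \<noteq> {} \<and> \<sigma> \<subseteq> mspace X \<and> diam X \<sigma> \<le> r}"

definition cech :: "'a metric \<Rightarrow> real \<Rightarrow> 'a set set"
  where "cech X r =
    {\<sigma>. finite \<sigma> \<and> \<sigma> \<noteq> {} \<and> \<sigma> \<subseteq> mspace X \<and> (\<Inter>z\<in>\<sigma>. mball_of X z r) \<noteq> {}}"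

definition closed_cech :: "'a metric \<Rightarrow> real \<Rightarrow> 'a set set"
  where "closed_cech X r =
    {\<sigma>. finite \<sigma> \<and> \<sigma> \<noteq> {} \<and> \<sigma> \<subseteq> mspace X \<and> (\<Inter>z\<in>\<sigma>. mcball_of X z r) \<noteq> {}}"


section \<open>Persistence modules\<close>

text \<open>Only the parameters \<open>r > 0\<close> and the bonding maps \<open>bond P r s\<close> with \<open>0 < r \<le> s\<close> are
  relevant.\<close>

record ('f, 'v) persistence =
  vspace :: "real \<Rightarrow> ('f, 'v) module"
  bond :: "real \<Rightarrow> real \<Rightarrow> 'v \<Rightarrow> 'v"

definition persistence_iso :: "('f::field, 'v) persistence \<Rightarrow> ('f, 'w) persistence \<Rightarrow> bool"
  where "persistence_iso P Q \<longleftrightarrow>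
    (\<exists>\<phi>.
      (\<forall>r>0. \<phi> r \<in> module_hom field_ring (vspace P r) (vspace Q r) \<and>
             bij_betw (\<phi> r) (carrier (vspace P r)) (carrier (vspace Q r))) \<and>
      (\<forall>r s. 0 < r \<longrightarrow> r \<le> s \<longrightarrow>
        (\<forall>v\<in>carrier (vspace P r). \<phi> s (bond P r s v) = bond Q r s (\<phi> r v))))"

text \<open>The simplicial homology of a complex \<open>K\<close> (a set of finite nonempty sets) is computed from its
  ordered chain complex (Spanier, Algebraic Topology, Section 4.3), which needs no choice of
  orientations: the generators in degree \<open>p\<close> are the tuples \<open>[v\<^sub>0, \<dots>, v\<^sub>p]\<close>, repetitions
  permitted, whose underlying set is a simplex of \<open>K\<close>.\<close>

definition ordered_simplices :: "'a set set \<Rightarrow> nat \<Rightarrow> 'a list set"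
  where "ordered_simplices K p = {vs. length vs = Suc p \<and> set vs \<in> K}"

definition ordered_face :: "nat \<Rightarrow> nat \<Rightarrow> 'a list \<Rightarrow> 'a list"
  where "ordered_face p k vs = take k vs @ drop (Suc k) vs"

text \<open>An inclusion \<open>K r \<subseteq> K s\<close> sends the coset \<open>z +o B\<^sub>r\<close> to \<open>z +o B\<^sub>s = (z +o B\<^sub>r) + B\<^sub>s\<close>.\<close>

definition homology_persistence ::
    "nat \<Rightarrow> (real \<Rightarrow> 'a set set) \<Rightarrow> ('f::field, ('a list \<Rightarrow>\<^sub>0 'f) set) persistence"
  where "homology_persistence p K =
    \<lparr>vspace = (\<lambda>r. homology (ordered_simplices (K r)) ordered_face p),
     bond = (\<lambda>r s C. C + boundaries (ordered_simplices (K s)) ordered_face p)\<rparr>"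

definition interval_module :: "real set \<Rightarrow> ('f::field, 'f) persistence"
  where "interval_module I =
    \<lparr>vspace = (\<lambda>r. \<lparr>carrier = (if r \<in> I then UNIV else {0}),
                   mult = (*), one = 1, zero = 0, add = (+), smult = (*)\<rparr>),
     bond = (\<lambda>r s x. if r \<in> I \<and> s \<in> I then x else 0)\<rparr>"

definition persistence_sum ::
    "nat \<Rightarrow> (nat \<Rightarrow> ('f, 'v) persistence) \<Rightarrow> ('f, nat \<Rightarrow> 'v) persistence"
  where "persistence_sum n P =
    \<lparr>vspace = (\<lambda>r.
       \<lparr>carrier = (\<Pi>\<^sub>E i\<in>{..<n}. carrier (vspace (P i) r)),
        mult = (\<lambda>_ _. \<lambda>i\<in>{..<n}. \<zero>\<^bsub>vspace (P i) r\<^esub>), one = (\<lambda>i\<in>{..<n}. \<zero>\<^bsub>vspace (P i) r\<^esub>),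
        zero = (\<lambda>i\<in>{..<n}. \<zero>\<^bsub>vspace (P i) r\<^esub>),
        add = (\<lambda>v w. \<lambda>i\<in>{..<n}. v i \<oplus>\<^bsub>vspace (P i) r\<^esub> w i),
        smult = (\<lambda>c v. \<lambda>i\<in>{..<n}. c \<odot>\<^bsub>vspace (P i) r\<^esub> v i)\<rparr>),
     bond = (\<lambda>r s v. \<lambda>i\<in>{..<n}. bond (P i) r s (v i))\<rparr>"

end

(*
  Sending an edge [x, y] of a Rips or Cech complex at scale r to a geodesic from x to y, and a
  singular path to the sum of the edges between its sample points on a fine grid, gives mutually
  inverse isomorphisms between the first homology of the complex and H_1(X) / L_r. Here L_r is
  spanned by the loops that die at scale r: those of length < 3r, <= 3r, < 4r, <= 4r in the four
  cases. For Rips, a simplex {x, y, z} becomes a geodesic triangle of perimeter at most 3r, and a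
  loop of length at most 3r is cut into three arcs that span a simplex. For Cech, the triangle is
  coned off from a common point of the balls into three loops of length at most 4r, and a loop of
  length at most 4r is cut into four arcs, any two consecutive ones of which lie in a ball of
  radius r. The only local property used is that small balls are contractible, which makes
  a path homologous to the geodesic polygon through its sample points.

  If a loop that is shorter than a_i had a nonzero coordinate at a_i, it could replace a_i and the
  base would not be lexicographically minimal. Hence L_r is spanned by those a_i that die at scale
  r, and the coordinates of a class at the remaining a_i give the isomorphism with the sum of
  interval modules; geodesics do not depend on r, so it commutes with the bonding maps.
*)
theory Submission
  imports Defs
begin

section \<open>Chains as vectors\<close>

text \<open>The two maps are not symmetric. \<open>sampling\<close> depends on a mesh and on the
  complex, so it only serves to compute the kernel of \<open>realize\<close> and to show that
  \<open>realize\<close> is onto; the isomorphism itself is read off from \<open>realize\<close>.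
  Both maps involve choices and are inverse to each other only modulo boundaries. Hence most
  statements say that a difference of chains lies in a span of boundaries or killed loops, and
  cosets enter only when the homology spaces themselves have to be compared.

  Lengths are controlled without arc length parametrisations: a curve of length at most
  \<open>D\<close> is a 1-Lipschitz map on \<open>{0..D}\<close>, and an arbitrary loop is replaced
  by an inscribed geodesic polygon, which is homologous to it and no longer.

  The right end of an interval records strictness. An open complex at scale \<open>r\<close> kills
  only lengths below \<open>3 * r\<close> or \<open>4 * r\<close>, so a class of length
  \<open>l\<close> is still alive at \<open>l / 3\<close> or \<open>l / 4\<close>; a closed complex
  kills it there. The algebra relies on killing being inherited by smaller lengths, which is the
  assumption \<open>kill_mono\<close>.\<close>

definition scl :: "'f::field \<Rightarrow> ('x \<Rightarrow>\<^sub>0 'f) \<Rightarrow> ('x \<Rightarrow>\<^sub>0 'f)"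
  where "scl c = Poly_Mapping.map ((*) c)"

lemma lookup_scl [simp]: "Poly_Mapping.lookup (scl c p) x = c * Poly_Mapping.lookup p x"
  by (simp add: scl_def Poly_Mapping.map.rep_eq when_def)

interpretation pm: vector_space scl
  by unfold_locales (auto intro!: poly_mapping_eqI simp: lookup_add algebra_simps)

lemma scl_single [simp]: "scl c (Poly_Mapping.single x a) = Poly_Mapping.single x (c * a)"
  by (auto intro!: poly_mapping_eqI simp: lookup_single when_def)

lemma keys_scl: "Poly_Mapping.keys (scl c p) \<subseteq> Poly_Mapping.keys p"
  by (auto simp: in_keys_iff)

text \<open>Linear extension of a map given on generators; the boundary operators and both
  comparison maps have this form.\<close>

definition lin :: "('x \<Rightarrow> ('y \<Rightarrow>\<^sub>0 'f)) \<Rightarrow> ('x \<Rightarrow>\<^sub>0 'f) \<Rightarrow> ('y \<Rightarrow>\<^sub>0 'f::field)"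
  where "lin f c = (\<Sum>x\<in>Poly_Mapping.keys c. scl (Poly_Mapping.lookup c x) (f x))"

lemma lin_superset:
  "finite A \<Longrightarrow> Poly_Mapping.keys c \<subseteq> A \<Longrightarrow> lin f c = (\<Sum>x\<in>A. scl (Poly_Mapping.lookup c x) (f x))"
  unfolding lin_def by (rule sum.mono_neutral_left) (auto simp: in_keys_iff)

lemma linear_lin:
  fixes f :: "'a \<Rightarrow> ('b \<Rightarrow>\<^sub>0 'c::field)"
  shows "Modules.module_hom scl scl (lin f)"
proof (unfold_locales)
  fix b1 b2 :: "'a \<Rightarrow>\<^sub>0 'c" and r :: 'c
  let ?A = "Poly_Mapping.keys b1 \<union> Poly_Mapping.keys b2"
  have "lin f (b1 + b2) = (\<Sum>x\<in>?A. scl (Poly_Mapping.lookup (b1 + b2) x) (f x))"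
    by (rule lin_superset) (use Poly_Mapping.keys_add[of b1 b2] in auto)
  also have "\<dots> = (\<Sum>x\<in>?A. scl (Poly_Mapping.lookup b1 x) (f x)) + (\<Sum>x\<in>?A. scl (Poly_Mapping.lookup b2 x) (f x))"
    by (simp add: lookup_add pm.scale_left_distrib sum.distrib)
  also have "\<dots> = lin f b1 + lin f b2"
    by (subst (1 2) lin_superset[of ?A]) auto
  finally show "lin f (b1 + b2) = lin f b1 + lin f b2" .
  show "lin f (scl r b1) = scl r (lin f b1)"
    by (subst lin_superset[of "Poly_Mapping.keys b1"])
      (auto simp: keys_scl lin_def pm.scale_sum_right)
qed

lemmas lin_add = Modules.module_hom.add[OF linear_lin]
  and lin_diff = Modules.module_hom.diff[OF linear_lin]
  and lin_scl = Modules.module_hom.scale[OF linear_lin]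
  and lin_sum = Modules.module_hom.sum[OF linear_lin]
  and lin_zero = Modules.module_hom.zero[OF linear_lin]

abbreviation gen :: "'x \<Rightarrow> ('x \<Rightarrow>\<^sub>0 'f::field)"
  where "gen x \<equiv> Poly_Mapping.single x 1"

lemma lin_gen [simp]: "lin f (gen x) = f x"
  by (simp add: lin_def)

lemma chain_eq_lin: "c = lin gen c"
  by (rule poly_mapping_eqI) (simp add: lin_def lookup_sum lookup_single when_def sum.delta in_keys_iff)

lemma chain_space_span: "(chain_space S p :: ('a \<Rightarrow>\<^sub>0 'b::field) set) = pm.span (gen ` S p)"
proof
  show "(chain_space S p :: ('a \<Rightarrow>\<^sub>0 'b) set) \<subseteq> pm.span (gen ` S p)"
  proof
    fix c :: "'a \<Rightarrow>\<^sub>0 'b::field" assume "c \<in> chain_space S p"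
    then have "lin gen c \<in> pm.span (gen ` S p)"
      unfolding lin_def chain_space_def
      by (intro pm.span_sum pm.span_scale pm.span_base) auto
    then show "c \<in> pm.span (gen ` S p)" using chain_eq_lin[of c] by simp
  qed
  have "pm.subspace (chain_space S p :: ('a \<Rightarrow>\<^sub>0 'b) set)"
  proof (rule pm.subspaceI)
    fix x y :: "'a \<Rightarrow>\<^sub>0 'b" and c
    show "x + y \<in> chain_space S p" if "x \<in> chain_space S p" "y \<in> chain_space S p"
      using that Poly_Mapping.keys_add[of x y] unfolding chain_space_def by blast
    show "scl c x \<in> chain_space S p" if "x \<in> chain_space S p"
      using that keys_scl[of c x] unfolding chain_space_def by blast
  qed (simp add: chain_space_def)
  then show "pm.span (gen ` S p) \<subseteq> (chain_space S p :: ('a \<Rightarrow>\<^sub>0 'b) set)"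
    by (intro pm.span_minimal) (auto simp: chain_space_def)
qed

lemma boundary_lin:
  assumes "0 < p"
  shows "boundary d p = lin (\<lambda>\<sigma>. \<Sum>k\<le>p. Poly_Mapping.single (d p k \<sigma>) ((-1) ^ k))"
  using assms by (auto simp: boundary_def lin_def pm.scale_sum_right mult.commute)

lemma boundary_1:
  "boundary d 1 = lin (\<lambda>\<sigma>. gen (d 1 0 \<sigma>) - gen (d 1 1 \<sigma>))"
  by (simp add: boundary_lin single_uminus)

lemma boundary_2:
  "boundary d 2 = lin (\<lambda>\<sigma>. gen (d 2 0 \<sigma>) - gen (d 2 1 \<sigma>) + gen (d 2 2 \<sigma>))"
  by (simp add: boundary_lin eval_nat_numeral single_uminus)

text \<open>As a span of triangle boundaries: membership is shown by exhibiting triangles, and a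
  linear map is controlled by its values on them.\<close>

lemma boundaries_1:
  "boundaries S d 1 = pm.span ((\<lambda>\<sigma>. gen (d 2 0 \<sigma>) - gen (d 2 1 \<sigma>) + gen (d 2 2 \<sigma>)) ` S 2)"
  unfolding boundaries_def chain_space_span
  by (simp add: numeral_2_eq_2[symmetric] boundary_2
      Modules.module_hom.span_image[OF linear_lin, symmetric] image_image)

lemma lin_span_subset:
  assumes "c \<in> pm.span (gen ` A)" "\<And>x. x \<in> A \<Longrightarrow> f x \<in> pm.span B"
  shows "lin f c \<in> pm.span B"
proof -
  have "lin f c \<in> pm.span (f ` A)"
    using assms(1) Modules.module_hom.span_image[OF linear_lin, of f "gen ` A"]
    by (simp add: image_image)
  then show ?thesis using assms(2) pm.span_minimal[of "f ` A" "pm.span B"] by auto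
qed

lemma lin_cong_span:
  assumes "c \<in> pm.span (gen ` A)" "\<And>x. x \<in> A \<Longrightarrow> f x - g x \<in> pm.span B"
  shows "lin f c - lin g c \<in> pm.span B"
proof -
  have "lin f c - lin g c = lin (\<lambda>x. f x - g x) c"
    by (simp add: lin_def sum_subtractf pm.scale_right_diff_distrib)
  moreover have "lin (\<lambda>x. f x - g x) c \<in> pm.span B"
    by (rule lin_span_subset[OF assms(1)]) (rule assms(2))
  ultimately show ?thesis by (rule ssubst)
qed

lemma cycles_1:
  "c \<in> cycles S d 1 \<longleftrightarrow> c \<in> pm.span (gen ` S 1) \<and> boundary d 1 c = 0"
  by (simp add: cycles_def chain_space_span)

lemma subspace_cycles_1: "pm.subspace (cycles S d 1 :: ('a \<Rightarrow>\<^sub>0 'b::field) set)"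
proof (rule pm.subspaceI)
  show "0 \<in> cycles S d 1"
    unfolding cycles_1 boundary_1 by (simp add: lin_zero pm.span_zero)
next
  fix x y :: "'a \<Rightarrow>\<^sub>0 'b" assume "x \<in> cycles S d 1" "y \<in> cycles S d 1"
  then show "x + y \<in> cycles S d 1"
    unfolding cycles_1 boundary_1 by (simp add: lin_add pm.span_add)
next
  fix c and x :: "'a \<Rightarrow>\<^sub>0 'b" assume "x \<in> cycles S d 1"
  then show "scl c x \<in> cycles S d 1"
    unfolding cycles_1 boundary_1 by (simp add: lin_scl pm.span_scale)
qed

section \<open>Singular chains of paths\<close>

declare One_nat_def [simp del]

abbreviation simplices :: "'a topology \<Rightarrow> nat \<Rightarrow> ((nat \<Rightarrow> real) \<Rightarrow> 'a) set"
  where "simplices T \<equiv> \<lambda>q. singular_simplex_set q T"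

abbreviation bds :: "'a topology \<Rightarrow> (((nat \<Rightarrow> real) \<Rightarrow> 'a) \<Rightarrow>\<^sub>0 'f::field) set"
  where "bds T \<equiv> boundaries (simplices T) singular_face 1"

text \<open>Singular simplices are extensional, hence the restriction; by it the simplex depends on
  \<open>p\<close> over the unit interval only.\<close>

definition path_simplex :: "(real \<Rightarrow> 'a) \<Rightarrow> (nat \<Rightarrow> real) \<Rightarrow> 'a"
  where "path_simplex p = restrict (\<lambda>x. p (x 1)) (standard_simplex 1)"

definition simplex_path :: "((nat \<Rightarrow> real) \<Rightarrow> 'a) \<Rightarrow> real \<Rightarrow> 'a"
  where "simplex_path \<sigma> t = \<sigma> (\<lambda>i. if i = 0 then 1 - t else if i = 1 then t else 0)"

definition point_simplex :: "'a \<Rightarrow> (nat \<Rightarrow> real) \<Rightarrow> 'a"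
  where "point_simplex y = restrict (\<lambda>_. y) (standard_simplex 0)"

text \<open>Affine reparametrisation to the unit interval; \<open>b < a\<close> is allowed and gives
  the reversed path.\<close>

definition segment :: "(real \<Rightarrow> 'a) \<Rightarrow> real \<Rightarrow> real \<Rightarrow> ((nat \<Rightarrow> real) \<Rightarrow> 'a) \<Rightarrow>\<^sub>0 'f::field"
  where "segment p a b = gen (path_simplex (\<lambda>t. p (a + t * (b - a))))"

lemma standard_simplex_1D:
  assumes "x \<in> standard_simplex 1"
  shows "x 0 = 1 - x 1" "0 \<le> x 1" "x 1 \<le> 1" "\<And>i. 1 < i \<Longrightarrow> x i = 0"
  using assms by (auto simp: standard_simplex_def One_nat_def)

lemma standard_simplex_1E:
  assumes "x \<in> standard_simplex 1"
  shows "x = (\<lambda>i. if i = 0 then 1 - x 1 else if i = 1 then x 1 else 0)"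
  using standard_simplex_1D[OF assms] by (auto simp: fun_eq_iff)

lemma standard_simplex_1I:
  assumes "t \<in> {0..1}"
  shows "(\<lambda>i. if i = 0 then 1 - t else if i = 1 then t else 0) \<in> standard_simplex 1"
  using assms by (auto simp: standard_simplex_def One_nat_def)

lemma path_simplex_cong:
  "(\<And>t. t \<in> {0..1} \<Longrightarrow> p t = q t) \<Longrightarrow> path_simplex p = path_simplex q"
  by (auto simp: path_simplex_def fun_eq_iff restrict_def standard_simplex_1D)

lemma segment_cong:
  "(\<And>t. t \<in> {0..1} \<Longrightarrow> p (a + t * (b - a)) = q (c + t * (d - c))) \<Longrightarrow> segment p a b = segment q c d"
  by (auto simp: segment_def intro!: arg_cong[where f = "\<lambda>s. Poly_Mapping.single s _"] path_simplex_cong)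

lemma segment_01: "segment p 0 1 = gen (path_simplex p)"
  by (simp add: segment_def)

lemma continuous_map_coordinate:
  "continuous_map (subtopology (powertop_real UNIV) S) euclideanreal (\<lambda>x. x i)"
  by (intro continuous_map_from_subtopology continuous_map_product_projection) auto

lemma path_simplex_in:
  assumes "pathin T p"
  shows "path_simplex p \<in> simplices T 1"
proof -
  have "continuous_map (subtopology (powertop_real UNIV) (standard_simplex 1)) (top_of_set {0..1}) (\<lambda>x. x 1)"
    by (auto simp: continuous_map_in_subtopology standard_simplex_1D intro!: continuous_map_coordinate)
  from continuous_map_compose[OF this, of T p] assms
  have "continuous_map (subtopology (powertop_real UNIV) (standard_simplex 1)) T (\<lambda>x. p (x 1))"
    by (simp add: pathin_def o_def)
  then have "continuous_map (subtopology (powertop_real UNIV) (standard_simplex 1)) T (path_simplex p)"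
    by (rule continuous_map_eq) (simp add: path_simplex_def)
  then show ?thesis by (simp add: singular_simplex_def path_simplex_def)
qed

lemma simplex_path_pathin:
  assumes "\<sigma> \<in> simplices T 1"
  shows "pathin T (simplex_path \<sigma>)"
proof -
  let ?g = "\<lambda>t::real. (\<lambda>i::nat. if i = 0 then 1 - t else if i = 1 then t else 0)"
  have "continuous_map euclideanreal euclideanreal (\<lambda>t. ?g t i)" for i
    by (cases "i = 0"; cases "i = 1") (auto intro!: continuous_intros)
  then have "continuous_map (top_of_set {0..1}) (powertop_real UNIV) ?g"
    unfolding continuous_map_componentwise_UNIV by (intro allI continuous_map_from_subtopology)
  then have "continuous_map (top_of_set {0..1}) (subtopology (powertop_real UNIV) (standard_simplex 1)) ?g"
    using standard_simplex_1I by (simp add: continuous_map_in_subtopology Pi_iff)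
  from continuous_map_compose[OF this, of T \<sigma>] assms show ?thesis
    by (simp add: singular_simplex_def pathin_def o_def simplex_path_def[abs_def])
qed

lemma path_simplex_simplex_path:
  assumes "\<sigma> \<in> simplices T 1"
  shows "path_simplex (simplex_path \<sigma>) = \<sigma>"
proof
  fix x
  show "path_simplex (simplex_path \<sigma>) x = \<sigma> x"
  proof (cases "x \<in> standard_simplex 1")
    case True
    then show ?thesis
      using arg_cong[OF standard_simplex_1E[OF True], of \<sigma>]
      by (simp add: path_simplex_def simplex_path_def)
  next
    case False
    then show ?thesis using assms by (auto simp: path_simplex_def singular_simplex_def extensional_def)
  qed
qed

lemma simplex_path_path_simplex:
  "t \<in> {0..1} \<Longrightarrow> simplex_path (path_simplex p) t = p t"
  using standard_simplex_1I[of t] by (simp add: path_simplex_def simplex_path_def)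

lemma singular_face_2: "singular_face 2 k f = restrict (f \<circ> simplical_face k) (standard_simplex 1)"
  by (simp add: singular_face_def One_nat_def)

lemma boundary_path_simplex:
  "singular_face 1 0 (path_simplex p) = point_simplex (p 1)"
  "singular_face 1 1 (path_simplex p) = point_simplex (p 0)"
  by (auto simp: singular_face_def path_simplex_def point_simplex_def fun_eq_iff
      standard_simplex_0 One_nat_def simplical_face_def standard_simplex_def restrict_def)

lemma boundary_gen_path_simplex:
  "boundary singular_face 1 (gen (path_simplex p)) =
    gen (point_simplex (p 1)) - gen (point_simplex (p 0))"
  using boundary_path_simplex[of p] by (simp add: boundary_1)

lemma path_simplex_cycle:
  assumes "pathin T p" "p 0 = p 1"
  shows "gen (path_simplex p) \<in> cycles (simplices T) singular_face 1"
  using path_simplex_in[OF assms(1)] assms(2) boundary_gen_path_simplex[of p]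
  by (simp add: cycles_1 pm.span_base)

lemma bds_span:
  "bds T = pm.span ((\<lambda>\<sigma>. gen (singular_face 2 0 \<sigma>) - gen (singular_face 2 1 \<sigma>)
    + gen (singular_face 2 2 \<sigma>)) ` simplices T 2)"
  by (rule boundaries_1)

lemma convex_sum_3:
  assumes "convex C" "A \<in> C" "B \<in> C" "D \<in> C" "0 \<le> a" "0 \<le> b" "0 \<le> c" "a + b + c = 1"
  shows "a *\<^sub>R A + b *\<^sub>R B + c *\<^sub>R D \<in> C"
proof -
  have "convex hull {A, B, D} \<subseteq> C" using assms by (intro hull_minimal) auto
  then show ?thesis using assms by (auto simp: convex_hull_3)
qed

text \<open>The affine triangle \<open>A B D\<close> is pushed forward by \<open>h\<close>. With
  \<open>C\<close> an interval this subdivides and reverses paths, with \<open>C\<close> a square it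
  turns homotopies into boundaries.\<close>

lemma triangle_boundary:
  fixes h :: "'b::real_normed_vector \<Rightarrow> 'a"
  assumes C: "convex C" and h: "continuous_map (top_of_set C) T h" and ABD: "A \<in> C" "B \<in> C" "D \<in> C"
  shows "gen (path_simplex (\<lambda>t. h (B + t *\<^sub>R (D - B)))) - gen (path_simplex (\<lambda>t. h (A + t *\<^sub>R (D - A))))
    + gen (path_simplex (\<lambda>t. h (A + t *\<^sub>R (B - A)))) \<in> bds T"
proof -
  define g where "g x = x 0 *\<^sub>R A + x 1 *\<^sub>R B + x 2 *\<^sub>R D" for x :: "nat \<Rightarrow> real"
  define \<tau> where "\<tau> = restrict (h \<circ> g) (standard_simplex 2)"
  have *: "continuous_map (subtopology (powertop_real UNIV) S) euclidean (\<lambda>x. x i *\<^sub>R Y)" for S i and Y :: 'b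
    using continuous_map_compose[OF continuous_map_coordinate, of euclidean "\<lambda>r. r *\<^sub>R Y" S i]
    by (simp add: o_def continuous_intros)
  have "g \<in> standard_simplex 2 \<rightarrow> C"
  proof
    fix x :: "nat \<Rightarrow> real" assume "x \<in> standard_simplex 2"
    then have x: "0 \<le> x 0" "0 \<le> x 1" "0 \<le> x 2" "x 0 + x 1 + x 2 = 1"
      by (auto simp: standard_simplex_def numeral_2_eq_2 One_nat_def)
    show "g x \<in> C"
      unfolding g_def by (rule convex_sum_3[OF C]) (use ABD x in auto)
  qed
  then have "continuous_map (subtopology (powertop_real UNIV) (standard_simplex 2)) (top_of_set C) g"
    unfolding g_def continuous_map_in_subtopology
    by (auto intro!: continuous_map_add *)
  then have "continuous_map (subtopology (powertop_real UNIV) (standard_simplex 2)) T \<tau>"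
    using continuous_map_compose[OF _ h] by (auto simp: \<tau>_def intro: continuous_map_eq)
  then have \<tau>: "\<tau> \<in> simplices T 2" by (simp add: singular_simplex_def \<tau>_def)
  have s: "simplical_face k x \<in> standard_simplex 2" if "x \<in> standard_simplex 1" "k \<le> 2" for x :: "nat \<Rightarrow> real" and k
    using simplical_face_in_standard_simplex[of 2 k x] that by (simp add: One_nat_def)
  have f: "singular_face 2 k \<tau> x = (if x \<in> standard_simplex 1 then h (g (simplical_face k x)) else undefined)"
    if "k \<le> 2" for k x
    using s that by (auto simp: singular_face_2 \<tau>_def restrict_def)
  have "singular_face 2 0 \<tau> = path_simplex (\<lambda>t. h (B + t *\<^sub>R (D - B)))"
    by (rule ext) (auto simp: f path_simplex_def g_def simplical_face_def standard_simplex_1D One_nat_def[symmetric] algebra_simps)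
  moreover have "singular_face 2 1 \<tau> = path_simplex (\<lambda>t. h (A + t *\<^sub>R (D - A)))"
    by (rule ext) (auto simp: f path_simplex_def g_def simplical_face_def standard_simplex_1D One_nat_def[symmetric] algebra_simps)
  moreover have "singular_face 2 2 \<tau> = path_simplex (\<lambda>t. h (A + t *\<^sub>R (B - A)))"
    by (rule ext) (auto simp: f path_simplex_def g_def simplical_face_def standard_simplex_1D One_nat_def[symmetric] algebra_simps)
  ultimately show ?thesis
    unfolding bds_span using \<tau> by (intro pm.span_base) force
qed

text \<open>The coordinates \<open>(1 - u, u * (1 - v), u * v)\<close> turn a 2-simplex into a
  square with one side collapsed to vertex 0. A square carries the uniform grid on which paths are
  sampled.\<close>

lemma simplex_square:
  assumes "\<tau> \<in> simplices T 2"
  obtains h :: "real \<times> real \<Rightarrow> 'a" where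
    "continuous_map (top_of_set ({0..1} \<times> {0..1})) T h"
    "singular_face 2 0 \<tau> = path_simplex (\<lambda>t. h (1, t))"
    "singular_face 2 1 \<tau> = path_simplex (\<lambda>t. h (t, 1))"
    "singular_face 2 2 \<tau> = path_simplex (\<lambda>t. h (t, 0))"
    "\<And>t. h (0, t) = h (0, 0)"
proof
  let ?g = "\<lambda>z::real \<times> real. (\<lambda>i::nat. if i = 0 then 1 - fst z else if i = 1 then fst z * (1 - snd z)
    else if i = 2 then fst z * snd z else 0)"
  have "continuous_map euclidean euclideanreal (\<lambda>z. ?g z i)" for i
    by (cases "i = 0"; cases "i = 1"; cases "i = 2") (auto intro!: continuous_intros)
  moreover have "?g z \<in> standard_simplex 2" if z: "z \<in> {0..1} \<times> {0..1}" for z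
  proof -
    have "fst z * snd z \<le> fst z" "0 \<le> fst z * snd z"
      using z mult_left_le[of "snd z" "fst z"] mult_nonneg_nonneg[of "fst z" "snd z"] by auto
    moreover from this have "fst z \<le> 1 + fst z * snd z" "fst z * snd z \<le> 1" using z by auto
    ultimately show ?thesis
      using z by (auto simp: standard_simplex_def numeral_2_eq_2 algebra_simps One_nat_def)
  qed
  moreover from calculation(1) have "continuous_map (top_of_set ({0..1} \<times> {0..1})) (powertop_real UNIV) ?g"
    unfolding continuous_map_componentwise_UNIV by (intro allI continuous_map_from_subtopology)
  ultimately have "continuous_map (top_of_set ({0..1} \<times> {0..1})) (subtopology (powertop_real UNIV) (standard_simplex 2)) ?g"
    by (simp add: continuous_map_in_subtopology Pi_iff)
  from continuous_map_compose[OF this, of T \<tau>] assms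
  show "continuous_map (top_of_set ({0..1} \<times> {0..1})) T (\<tau> \<circ> ?g)"
    by (simp add: singular_simplex_def)
  have *: "simplical_face 0 x = ?g (1, x 1)" "simplical_face 1 x = ?g (x 1, 1)"
    "simplical_face 2 x = ?g (x 1, 0)" if "x \<in> standard_simplex 1" for x :: "nat \<Rightarrow> real"
    using standard_simplex_1D[OF that] by (auto simp: simplical_face_def fun_eq_iff One_nat_def[symmetric])
  show "singular_face 2 0 \<tau> = path_simplex (\<lambda>t. (\<tau> \<circ> ?g) (1, t))"
    "singular_face 2 1 \<tau> = path_simplex (\<lambda>t. (\<tau> \<circ> ?g) (t, 1))"
    "singular_face 2 2 \<tau> = path_simplex (\<lambda>t. (\<tau> \<circ> ?g) (t, 0))"
    by (rule ext, simp add: singular_face_2 path_simplex_def restrict_def *)+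
  show "(\<tau> \<circ> ?g) (0, t) = (\<tau> \<circ> ?g) (0, 0)" for t by (simp cong: if_cong)
qed

lemma segment_triangle:
  assumes "convex C" "continuous_map (top_of_set C) T p" "a \<in> C" "b \<in> C" "c \<in> C"
  shows "segment p b c - segment p a c + segment p a b \<in> bds T"
  using triangle_boundary[OF assms] by (simp add: segment_def)

lemma subspace_bds: "pm.subspace (bds T)"
  unfolding bds_span by (rule pm.subspace_span)

text \<open>In the degenerate triangle with all corners \<open>a\<close>, two of the three equal
  sides cancel.\<close>

lemma segment_refl:
  assumes "convex C" "continuous_map (top_of_set C) T p" "a \<in> C"
  shows "segment p a a \<in> bds T"
  using segment_triangle[OF assms(1,2,3,3,3)] by simp

lemma segment_rev:
  assumes "convex C" "continuous_map (top_of_set C) T p" "a \<in> C" "b \<in> C"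
  shows "segment p a b + segment p b a \<in> bds T"
  using pm.subspace_add[OF subspace_bds segment_triangle[OF assms(1-3,4,3)] segment_refl[OF assms(1-3)]]
  by (simp add: algebra_simps)

lemma segment_sum:
  assumes "convex C" "continuous_map (top_of_set C) T p" "\<And>i. i \<le> n \<Longrightarrow> t i \<in> C"
  shows "(\<Sum>i<n. segment p (t i) (t (Suc i))) - segment p (t 0) (t n) \<in> bds T"
  using assms(3)
proof (induction n)
  case 0
  then show ?case using pm.subspace_neg[OF subspace_bds segment_refl[OF assms(1,2)]] by simp
next
  case (Suc n)
  from pm.subspace_add[OF subspace_bds Suc.IH segment_triangle[OF assms(1,2), of "t 0" "t n" "t (Suc n)"]] Suc.prems
  show ?case by (simp add: algebra_simps)
qed

section \<open>Sampling paths in a metric space\<close>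

text \<open>The target is an abstract metric, so Heine-Cantor is applied to the real function
  \<open>D (u, v) = mdist X (h u) (h v)\<close> on the compact \<open>C \<times> C\<close>,
  comparing \<open>(u, v)\<close> with the diagonal point \<open>(u, u)\<close>.\<close>

lemma uniformly_continuous_mdist:
  fixes h :: "'b::metric_space \<Rightarrow> 'a"
  assumes h: "continuous_map (top_of_set C) (mtopology_of X) h" and C: "compact C" and e: "0 < e"
  obtains \<delta> where "0 < \<delta>" "\<And>u v. u \<in> C \<Longrightarrow> v \<in> C \<Longrightarrow> dist u v < \<delta> \<Longrightarrow> mdist X (h u) (h v) < e"
proof -
  define D where "D z = mdist X (h (fst z)) (h (snd z))" for z
  have "continuous_map (top_of_set (C \<times> C)) (top_of_set C) fst"
    "continuous_map (top_of_set (C \<times> C)) (top_of_set C) snd"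
    by (auto simp: continuous_map_in_subtopology intro!: continuous_intros)
  from this[THEN continuous_map_compose, OF h]
  have "continuous_map (top_of_set (C \<times> C)) euclideanreal D"
    unfolding D_def o_def by (rule continuous_map_mdist)
  then have "uniformly_continuous_on (C \<times> C) D"
    using C by (intro compact_uniformly_continuous compact_Times) auto
  then obtain \<delta> where \<delta>: "0 < \<delta>"
    "\<And>x y. x \<in> C \<times> C \<Longrightarrow> y \<in> C \<times> C \<Longrightarrow> dist y x < \<delta> \<Longrightarrow> dist (D y) (D x) < e"
    unfolding uniformly_continuous_on_def using e by metis
  have M: "h u \<in> mspace X" if "u \<in> C" for u
    using h that by (auto simp: continuous_map_def)
  show ?thesis
  proof (rule that[OF \<delta>(1)])
    fix u v assume uv: "u \<in> C" "v \<in> C" "dist u v < \<delta>"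
    then have "dist (D (u, v)) (D (u, u)) < e"
      by (intro \<delta>(2)) (auto simp: dist_Pair_Pair dist_commute)
    moreover have "D (u, u) = 0" using M[OF uv(1)] by (simp add: D_def)
    ultimately show "mdist X (h u) (h v) < e" by (simp add: D_def dist_real_def)
  qed
qed

section \<open>Triangles, edge paths and samples in the ordered chain complex\<close>

lemma ordered_face_simps [simp]:
  "ordered_face 1 0 [a, b] = [b]" "ordered_face 1 1 [a, b] = [a]"
  "ordered_face 2 0 [a, b, c] = [b, c]" "ordered_face 2 1 [a, b, c] = [a, c]"
  "ordered_face 2 2 [a, b, c] = [a, b]"
  by (auto simp: ordered_face_def One_nat_def numeral_2_eq_2)

abbreviation obds :: "'a set set \<Rightarrow> ('a list \<Rightarrow>\<^sub>0 'f::field) set"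
  where "obds K \<equiv> boundaries (ordered_simplices K) ordered_face 1"

lemma obds_span:
  "obds K = pm.span ((\<lambda>(a, b, c). gen [b, c] - gen [a, c] + gen [a, b]) ` {(a, b, c). {a, b, c} \<in> K})"
proof -
  have "ordered_simplices K 2 = (\<lambda>(a, b, c). [a, b, c]) ` {(a, b, c). {a, b, c} \<in> K}"
    by (auto simp: ordered_simplices_def length_Suc_conv numeral_2_eq_2 One_nat_def image_iff)
  then show ?thesis
    unfolding boundaries_1 by (simp add: image_image case_prod_unfold)
qed

lemma subspace_obds: "pm.subspace (obds K)"
  unfolding obds_span by (rule pm.subspace_span)

lemma obds_triangle: "{a, b, c} \<in> K \<Longrightarrow> gen [b, c] - gen [a, c] + gen [a, b] \<in> obds K"
  unfolding obds_span by (intro pm.span_base) force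

lemma obds_refl: "{a} \<in> K \<Longrightarrow> gen [a, a] \<in> obds K"
  using obds_triangle[of a a a K] by simp

lemma obds_chain:
  assumes "\<And>i j k. i \<le> n \<Longrightarrow> j \<le> n \<Longrightarrow> k \<le> n \<Longrightarrow> {y i, y j, y k} \<in> K"
  shows "(\<Sum>i<n. gen [y i, y (Suc i)]) - gen [y 0, y n] \<in> obds K"
  using assms
proof (induction n)
  case 0
  then show ?case using pm.subspace_neg[OF subspace_obds obds_refl[of "y 0" K]] by simp
next
  case (Suc n)
  from pm.subspace_add[OF subspace_obds Suc.IH obds_triangle[of "y 0" "y n" "y (Suc n)"]] Suc.prems
  show ?case by (simp add: algebra_simps)
qed

definition sample :: "nat \<Rightarrow> (real \<Rightarrow> 'a) \<Rightarrow> ('a list \<Rightarrow>\<^sub>0 'f::field)"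
  where "sample N p = (\<Sum>i<N. gen [p (i / N), p (Suc i / N)])"

text \<open>The bound concerns any two parameters at distance at most \<open>1 / N\<close>, not just
  neighbouring grid points, so that all points of a subdivided grid interval are pairwise
  close.\<close>

definition fine :: "'a metric \<Rightarrow> real \<Rightarrow> nat \<Rightarrow> (real \<Rightarrow> 'a) \<Rightarrow> bool"
  where "fine X e N p \<longleftrightarrow> 0 < N \<and>
    (\<forall>s\<in>{0..1}. \<forall>t\<in>{0..1}. \<bar>s - t\<bar> \<le> 1 / N \<longrightarrow> mdist X (p s) (p t) < e)"

lemma sample_cong: "(\<And>t. t \<in> {0..1} \<Longrightarrow> p t = q t) \<Longrightarrow> sample N p = sample N q"
  unfolding sample_def by (intro sum.cong HOL.refl arg_cong2[where f = "\<lambda>a b. gen [a, b]"]) auto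

lemma boundary_sample:
  assumes "0 < N"
  shows "boundary ordered_face 1 (sample N p) = gen [p 1] - gen [p 0]"
proof -
  have "boundary ordered_face 1 (sample N p) = (\<Sum>i<N. gen [p (Suc i / N)] - gen [p (i / N)])"
    by (simp add: sample_def boundary_1 lin_sum)
  also have "\<dots> = gen [p (N / N)] - gen [p (0 / N)]"
    using sum_lessThan_telescope[of "\<lambda>i. gen [p (i / N)]" N] by simp
  finally show ?thesis using assms by simp
qed

text \<open>Isolates the property of Rips and Cech complexes that makes sampling independent of the
  mesh and compatible with boundaries.\<close>

locale fine_complex =
  fixes X :: "'a metric" and K :: "'a set set" and \<epsilon> :: real
  assumes eps: "0 < \<epsilon>"
    and small: "finite S \<Longrightarrow> S \<noteq> {} \<Longrightarrow> S \<subseteq> mspace X \<Longrightarrow>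
      (\<And>x y. x \<in> S \<Longrightarrow> y \<in> S \<Longrightarrow> mdist X x y < \<epsilon>) \<Longrightarrow> S \<in> K"
begin

lemma fine_exists:
  assumes "pathin (mtopology_of X) p"
  obtains N0 where "\<And>N. N0 \<le> N \<Longrightarrow> fine X \<epsilon> N p"
proof -
  obtain \<delta> where \<delta>: "0 < \<delta>"
    "\<And>u v. u \<in> {0..1} \<Longrightarrow> v \<in> {0..1} \<Longrightarrow> dist u v < \<delta> \<Longrightarrow> mdist X (p u) (p v) < \<epsilon>"
    using uniformly_continuous_mdist[OF assms[unfolded pathin_def] compact_Icc eps] by metis
  obtain N0 :: nat where N0: "1 / \<delta> < N0" using reals_Archimedean2 by blast
  show ?thesis
  proof (rule that)
    fix N assume "N0 \<le> N"
    then have "1 / \<delta> < N" using N0 by (meson less_le_trans of_nat_le_iff)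
    moreover from this have "0 < N" using \<delta>(1)
      by (cases N) (auto simp: divide_less_0_iff)
    ultimately have "0 < N" "1 / N < \<delta>" using \<delta>(1) by (auto simp: field_simps)
    then show "fine X \<epsilon> N p" using \<delta>(2) by (auto simp: fine_def dist_real_def)
  qed
qed

text \<open>The points that subdivide one grid interval are pairwise closer than
  \<open>\<epsilon>\<close>, so any three of them span a simplex and \<open>obds_chain\<close>
  contracts the \<open>M\<close> small edges to one.\<close>

lemma sample_refine:
  assumes p: "p \<in> {0..1} \<rightarrow> mspace X" and N: "fine X \<epsilon> N p" and M: "0 < M"
  shows "(sample (N * M) p - sample N p :: 'a list \<Rightarrow>\<^sub>0 'f::field) \<in> obds K"
proof -
  let ?y = "\<lambda>m i. p (real (m * M + i) / real (N * M))"
  have N0: "0 < N" using N by (simp add: fine_def)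
  have "(\<Sum>i<M. gen [?y m i, ?y m (Suc i)]) - (gen [?y m 0, ?y m M] :: 'a list \<Rightarrow>\<^sub>0 'f) \<in> obds K" if m: "m < N" for m
  proof (rule obds_chain)
    fix i j k assume ijk: "i \<le> M" "j \<le> M" "k \<le> M"
    have *: "real (m * M + i) / real (N * M) \<in> {0..1}" if "i \<le> M" for i
    proof -
      have "m * M + i \<le> (N - 1) * M + M" using m that by (intro add_mono mult_right_mono) auto
      also have "\<dots> = N * M" using N0 by (cases N) auto
      finally show ?thesis using N0 M by (simp add: divide_le_eq_1 del: of_nat_add of_nat_mult)
    qed
    have **: "mdist X (?y m i) (?y m j) < \<epsilon>" if "i \<le> M" "j \<le> M" for i j
    proof -
      have "\<bar>real (m * M + i) / real (N * M) - real (m * M + j) / real (N * M)\<bar> = \<bar>real i - real j\<bar> / (N * M)"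
        using N0 M by (simp add: diff_divide_distrib[symmetric] abs_divide)
      also have "\<dots> \<le> M / (N * M)" using that by (intro divide_right_mono) auto
      also have "\<dots> = 1 / N" using M by simp
      finally show ?thesis using N * that by (auto simp: fine_def)
    qed
    show "{?y m i, ?y m j, ?y m k} \<in> K"
      using ** ijk p * by (intro small) (auto simp: Pi_iff)
  qed
  then have "(\<Sum>m<N. (\<Sum>i<M. gen [?y m i, ?y m (Suc i)]) - (gen [?y m 0, ?y m M] :: 'a list \<Rightarrow>\<^sub>0 'f)) \<in> obds K"
    by (intro pm.subspace_sum[OF subspace_obds]) auto
  \<comment> \<open>Step \<open>i\<close> in grid interval \<open>m\<close> is step
    \<open>m * M + i\<close> of the fine sample, so the double sum is a regrouping.\<close>
  moreover have "(\<Sum>m<N. \<Sum>i<M. gen [?y m i, ?y m (Suc i)]) = (sample (N * M) p :: 'a list \<Rightarrow>\<^sub>0 'f)"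
  proof -
    have "(\<Sum>i<M. gen [?y m i, ?y m (Suc i)]) =
      (\<Sum>i=m*M..<m*M+M. gen [p (i / real (N * M)), p (Suc i / real (N * M))] :: 'a list \<Rightarrow>\<^sub>0 'f)" for m
      by (subst sum.atLeastLessThan_shift_0) (simp add: atLeast0LessThan add_ac del: of_nat_add of_nat_mult of_nat_Suc)
    then show ?thesis
      unfolding sample_def sum.nat_group[of "\<lambda>i. gen [p (i / real (N * M)), p (Suc i / real (N * M))]", symmetric]
      by (rule sum.cong[OF HOL.refl])
  qed
  moreover have "(\<Sum>m<N. gen [?y m 0, ?y m M]) = (sample N p :: 'a list \<Rightarrow>\<^sub>0 'f)"
  proof -
    have "real (m * M + M) / real (N * M) = Suc m / N" for m
    proof -
      have "real (m * M + M) / real (N * M) = (real (Suc m) * real M) / (real N * real M)"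
        by (simp add: algebra_simps)
      then show ?thesis using M by simp
    qed
    then have "?y m M = p (Suc m / N)" for m by (simp only:)
    moreover have "?y m 0 = p (m / N)" for m using M by simp
    ultimately show ?thesis unfolding sample_def by (simp only:)
  qed
  ultimately show ?thesis by (simp add: sum_subtractf)
qed

text \<open>Both samples are compared with their common refinement into \<open>N * M\<close>
  steps.\<close>

lemma sample_independent:
  assumes p: "p \<in> {0..1} \<rightarrow> mspace X" and "fine X \<epsilon> N p" "fine X \<epsilon> M p"
  shows "sample N p - sample M p \<in> obds K"
proof -
  have "0 < N" "0 < M" using assms by (auto simp: fine_def)
  then have "(sample (M * N) p - sample M p) - (sample (N * M) p - sample N p) \<in> obds K"
    using assms by (intro pm.subspace_diff[OF subspace_obds] sample_refine)
  then show ?thesis by (simp add: mult.commute)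
qed

text \<open>A discrete homotopy over a grid. A threshold \<open>N0\<close> rather than a single
  \<open>N\<close> leaves room to make the grid fine for the boundary paths as well.\<close>

lemma sample_square:
  assumes h: "continuous_map (top_of_set ({0..1} \<times> {0..1})) (mtopology_of X) h"
    and h0: "\<And>t. h (0, t) = h (0, 0)"
  obtains N0 where "\<And>N. N0 \<le> N \<Longrightarrow>
    (sample N (\<lambda>t. h (1, t)) - sample N (\<lambda>t. h (t, 1)) + sample N (\<lambda>t. h (t, 0))
      :: 'a list \<Rightarrow>\<^sub>0 'f::field) \<in> obds K"
proof -
  obtain \<delta> where \<delta>: "0 < \<delta>"
    "\<And>u v. u \<in> {0..1} \<times> {0..1} \<Longrightarrow> v \<in> {0..1} \<times> {0..1} \<Longrightarrow> dist u v < \<delta> \<Longrightarrow> mdist X (h u) (h v) < \<epsilon>"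
    using uniformly_continuous_mdist[OF h compact_Times[OF compact_Icc compact_Icc] eps] by metis
  \<comment> \<open>A grid cell has diameter at most \<open>2 / N\<close>, one \<open>1 / N\<close>
    from each coordinate.\<close>
  obtain N0 :: nat where N0: "2 / \<delta> < N0" using reals_Archimedean2 by blast
  show ?thesis
  proof (rule that)
    fix N assume "N0 \<le> N"
    then have "2 / \<delta> < N" using N0 by (meson less_le_trans of_nat_le_iff)
    moreover from this have "0 < N" using \<delta>(1)
      by (cases N) (auto simp: divide_less_0_iff)
    ultimately have N: "0 < N" "2 / N < \<delta>" using \<delta>(1) by (auto simp: field_simps)
    define P where "P i j = h (real i / N, real j / N)" for i j
    have PM: "P i j \<in> mspace X" if "i \<le> N" "j \<le> N" for i j
      using h that N by (auto simp: P_def continuous_map_def divide_le_eq_1)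
    have Pd: "mdist X (P i j) (P i' j') < \<epsilon>"
      if "i \<le> N" "j \<le> N" "i' \<le> N" "j' \<le> N" "\<bar>real i - real i'\<bar> \<le> 1" "\<bar>real j - real j'\<bar> \<le> 1" for i j i' j'
      unfolding P_def
    proof (rule \<delta>(2))
      have "dist (real i / N, real j / N) (real i' / N, real j' / N)
        \<le> dist (real i / N) (real i' / N) + dist (real j / N) (real j' / N)"
        by (simp add: dist_Pair_Pair sqrt_sum_squares_le_sum)
      also have "\<dots> = \<bar>real i - real i'\<bar> / N + \<bar>real j - real j'\<bar> / N"
        by (simp add: dist_real_def diff_divide_distrib[symmetric] abs_divide)
      also have "\<dots> \<le> 1 / N + 1 / N" using that by (intro add_mono divide_right_mono) auto
      also have "\<dots> < \<delta>" using N by simp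
      finally show "dist (real i / N, real j / N) (real i' / N, real j' / N) < \<delta>" .
    qed (use that N in \<open>auto simp: divide_le_eq_1\<close>)
    define R where "R j = (\<Sum>i<N. gen [P i j, P (Suc i) j] :: 'a list \<Rightarrow>\<^sub>0 'f)" for j
    define V where "V i j = (gen [P i j, P i (Suc j)] :: 'a list \<Rightarrow>\<^sub>0 'f)" for i j
    \<comment> \<open>A cell is cut along its diagonal; the diagonal edge cancels in the difference
      of the two triangle boundaries.\<close>
    have cell: "gen [P i j, P (Suc i) j] + V (Suc i) j - V i j - gen [P i (Suc j), P (Suc i) (Suc j)] \<in> obds K"
      if "i < N" "j < N" for i j
    proof -
      have "{P i j, P (Suc i) j, P (Suc i) (Suc j)} \<in> K" "{P i j, P i (Suc j), P (Suc i) (Suc j)} \<in> K"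
        using that by (intro small; auto intro!: PM Pd)+
      from this[THEN obds_triangle] have
        "(gen [P (Suc i) j, P (Suc i) (Suc j)] - gen [P i j, P (Suc i) (Suc j)] + gen [P i j, P (Suc i) j]) -
        (gen [P i (Suc j), P (Suc i) (Suc j)] - gen [P i j, P (Suc i) (Suc j)] + gen [P i j, P i (Suc j)]) \<in> obds K"
        by (rule pm.subspace_diff[OF subspace_obds])
      then show ?thesis by (simp add: V_def algebra_simps)
    qed
    have row: "R j + V N j - V 0 j - R (Suc j) \<in> obds K" if "j < N" for j
    proof -
      have "(\<Sum>i<N. gen [P i j, P (Suc i) j] + (V (Suc i) j - V i j) - gen [P i (Suc j), P (Suc i) (Suc j)]) \<in> obds K"
        using cell that by (intro pm.subspace_sum[OF subspace_obds]) (simp add: algebra_simps)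
      moreover have "(\<Sum>i<N. V (Suc i) j) = (\<Sum>i<N. V i j) + (V N j - V 0 j)"
        using sum_lessThan_telescope[of "\<lambda>i. V i j" N] by (simp add: sum_subtractf algebra_simps)
      ultimately show ?thesis
        by (simp add: sum.distrib sum_subtractf R_def algebra_simps)
    qed
    have "(\<Sum>j<N. V N j - V 0 j - (R (Suc j) - R j)) \<in> obds K"
      using row by (intro pm.subspace_sum[OF subspace_obds]) (simp add: algebra_simps)
    then have *: "(\<Sum>j<N. V N j) - (\<Sum>j<N. V 0 j) - (R N - R 0) \<in> obds K"
      using sum_lessThan_telescope[of R N] by (simp add: sum_subtractf)
    \<comment> \<open>The column over 0 is collapsed to a point, so its edges are degenerate and
      hence boundaries.\<close>
    have "V 0 j \<in> obds K" for j
    proof -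
      have PP: "mdist X (P 0 0) (P 0 0) = 0" using PM[of 0 0] by simp
      have "{P 0 0} \<in> K"
      proof (rule small)
        fix x y assume "x \<in> {P 0 0}" "y \<in> {P 0 0}"
        then have "x = P 0 0" "y = P 0 0" by auto
        then show "mdist X x y < \<epsilon>" using eps PP by (simp only:)
      qed (use PM[of 0 0] in auto)
      moreover have eq: "P 0 j = P 0 0" for j using h0[of "real j / N"] by (simp add: P_def)
      ultimately show ?thesis
        using obds_refl[of "P 0 0" K] unfolding V_def eq[of j] eq[of "Suc j"] by blast
    qed
    then have "(\<Sum>j<N. V 0 j) \<in> obds K" by (intro pm.subspace_sum[OF subspace_obds])
    from pm.subspace_add[OF subspace_obds * this]
    have "(\<Sum>j<N. V N j) - R N + R 0 \<in> obds K" by (simp add: algebra_simps)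
    moreover have "(\<Sum>j<N. V N j) = sample N (\<lambda>t. h (1, t))" "R N = sample N (\<lambda>t. h (t, 1))"
      "R 0 = sample N (\<lambda>t. h (t, 0))"
      using N by (auto simp: V_def R_def sample_def P_def)
    ultimately show "sample N (\<lambda>t. h (1, t)) - sample N (\<lambda>t. h (t, 1)) + (sample N (\<lambda>t. h (t, 0)) :: 'a list \<Rightarrow>\<^sub>0 'f) \<in> obds K"
      by simp
  qed
qed

end

section \<open>Short curves and local contractibility\<close>

text \<open>Obtains continuity from an estimate alone. For short curves \<open>g\<close> is
  constant; for contractions along a path, \<open>g\<close> is the path and the Lipschitz term
  accounts for the contraction parameter.\<close>

lemma continuous_map_dominated:
  fixes h :: "'b::metric_space \<Rightarrow> 'a" and g :: "'b \<Rightarrow> 'c"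
  assumes g: "continuous_map (top_of_set C) (mtopology_of Y) g" and C: "compact C"
    and M: "\<And>u. u \<in> C \<Longrightarrow> h u \<in> mspace X"
    and L: "\<And>u v. u \<in> C \<Longrightarrow> v \<in> C \<Longrightarrow> mdist X (h u) (h v) \<le> mdist Y (g u) (g v) + L * dist u v"
  shows "continuous_map (top_of_set C) (mtopology_of X) h"
proof -
  interpret Metric_space "mspace X" "mdist X" by (rule Metric_space_mspace_mdist)
  have "\<exists>U. openin (top_of_set C) U \<and> u \<in> U \<and> (\<forall>v\<in>U. h v \<in> mball (h u) e)"
    if u: "u \<in> C" and e: "0 < e" for u e
  proof -
    obtain \<delta> where \<delta>: "0 < \<delta>"
      "\<And>u v. u \<in> C \<Longrightarrow> v \<in> C \<Longrightarrow> dist u v < \<delta> \<Longrightarrow> mdist Y (g u) (g v) < e / 2"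
      using uniformly_continuous_mdist[OF g C half_gt_zero[OF e]] by metis
    show ?thesis
    proof (intro exI conjI ballI)
      \<comment> \<open>Adding 1 keeps the divisor positive when \<open>L = 0\<close>.\<close>
      let ?U = "C \<inter> ball u (min \<delta> (e / 2 / (\<bar>L\<bar> + 1)))"
      show "openin (top_of_set C) ?U" by (simp add: openin_open_Int)
      show "u \<in> ?U" using u e \<delta>(1) by (simp add: add_nonneg_pos)
      fix v assume v: "v \<in> ?U"
      then have "mdist X (h u) (h v) \<le> mdist Y (g u) (g v) + L * dist u v" using L u by auto
      also have "\<dots> \<le> mdist Y (g u) (g v) + (\<bar>L\<bar> + 1) * dist u v"
        by (intro add_left_mono mult_right_mono) auto
      also have "mdist Y (g u) (g v) < e / 2" using v u by (intro \<delta>(2)) auto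
      also have "(\<bar>L\<bar> + 1) * dist u v < e / 2"
        using v by (simp add: field_simps)
      finally show "h v \<in> mball (h u) e" using u v M by auto
    qed
  qed
  then show ?thesis by (simp add: continuous_map_to_metric mtopology_of_def)
qed

lemma affine_between:
  fixes a b t :: real
  assumes "t \<in> {0..1}" "a \<le> b"
  shows "a + t * (b - a) \<in> {a..b}"
  using assms mult_left_le_one_le[of "b - a" t] by auto

lemma pathin_affine:
  assumes "convex C" "continuous_map (top_of_set C) T p" "a \<in> C" "b \<in> C"
  shows "pathin T (\<lambda>t. p (a + t * (b - a)))"
proof -
  have "a + t * (b - a) \<in> C" if "t \<in> {0..1}" for t
  proof -
    have "(1 - t) *\<^sub>R a + t *\<^sub>R b \<in> C" using assms that by (intro convexD) auto
    then show ?thesis by (simp add: algebra_simps)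
  qed
  then have "continuous_map (top_of_set {0..1}) (top_of_set C) (\<lambda>t. a + t * (b - a))"
    by (auto simp: continuous_map_in_subtopology intro!: continuous_intros)
  from continuous_map_compose[OF this assms(2)] show ?thesis by (simp add: pathin_def o_def)
qed

text \<open>A 1-Lipschitz curve, so its length is at most \<open>D\<close>; it is a geodesic when
  \<open>D\<close> is the distance of its ends. Unlike geodesics, such curves can be joined and
  closed up.\<close>

definition short_curve :: "'a metric \<Rightarrow> (real \<Rightarrow> 'a) \<Rightarrow> real \<Rightarrow> 'a \<Rightarrow> 'a \<Rightarrow> bool"
  where "short_curve X p D x y \<longleftrightarrow> 0 \<le> D \<and> p 0 = x \<and> p D = y \<and> (\<forall>t\<in>{0..D}. p t \<in> mspace X) \<and>
    (\<forall>s\<in>{0..D}. \<forall>t\<in>{0..D}. mdist X (p s) (p t) \<le> \<bar>s - t\<bar>)"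

lemma short_curve_dist:
  "short_curve X p D x y \<Longrightarrow> s \<in> {0..D} \<Longrightarrow> t \<in> {0..D} \<Longrightarrow> mdist X (p s) (p t) \<le> \<bar>s - t\<bar>"
  by (simp add: short_curve_def)

lemma short_curve_continuous:
  assumes p: "short_curve X p D x y"
  shows "continuous_map (top_of_set {0..D}) (mtopology_of X) p"
proof (rule continuous_map_dominated[where L = 1])
  have "x \<in> mspace X" using p by (auto simp: short_curve_def)
  then show "continuous_map (top_of_set {0..D}) (mtopology_of X) (\<lambda>_. x)" by simp
  fix s t assume "s \<in> {0..D}" "t \<in> {0..D}"
  then show "mdist X (p s) (p t) \<le> mdist X x x + 1 * dist s t"
    using short_curve_dist[OF p, of s t] by (simp add: dist_real_def add_increasing)
qed (use p in \<open>auto simp: short_curve_def\<close>)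

lemma short_curve_join:
  assumes p: "short_curve X p D x y" and q: "short_curve X q D' y z"
  obtains c where "short_curve X c (D + D') x z"
    "segment c 0 (D + D') - segment p 0 D - segment q 0 D' \<in> (bds (mtopology_of X) :: (_ \<Rightarrow>\<^sub>0 'f::field) set)"
proof -
  interpret Metric_space "mspace X" "mdist X" by (rule Metric_space_mspace_mdist)
  define c where "c t = (if t \<le> D then p t else q (t - D))" for t
  have D: "0 \<le> D" "0 \<le> D'" using p q by (auto simp: short_curve_def)
  have cM: "c t \<in> mspace X" if "t \<in> {0..D + D'}" for t
    using p q that by (auto simp: c_def short_curve_def)
  have cq: "c t = q (t - D)" if "D \<le> t" for t
    using p q that by (auto simp: c_def short_curve_def)
  have mixed: "mdist X (c s) (c t) \<le> t - s" if "0 \<le> s" "s \<le> t" "t \<le> D + D'" for s t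
  proof -
    consider "t \<le> D" | "D \<le> s" | "s \<le> D" "D \<le> t" using that by linarith
    then show ?thesis
    proof cases
      case 1 then show ?thesis using short_curve_dist[OF p, of s t] that by (simp add: c_def)
    next
      case 2
      then have "mdist X (q (s - D)) (q (t - D)) \<le> \<bar>(s - D) - (t - D)\<bar>"
        using that by (intro short_curve_dist[OF q]) auto
      then show ?thesis using 2 that by (simp add: cq)
    next
      \<comment> \<open>Points on different sides of the junction are compared through the junction
        \<open>c D\<close>.\<close>
      case 3
      have "mdist X (c s) (c t) \<le> mdist X (c s) (c D) + mdist X (c D) (c t)"
        using that D 3 by (intro triangle cM) auto
      also have "mdist X (c s) (c D) \<le> \<bar>s - D\<bar>"
        using short_curve_dist[OF p, of s D] that D 3 by (simp add: c_def)
      also have "mdist X (c D) (c t) \<le> \<bar>0 - (t - D)\<bar>"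
      proof -
        have "mdist X (q 0) (q (t - D)) \<le> \<bar>0 - (t - D)\<bar>"
          using that D 3 by (intro short_curve_dist[OF q]) auto
        then show ?thesis using 3 by (simp add: cq)
      qed
      finally show ?thesis using 3 by simp
    qed
  qed
  have c: "short_curve X c (D + D') x z"
    unfolding short_curve_def
  proof (intro conjI ballI)
    show "c 0 = x" using p D by (simp add: c_def short_curve_def)
    show "c (D + D') = z" using q D by (simp add: cq short_curve_def)
    fix s t assume "s \<in> {0..D + D'}" "t \<in> {0..D + D'}"
    then show "mdist X (c s) (c t) \<le> \<bar>s - t\<bar>"
      using mixed[of s t] mixed[of t s] by (cases "s \<le> t") (auto simp: commute)
  qed (use D cM in auto)
  have "segment c D (D + D') - segment c 0 (D + D') + segment c 0 D \<in> (bds (mtopology_of X) :: (_ \<Rightarrow>\<^sub>0 'f) set)"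
    using D by (intro segment_triangle[OF _ short_curve_continuous[OF c]]) auto
  moreover have "segment c 0 D = (segment p 0 D :: _ \<Rightarrow>\<^sub>0 'f)"
    using D by (intro segment_cong) (auto simp: c_def mult_left_le_one_le)
  moreover have "segment c D (D + D') = (segment q 0 D' :: _ \<Rightarrow>\<^sub>0 'f)"
    using D by (intro segment_cong) (simp add: cq)
  ultimately have "- (segment q 0 D' - segment c 0 (D + D') + segment p 0 D) \<in> (bds (mtopology_of X) :: (_ \<Rightarrow>\<^sub>0 'f) set)"
    by (intro pm.subspace_neg[OF subspace_bds]) simp
  with c show ?thesis by (intro that) (auto simp: algebra_simps)
qed

lemma short_curve_rev:
  assumes p: "short_curve X p D x y"
  obtains c where "short_curve X c D y x"
    "segment c 0 D + segment p 0 D \<in> (bds (mtopology_of X) :: (_ \<Rightarrow>\<^sub>0 'f::field) set)"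
proof
  show c: "short_curve X (\<lambda>t. p (D - t)) D y x"
    unfolding short_curve_def
  proof (intro conjI ballI)
    fix s t assume "s \<in> {0..D}" "t \<in> {0..D}"
    then show "mdist X (p (D - s)) (p (D - t)) \<le> \<bar>s - t\<bar>"
      using short_curve_dist[OF p, of "D - s" "D - t"] by (simp add: abs_minus_commute)
  qed (use p in \<open>auto simp: short_curve_def\<close>)
  have D: "0 \<le> D" using p by (simp add: short_curve_def)
  have "segment p 0 D + segment p D 0 \<in> (bds (mtopology_of X) :: (_ \<Rightarrow>\<^sub>0 'f) set)"
    using D by (intro segment_rev[OF _ short_curve_continuous[OF p]]) auto
  moreover have "segment p D 0 = (segment (\<lambda>t. p (D - t)) 0 D :: _ \<Rightarrow>\<^sub>0 'f)"
    by (intro segment_cong) simp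
  ultimately show "segment (\<lambda>t. p (D - t)) 0 D + segment p 0 D \<in> (bds (mtopology_of X) :: (_ \<Rightarrow>\<^sub>0 'f) set)"
    by (simp add: add.commute)
qed

text \<open>\<open>H\<close> contracts the ball to \<open>w\<close> inside the whole space. The
  Lipschitz estimate stands in for joint continuity: it makes \<open>H\<close> composed with any
  path in the ball continuous.\<close>

definition contractible_ball :: "'a metric \<Rightarrow> 'a \<Rightarrow> real \<Rightarrow> bool"
  where "contractible_ball X w e \<longleftrightarrow> 0 < e \<and> w \<in> mspace X \<and> (\<exists>H. \<forall>x\<in>mball_of X w e. \<forall>y\<in>mball_of X w e.
    \<forall>s\<in>{0..1}. \<forall>t\<in>{0..1}. H x s \<in> mspace X \<and> H x 0 = w \<and> H x 1 = x \<and>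
      mdist X (H x s) (H y t) \<le> mdist X x y + e * \<bar>s - t\<bar>)"

text \<open>Coning a path from \<open>w\<close> makes it homologous to
  \<open>H (p 1) - H (p 0)\<close>, which depends on the end points only.\<close>

lemma contractible_ball_paths:
  assumes "contractible_ball X w e"
    and p: "pathin (mtopology_of X) p" "\<And>t. t \<in> {0..1} \<Longrightarrow> p t \<in> mball_of X w e"
    and q: "pathin (mtopology_of X) q" "\<And>t. t \<in> {0..1} \<Longrightarrow> q t \<in> mball_of X w e"
    and pq: "p 0 = q 0" "p 1 = q 1"
  shows "gen (path_simplex p) - gen (path_simplex q) \<in> bds (mtopology_of X)"
proof -
  obtain H where H0: "\<forall>x\<in>mball_of X w e. \<forall>y\<in>mball_of X w e. \<forall>s\<in>{0..1}. \<forall>t\<in>{0..1}.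
    H x s \<in> mspace X \<and> H x 0 = w \<and> H x 1 = x \<and> mdist X (H x s) (H y t) \<le> mdist X x y + e * \<bar>s - t\<bar>"
    using assms(1) unfolding contractible_ball_def by (elim conjE exE)
  have H: "H x s \<in> mspace X" "H x 0 = w" "H x 1 = x"
    if "x \<in> mball_of X w e" "s \<in> {0..1}" for x s
    using H0[rule_format, OF that(1) that(1) that(2) that(2)] by auto
  have H4: "mdist X (H x s) (H y t) \<le> mdist X x y + e * \<bar>s - t\<bar>"
    if "x \<in> mball_of X w e" "y \<in> mball_of X w e" "s \<in> {0..1}" "t \<in> {0..1}" for x y s t
    using H0[rule_format, OF that] by auto
  have e: "0 < e" and w: "w \<in> mspace X" using assms(1) by (auto simp: contractible_ball_def)
  let ?C = "{0..1} \<times> {0..1} :: (real \<times> real) set"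
  have cone: "gen (path_simplex p) - (gen (path_simplex (H (p 1))) - gen (path_simplex (H (p 0)))) \<in> bds (mtopology_of X)"
    if p: "pathin (mtopology_of X) p" "\<And>t. t \<in> {0..1} \<Longrightarrow> p t \<in> mball_of X w e" for p
  proof -
    define h where "h z = H (p (snd z)) (fst z)" for z
    have "continuous_map (top_of_set ?C) (top_of_set {0..1}) snd"
      by (auto simp: continuous_map_in_subtopology intro!: continuous_intros)
    from continuous_map_compose[OF this p(1)[unfolded pathin_def]]
    have "continuous_map (top_of_set ?C) (mtopology_of X) h"
    proof (rule continuous_map_dominated[where L = e])
      fix u v assume uv: "u \<in> ?C" "v \<in> ?C"
      then have "mdist X (h u) (h v) \<le> mdist X (p (snd u)) (p (snd v)) + e * \<bar>fst u - fst v\<bar>"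
        unfolding h_def using uv by (intro H4 p(2)) auto
      also have "\<bar>fst u - fst v\<bar> \<le> dist u v" using dist_fst_le[of u v] by (simp add: dist_real_def)
      finally show "mdist X (h u) (h v) \<le> mdist X ((p \<circ> snd) u) ((p \<circ> snd) v) + e * dist u v"
        using e by (simp add: mult_left_mono)
    qed (use H(1) p(2) in \<open>auto simp: h_def intro: compact_Times\<close>)
    note tri = triangle_boundary[OF convex_Times[OF convex_real_interval(5) convex_real_interval(5)] this]
    \<comment> \<open>The square \<open>h\<close> is cut along its diagonal. Its sides are
      \<open>p\<close>, the tracks \<open>H (p 0)\<close> and \<open>H (p 1)\<close> of the end
      points, and the constant path at \<open>w\<close>, which is a boundary.\<close>
    have 1: "gen (path_simplex p) - gen (path_simplex (\<lambda>t. h (t, t))) + gen (path_simplex (H (p 0))) \<in> bds (mtopology_of X)"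
    proof -
      have "path_simplex p = path_simplex (\<lambda>t. h (1, t))"
        using H(3)[OF p(2)] by (intro path_simplex_cong) (simp add: h_def)
      moreover have "path_simplex (H (p 0)) = path_simplex (\<lambda>t. h (t, 0))"
        by (intro path_simplex_cong) (simp add: h_def)
      ultimately show ?thesis using tri[of "(0, 0)" "(1, 0)" "(1, 1)"] by simp
    qed
    have 2: "gen (path_simplex (H (p 1))) - gen (path_simplex (\<lambda>t. h (t, t))) + gen (path_simplex (\<lambda>t. w)) \<in> bds (mtopology_of X)"
    proof -
      have "path_simplex (\<lambda>t. w) = path_simplex (\<lambda>t. h (0, t))"
        using H(2)[OF p(2)] by (intro path_simplex_cong) (simp add: h_def)
      moreover have "path_simplex (H (p 1)) = path_simplex (\<lambda>t. h (t, 1))"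
        by (intro path_simplex_cong) (simp add: h_def)
      ultimately show ?thesis using tri[of "(0, 0)" "(0, 1)" "(1, 1)"] by simp
    qed
    have 3: "gen (path_simplex (\<lambda>t. w)) \<in> bds (mtopology_of X)"
      using segment_refl[of UNIV "mtopology_of X" "\<lambda>t. w" 0] w by (simp add: segment_def)
    show ?thesis
      using pm.subspace_add[OF subspace_bds pm.subspace_diff[OF subspace_bds 1 2] 3] by (simp add: algebra_simps)
  qed
  from pm.subspace_diff[OF subspace_bds cone[OF p] cone[OF q]] pq show ?thesis by simp
qed

section \<open>Geodesic replacement of paths in a geodesic, semilocally simply connected
  space\<close>

locale geodesic_slsc =
  fixes X :: "'a metric"
  assumes geodesic: "x \<in> mspace X \<Longrightarrow> y \<in> mspace X \<Longrightarrow> \<exists>p. short_curve X p (mdist X x y) x y"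
    and contractible: "w \<in> mspace X \<Longrightarrow> \<exists>e. contractible_ball X w e"
begin

sublocale Metric_space "mspace X" "mdist X" by (rule Metric_space_mspace_mdist)

abbreviation "T \<equiv> mtopology_of X"

text \<open>Chosen for ordered pairs: \<open>geod x y\<close> and \<open>geod y x\<close> need not
  be reverses of each other. This suits the ordered complex, where \<open>[x, y]\<close> and
  \<open>[y, x]\<close> are separate generators.\<close>

definition geod :: "'a \<Rightarrow> 'a \<Rightarrow> real \<Rightarrow> 'a"
  where "geod x y = (SOME p. short_curve X p (mdist X x y) x y)"

lemma geod: "x \<in> mspace X \<Longrightarrow> y \<in> mspace X \<Longrightarrow> short_curve X (geod x y) (mdist X x y) x y"
  unfolding geod_def by (rule someI_ex[OF geodesic])

definition geod_chain :: "'a \<Rightarrow> 'a \<Rightarrow> ((nat \<Rightarrow> real) \<Rightarrow> 'a) \<Rightarrow>\<^sub>0 'f::field"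
  where "geod_chain x y = segment (geod x y) 0 (mdist X x y)"

definition realize :: "('a list \<Rightarrow>\<^sub>0 'f::field) \<Rightarrow> ((nat \<Rightarrow> real) \<Rightarrow> 'a) \<Rightarrow>\<^sub>0 'f"
  where "realize = lin (\<lambda>vs. geod_chain (vs ! 0) (vs ! 1))"

text \<open>Why \<open>e / 4\<close>: the ends of a piece are then less than \<open>e / 2\<close>
  apart, so the geodesic between them stays within \<open>3 * e / 4\<close> of \<open>w\<close>,
  inside the same contractible ball as the path.\<close>

definition local_fine :: "nat \<Rightarrow> (real \<Rightarrow> 'a) \<Rightarrow> bool"
  where "local_fine N p \<longleftrightarrow> 0 < N \<and> (\<forall>i<N. \<exists>w e. contractible_ball X w e \<and>
    (\<forall>t\<in>{i / N..Suc i / N}. mdist X w (p t) < e / 4))"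

text \<open>The radius of a contractible ball varies with its centre; a Lebesgue number for the
  preimages of the quarter balls in the unit interval gives one mesh for all pieces.\<close>

lemma local_fine_exists:
  assumes p: "pathin T p"
  obtains N0 where "\<And>N. N0 \<le> N \<Longrightarrow> local_fine N p"
proof -
  obtain r where r: "\<And>w. w \<in> mspace X \<Longrightarrow> contractible_ball X w (r w)" using contractible by metis
  have pM: "p t \<in> mspace X" if "t \<in> {0..1}" for t
    using p that by (auto simp: pathin_def continuous_map_def)
  have "\<exists>U. open U \<and> {0..1} \<inter> U = {t \<in> {0..1}. p t \<in> mball_of X w (r w / 4)}" for w
  proof -
    have "openin T (mball_of X w (r w / 4))" by (simp add: mtopology_of_def mball_of_def openin_mball)
    from openin_continuous_map_preimage[OF p[unfolded pathin_def] this] show ?thesis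
      by (auto simp: openin_open)
  qed
  then obtain U where U: "\<And>w. open (U w)"
    "\<And>w. {0..1} \<inter> U w = {t \<in> {0..1}. p t \<in> mball_of X w (r w / 4)}" by metis
  have "{0..1} \<subseteq> \<Union>(U ` mspace X)"
  proof
    fix t :: real assume t: "t \<in> {0..1}"
    then have "p t \<in> mball_of X (p t) (r (p t) / 4)"
      using r[OF pM] pM by (auto simp: contractible_ball_def)
    then show "t \<in> \<Union>(U ` mspace X)" using U(2)[of "p t"] t pM by blast
  qed
  then obtain \<delta> where \<delta>: "0 < \<delta>" "\<And>t. t \<in> {0..1} \<Longrightarrow> \<exists>G\<in>U ` mspace X. ball t \<delta> \<subseteq> G"
    using Heine_Borel_lemma[OF compact_Icc[of 0 "1::real"], of "U ` mspace X"] U(1) by (metis (no_types, lifting) imageE)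
  obtain N0 :: nat where N0: "1 / \<delta> < N0" using reals_Archimedean2 by blast
  show ?thesis
  proof (rule that)
    fix N assume "N0 \<le> N"
    then have "1 / \<delta> < N" using N0 by (meson less_le_trans of_nat_le_iff)
    moreover from this have "0 < N" using \<delta>(1)
      by (cases N) (auto simp: divide_less_0_iff)
    ultimately have N: "0 < N" "1 / N < \<delta>" using \<delta>(1) by (auto simp: field_simps)
    have "\<exists>w e. contractible_ball X w e \<and> (\<forall>t\<in>{i / N..Suc i / N}. mdist X w (p t) < e / 4)" if i: "i < N" for i
    proof -
      have "real i / N \<in> {0..1}" using i by (simp add: divide_le_eq_1)
      then obtain w where w: "w \<in> mspace X" "ball (real i / N) \<delta> \<subseteq> U w" using \<delta>(2) by blast
      have "mdist X w (p t) < r w / 4" if t: "t \<in> {i / N..Suc i / N}" for t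
      proof -
        have "Suc i / N \<le> 1" using i by (simp add: divide_le_eq_1)
        then have "t \<in> {0..1}"
          using t order_trans[of 0 "real i / N" t] order_trans[of t "Suc i / N" 1] by (simp del: of_nat_Suc)
        moreover have "t - i / N \<le> 1 / N" using t by (simp add: add_divide_distrib)
        then have "t \<in> ball (real i / N) \<delta>" using N t by (simp add: dist_real_def)
        ultimately have "t \<in> {0..1} \<inter> U w" using w(2) by auto
        then show ?thesis unfolding U(2) by simp
      qed
      then show ?thesis using r[OF w(1)] by blast
    qed
    then show "local_fine N p" using N by (simp add: local_fine_def)
  qed
qed

text \<open>On each grid interval the path and the geodesic share their end points and stay in one
  contractible ball, so they are homologous; \<open>segment_sum\<close> reassembles the pieces of
  the path.\<close>

lemma realize_sample:
  assumes p: "pathin T p" and N: "local_fine N p"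
  shows "realize (sample N p) - gen (path_simplex p) \<in> bds T"
proof -
  have N0: "0 < N" using N by (simp add: local_fine_def)
  have pM: "p t \<in> mspace X" if "t \<in> {0..1}" for t
    using p that by (auto simp: pathin_def continuous_map_def)
  have piece: "geod_chain (p (i / N)) (p (Suc i / N)) - segment p (i / N) (Suc i / N) \<in> bds T" if i: "i < N" for i
  proof -
    let ?a = "real i / N" and ?b = "Suc i / N"
    have ab: "?a \<in> {0..1}" "?b \<in> {0..1}" "?a \<le> ?b" using i by (auto simp: divide_le_eq_1 divide_right_mono)
    obtain w e where w: "contractible_ball X w e" "\<And>t. t \<in> {?a..?b} \<Longrightarrow> mdist X w (p t) < e / 4"
      using N i unfolding local_fine_def by metis
    have wM: "w \<in> mspace X" "0 < e" using w(1) by (auto simp: contractible_ball_def)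
    let ?x = "p ?a" and ?y = "p ?b"
    let ?d = "mdist X ?x ?y"
    have M: "?x \<in> mspace X" "?y \<in> mspace X" using ab pM by auto
    have wx: "mdist X w ?x < e / 4" and wy: "mdist X w ?y < e / 4" using w(2)[of ?a] w(2)[of ?b] ab(3) by (simp_all del: of_nat_Suc)
    have d: "?d < e / 2" using triangle[OF M(1) wM(1) M(2)] wx wy by (simp add: commute)
    note g = geod[OF M]
    have "gen (path_simplex (\<lambda>t. geod ?x ?y (0 + t * (?d - 0)))) - gen (path_simplex (\<lambda>t. p (?a + t * (?b - ?a)))) \<in> bds T"
    proof (rule contractible_ball_paths[OF w(1)])
      show "pathin T (\<lambda>t. geod ?x ?y (0 + t * (?d - 0)))"
        by (intro pathin_affine[OF _ short_curve_continuous[OF g]]) auto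
      show "pathin T (\<lambda>t. p (?a + t * (?b - ?a)))"
        using ab by (intro pathin_affine[OF _ p[unfolded pathin_def]]) auto
      fix t :: real assume t: "t \<in> {0..1}"
      define u where "u = ?a + t * (?b - ?a)"
      have u1: "u \<in> {?a..?b}"
        unfolding u_def by (rule affine_between[OF t ab(3)])
      moreover from this have "u \<in> {0..1}" using ab by (meson atLeastAtMost_iff order_trans)
      ultimately show "p (?a + t * (?b - ?a)) \<in> mball_of X w e"
        using w(2)[OF u1] wM pM[of u] unfolding u_def[symmetric] by simp
      have td: "t * ?d \<in> {0..?d}" using t by (auto simp: mult_left_le_one_le)
      then have z: "geod ?x ?y (t * ?d) \<in> mspace X" using g by (simp add: short_curve_def)
      have "mdist X (geod ?x ?y 0) (geod ?x ?y (t * ?d)) \<le> \<bar>0 - t * ?d\<bar>"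
        using td by (intro short_curve_dist[OF g]) auto
      then have "mdist X ?x (geod ?x ?y (t * ?d)) \<le> ?d" using g td by (simp add: short_curve_def)
      then have "mdist X w (geod ?x ?y (t * ?d)) < e"
        using triangle[OF wM(1) M(1) z] wx d wM(2) by linarith
      then show "geod ?x ?y (0 + t * (?d - 0)) \<in> mball_of X w e" using z wM by simp
    qed (use g in \<open>auto simp: short_curve_def\<close>)
    then show ?thesis by (simp add: geod_chain_def segment_def)
  qed
  have 1: "(\<Sum>i<N. geod_chain (p (i / N)) (p (Suc i / N)) - segment p (i / N) (Suc i / N)) \<in> bds T"
    using piece by (intro pm.subspace_sum[OF subspace_bds]) auto
  have 2: "(\<Sum>i<N. segment p (i / N) (Suc i / N)) - segment p (real 0 / N) (real N / N) \<in> bds T"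
    using N0 by (intro segment_sum[of "{0..1}"] p[unfolded pathin_def]) (auto simp: divide_le_eq_1)
  have 3: "realize (sample N p) = (\<Sum>i<N. geod_chain (p (i / N)) (p (Suc i / N)))"
    by (simp add: sample_def realize_def lin_sum)
  from pm.subspace_add[OF subspace_bds 1 2] N0 show ?thesis
    unfolding 3 by (simp add: sum_subtractf segment_01)
qed

text \<open>The polygon is traced by one curve whose parameter length is the sum of the edge
  lengths. This links a sum of geodesics to killing, which is a condition on single loops.\<close>

lemma geodesic_polygon:
  assumes "\<And>i. i \<le> n \<Longrightarrow> x i \<in> mspace X"
  shows "\<exists>c. short_curve X c (\<Sum>i<n. mdist X (x i) (x (Suc i))) (x 0) (x n) \<and>
    segment c 0 (\<Sum>i<n. mdist X (x i) (x (Suc i))) - (\<Sum>i<n. geod_chain (x i) (x (Suc i)))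
      \<in> (bds T :: (_ \<Rightarrow>\<^sub>0 'f::field) set)"
  using assms
proof (induction n)
  case 0
  let ?c = "\<lambda>_::real. x 0"
  have x: "x 0 \<in> mspace X" "mdist X (x 0) (x 0) = 0" using 0 by auto
  have "segment ?c 0 0 \<in> (bds T :: (_ \<Rightarrow>\<^sub>0 'f) set)"
    using x by (intro segment_refl[of UNIV]) auto
  moreover have "short_curve X ?c 0 (x 0) (x 0)" unfolding short_curve_def using x(1) by (auto simp: x(2))
  ultimately show ?case by (intro exI[of _ ?c]) simp
next
  case (Suc n)
  let ?D = "\<Sum>i<n. mdist X (x i) (x (Suc i))" and ?d = "mdist X (x n) (x (Suc n))"
  obtain c where c: "short_curve X c ?D (x 0) (x n)"
    "segment c 0 ?D - (\<Sum>i<n. geod_chain (x i) (x (Suc i))) \<in> (bds T :: (_ \<Rightarrow>\<^sub>0 'f) set)"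
    using Suc.IH Suc.prems by force
  have g: "short_curve X (geod (x n) (x (Suc n))) ?d (x n) (x (Suc n))"
    using Suc.prems by (intro geod) auto
  obtain c' where c': "short_curve X c' (?D + ?d) (x 0) (x (Suc n))"
    "segment c' 0 (?D + ?d) - segment c 0 ?D - geod_chain (x n) (x (Suc n)) \<in> (bds T :: (_ \<Rightarrow>\<^sub>0 'f) set)"
    using short_curve_join[OF c(1) g, where 'f = 'f] unfolding geod_chain_def by blast
  have "segment c' 0 (?D + ?d) - (\<Sum>i<Suc n. geod_chain (x i) (x (Suc i))) \<in> (bds T :: (_ \<Rightarrow>\<^sub>0 'f) set)"
    using pm.subspace_add[OF subspace_bds c(2) c'(2)] by (simp add: algebra_simps)
  with c'(1) show ?case by (intro exI[of _ c']) simp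
qed

end

section \<open>The first homology of a filtration stage\<close>

lemma lin_mem:
  assumes "pm.subspace V" "c \<in> pm.span (gen ` A)" "\<And>x. x \<in> A \<Longrightarrow> f x \<in> V"
  shows "lin f c \<in> V"
  using lin_span_subset[OF assms(2), of f V] assms(3) by (simp add: pm.span_eq_iff[THEN iffD2, OF assms(1)])

lemma lin_diff_mem:
  assumes "pm.subspace V" "c \<in> pm.span (gen ` A)" "\<And>x. x \<in> A \<Longrightarrow> f x - g x \<in> V"
  shows "lin f c - lin g c \<in> V"
  using lin_cong_span[OF assms(2), of f g V] assms(3) by (simp add: pm.span_eq_iff[THEN iffD2, OF assms(1)])

lemma lin_eq:
  assumes "c \<in> pm.span (gen ` A)" "\<And>x. x \<in> A \<Longrightarrow> f x = g x"
  shows "lin f c = lin g c"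
  using lin_diff_mem[of "{0}" c A f g] assms by (simp add: pm.subspace_single_0)

lemma lin_lin: "lin g (lin f c) = lin (\<lambda>x. lin g (f x)) c"
  by (simp add: lin_def[of f] lin_def[of "\<lambda>x. lin g (f x)"] lin_sum lin_scl)

lemma linear_mem:
  assumes "pm.subspace V" "c \<in> pm.span S" "\<And>s. s \<in> S \<Longrightarrow> lin f s \<in> V"
  shows "lin f c \<in> V"
proof -
  have "pm.subspace {c. lin f c \<in> V}"
    using assms(1) by (auto simp: pm.subspace_def lin_add lin_scl lin_zero)
  then have "pm.span S \<subseteq> {c. lin f c \<in> V}"
    using assms(3) by (intro pm.span_minimal) auto
  then show ?thesis using assms(2) by auto
qed

lemma fine_cong:
  "(\<And>t. t \<in> {0..1} \<Longrightarrow> p t = q t) \<Longrightarrow> fine X e N p \<longleftrightarrow> fine X e N q"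
  unfolding fine_def by (intro conj_cong HOL.refl ball_cong) simp

text \<open>The triangles with apex \<open>y 0\<close> are summed; the spokes telescope, since the
  polygon is closed.\<close>

lemma obds_fan:
  assumes "\<And>i. i < n \<Longrightarrow> {y 0, y i, y (Suc i)} \<in> K" "y n = y 0"
  shows "(\<Sum>i<n. gen [y i, y (Suc i)]) \<in> (obds K :: (_ \<Rightarrow>\<^sub>0 'f::field) set)"
proof -
  have "(\<Sum>i<n. gen [y i, y (Suc i)] - gen [y 0, y (Suc i)] + gen [y 0, y i]) \<in> (obds K :: (_ \<Rightarrow>\<^sub>0 'f) set)"
    using assms(1) by (intro pm.subspace_sum[OF subspace_obds] obds_triangle) auto
  moreover have "(\<Sum>i<n. gen [y 0, y (Suc i)]) = (\<Sum>i<n. gen [y 0, y i] :: _ \<Rightarrow>\<^sub>0 'f)"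
    using sum_lessThan_telescope[of "\<lambda>i. gen [y 0, y i] :: _ \<Rightarrow>\<^sub>0 'f" n] assms(2)
    by (simp add: sum_subtractf)
  ultimately show ?thesis by (simp add: sum_subtractf sum.distrib)
qed

section \<open>Lengths of loops, closed short curves and inscribed polygons\<close>

lemma path_length_short_curve:
  assumes p: "short_curve X p D x x"
  defines "a \<equiv> \<lambda>t. p (0 + t * (D - 0))"
  shows "is_loop X a" "path_length X a \<le> ennreal D"
proof -
  have D: "0 \<le> D" using p by (simp add: short_curve_def)
  have "pathin (mtopology_of X) a"
    unfolding a_def using D by (intro pathin_affine[OF _ short_curve_continuous[OF p]]) auto
  then show "is_loop X a" using p by (simp add: is_loop_def a_def short_curve_def)
  show "path_length X a \<le> ennreal D"
    unfolding path_length_def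
  proof (rule SUP_least)
    fix ts :: "real list" assume "ts \<in> {ts. sorted ts \<and> set ts \<subseteq> {0..1}}"
    then have ts: "sorted ts" "\<And>i. i < length ts \<Longrightarrow> ts ! i \<in> {0..1}" using nth_mem by blast+
    have "(\<Sum>i<length ts - 1. ennreal (mdist X (a (ts ! i)) (a (ts ! Suc i))))
      \<le> (\<Sum>i<length ts - 1. ennreal (D * (ts ! Suc i - ts ! i)))"
    proof (intro sum_mono ennreal_leI)
      fix i assume "i \<in> {..<length ts - 1}"
      then have i: "ts ! i \<in> {0..1}" "ts ! Suc i \<in> {0..1}" "ts ! i \<le> ts ! Suc i"
        using ts by (auto intro: sorted_nth_mono)
      have "mdist X (a (ts ! i)) (a (ts ! Suc i)) \<le> \<bar>ts ! i * D - ts ! Suc i * D\<bar>"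
        unfolding a_def using i D
        by (intro order_trans[OF short_curve_dist[OF p]]) (auto simp: mult_left_le_one_le)
      also have "\<dots> = D * (ts ! Suc i - ts ! i)"
        using mult_left_mono[OF i(3) D] by (simp add: algebra_simps)
      finally show "mdist X (a (ts ! i)) (a (ts ! Suc i)) \<le> D * (ts ! Suc i - ts ! i)" .
    qed
    also have "\<dots> = ennreal (\<Sum>i<length ts - 1. D * (ts ! Suc i - ts ! i))"
      using ts D by (intro sum_ennreal mult_nonneg_nonneg) (auto intro: sorted_nth_mono)
    also have "(\<Sum>i<length ts - 1. D * (ts ! Suc i - ts ! i)) = D * (ts ! (length ts - 1) - ts ! 0)"
      by (simp add: sum_distrib_left[symmetric] sum_lessThan_telescope)
    also have "ennreal \<dots> \<le> ennreal D"
    proof (cases "ts = []")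
      case False
      then have "ts ! (length ts - 1) \<in> {0..1}" "ts ! 0 \<in> {0..1}"
        using ts(2)[of "length ts - 1"] ts(2)[of 0] by simp_all
      then show ?thesis using D by (intro ennreal_leI mult_left_le) auto
    qed simp
    finally show "(\<Sum>i<length ts - 1. ennreal (mdist X (a (ts ! i)) (a (ts ! Suc i)))) \<le> ennreal D" .
  qed
qed

lemma polygon_le_path_length:
  assumes "0 < N"
  shows "ennreal (\<Sum>i<N. mdist X (a (real i / N)) (a (real (Suc i) / N))) \<le> path_length X a"
proof -
  let ?ts = "map (\<lambda>i. real i / N) [0..<Suc N]"
  have "ennreal (\<Sum>i<N. mdist X (a (real i / N)) (a (real (Suc i) / N))) =
    (\<Sum>i<length ?ts - 1. ennreal (mdist X (a (?ts ! i)) (a (?ts ! Suc i))))"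
    by (subst sum_ennreal[symmetric]) (auto simp del: upt_Suc intro!: sum.cong)
  also have "\<dots> \<le> path_length X a"
    unfolding path_length_def
    by (rule SUP_upper)
      (use assms in \<open>auto simp: sorted_iff_nth_mono divide_right_mono divide_le_eq_1 simp del: upt_Suc\<close>)
  finally show ?thesis .
qed

text \<open>\<open>K_cone\<close> splits the boundary of a triangle into killed loops through \<open>w\<close>; \<open>K_fan\<close> fills a killed
  loop by a fan of triangles.\<close>

locale filtration_stage = geodesic_slsc X + fine_complex X K \<epsilon>
  for X :: "'a metric" and K \<epsilon> +
  fixes kill :: "ennreal \<Rightarrow> bool"
  assumes K_mspace: "S \<in> K \<Longrightarrow> S \<subseteq> mspace X"
    and kill_mono: "l \<le> l' \<Longrightarrow> kill l' \<Longrightarrow> kill l"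
    and K_edge: "{x, y} \<in> K \<Longrightarrow> short_curve X p (mdist X x y) x y \<Longrightarrow>
      a \<in> {0..mdist X x y} \<Longrightarrow> b \<in> {0..mdist X x y} \<Longrightarrow> c \<in> {0..mdist X x y} \<Longrightarrow> {p a, p b, p c} \<in> K"
    and K_cone: "{x, y, z} \<in> K \<Longrightarrow> \<exists>w\<in>mspace X. \<forall>a\<in>{x, y, z}. \<forall>b\<in>{x, y, z}.
      kill (ennreal (mdist X w a + mdist X a b + mdist X w b))"
    and K_fan: "short_curve X p D x x \<Longrightarrow> kill (ennreal D) \<Longrightarrow>
      \<exists>(n::nat) t. t 0 = 0 \<and> t n = D \<and> (\<forall>i\<le>n. t i \<in> {0..D}) \<and>
        (\<forall>i<n. t i \<le> t (Suc i) \<and> {p (t 0), p (t i), p (t (Suc i))} \<in> K \<and>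
          (\<forall>a\<in>{t i..t (Suc i)}. \<forall>b\<in>{t i..t (Suc i)}. \<forall>c\<in>{t i..t (Suc i)}. {p a, p b, p c} \<in> K))"
begin

text \<open>The space L_r, pulled back to chains: boundaries are included so that membership depends
  on the homology class only. The generators are closed short curves;
  \<open>short_loop_killed\<close> shows that arbitrary killed loops add nothing.\<close>

definition killed_span :: "(((nat \<Rightarrow> real) \<Rightarrow> 'a) \<Rightarrow>\<^sub>0 'f::field) set"
  where "killed_span = pm.span (bds T \<union> {segment p 0 D | p D x. short_curve X p D x x \<and> kill (ennreal D)})"

lemma subspace_killed_span: "pm.subspace (killed_span :: (_ \<Rightarrow>\<^sub>0 'f::field) set)"
  unfolding killed_span_def by (rule pm.subspace_span)

lemma bds_killed: "c \<in> bds T \<Longrightarrow> c \<in> killed_span"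
  unfolding killed_span_def by (intro pm.span_base) auto

lemma loop_killed: "short_curve X p D x x \<Longrightarrow> kill (ennreal D) \<Longrightarrow> segment p 0 D \<in> killed_span"
  unfolding killed_span_def by (intro pm.span_base) auto

text \<open>Both conditions are needed: \<open>fine\<close> makes the sample a chain of the complex,
  \<open>local_fine\<close> makes its realization homologous to the path.\<close>

definition mesh :: "((nat \<Rightarrow> real) \<Rightarrow> 'a) \<Rightarrow> nat"
  where "mesh \<sigma> = (SOME N. fine X \<epsilon> N (simplex_path \<sigma>) \<and> local_fine N (simplex_path \<sigma>))"

definition sampling :: "(((nat \<Rightarrow> real) \<Rightarrow> 'a) \<Rightarrow>\<^sub>0 'f::field) \<Rightarrow> ('a list \<Rightarrow>\<^sub>0 'f)"
  where "sampling = lin (\<lambda>\<sigma>. sample (mesh \<sigma>) (simplex_path \<sigma>))"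

lemma sampling_gen: "sampling (gen \<sigma>) = sample (mesh \<sigma>) (simplex_path \<sigma>)"
  by (simp add: sampling_def)

lemma mesh:
  assumes "\<sigma> \<in> simplices T 1"
  shows "fine X \<epsilon> (mesh \<sigma>) (simplex_path \<sigma>)" "local_fine (mesh \<sigma>) (simplex_path \<sigma>)"
proof -
  note p = simplex_path_pathin[OF assms]
  obtain N0 where N0: "\<And>N. N0 \<le> N \<Longrightarrow> fine X \<epsilon> N (simplex_path \<sigma>)" using fine_exists[OF p] by blast
  obtain N1 where N1: "\<And>N. N1 \<le> N \<Longrightarrow> local_fine N (simplex_path \<sigma>)" using local_fine_exists[OF p] by blast
  have "\<exists>N. fine X \<epsilon> N (simplex_path \<sigma>) \<and> local_fine N (simplex_path \<sigma>)"
    using N0[of "max N0 N1"] N1[of "max N0 N1"] by auto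
  from someI_ex[OF this] show "fine X \<epsilon> (mesh \<sigma>) (simplex_path \<sigma>)" "local_fine (mesh \<sigma>) (simplex_path \<sigma>)"
    by (auto simp: mesh_def)
qed

lemma path_mspace: "pathin T p \<Longrightarrow> t \<in> {0..1} \<Longrightarrow> p t \<in> mspace X"
  by (auto simp: pathin_def continuous_map_def)

text \<open>Removes the choice of mesh: modulo boundaries any fine \<open>N\<close> may be used, in
  particular one \<open>N\<close> for several paths at once.\<close>

lemma sampling_path:
  assumes p: "pathin T p" and N: "fine X \<epsilon> N p"
  shows "sampling (gen (path_simplex p)) - sample N p \<in> (obds K :: (_ \<Rightarrow>\<^sub>0 'f::field) set)"
proof -
  let ?\<sigma> = "path_simplex p"
  have "sample (mesh ?\<sigma>) (simplex_path ?\<sigma>) - sample N (simplex_path ?\<sigma>) \<in> (obds K :: (_ \<Rightarrow>\<^sub>0 'f) set)"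
  proof (rule sample_independent)
    show "simplex_path ?\<sigma> \<in> {0..1} \<rightarrow> mspace X"
      using path_mspace[OF p] by (simp add: simplex_path_path_simplex Pi_iff)
    show "fine X \<epsilon> (mesh ?\<sigma>) (simplex_path ?\<sigma>)" by (intro mesh path_simplex_in p)
    show "fine X \<epsilon> N (simplex_path ?\<sigma>)"
      using N fine_cong[of "simplex_path ?\<sigma>" p] by (simp add: simplex_path_path_simplex)
  qed
  moreover have "sample N (simplex_path ?\<sigma>) = (sample N p :: _ \<Rightarrow>\<^sub>0 'f)"
    by (rule sample_cong) (rule simplex_path_path_simplex)
  ultimately show ?thesis by (simp only: sampling_gen)
qed

text \<open>Whatever mesh was chosen, all sample points lie on \<open>p\<close>, so any three span a
  simplex and the sample contracts to one edge.\<close>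

lemma sampling_small_path:
  assumes p: "pathin T p"
    and K: "\<And>a b c. a \<in> {0..1} \<Longrightarrow> b \<in> {0..1} \<Longrightarrow> c \<in> {0..1} \<Longrightarrow> {p a, p b, p c} \<in> K"
  shows "sampling (gen (path_simplex p)) - gen [p 0, p 1] \<in> (obds K :: (_ \<Rightarrow>\<^sub>0 'f::field) set)"
proof -
  let ?\<sigma> = "path_simplex p"
  let ?N = "mesh ?\<sigma>"
  have N: "0 < ?N" using mesh(1)[OF path_simplex_in[OF p]] by (simp add: fine_def)
  have "sampling (gen ?\<sigma>) = (sample ?N p :: _ \<Rightarrow>\<^sub>0 'f)"
    unfolding sampling_gen by (rule sample_cong) (rule simplex_path_path_simplex)
  moreover have "sample ?N p - gen [p (real 0 / ?N), p (real ?N / ?N)] \<in> (obds K :: (_ \<Rightarrow>\<^sub>0 'f) set)"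
    unfolding sample_def by (rule obds_chain) (auto simp: divide_le_eq_1 intro!: K)
  ultimately show ?thesis using N by simp
qed

lemma sampling_segment:
  assumes "convex C" "continuous_map (top_of_set C) T p" "a \<in> C" "b \<in> C" "a \<le> b"
    and K: "\<And>u v w. u \<in> {a..b} \<Longrightarrow> v \<in> {a..b} \<Longrightarrow> w \<in> {a..b} \<Longrightarrow> {p u, p v, p w} \<in> K"
  shows "sampling (segment p a b) - gen [p a, p b] \<in> obds K"
proof -
  have "sampling (gen (path_simplex (\<lambda>t. p (a + t * (b - a))))) -
    gen [p (a + 0 * (b - a)), p (a + 1 * (b - a))] \<in> obds K"
    by (intro sampling_small_path pathin_affine[OF assms(1-4)] K affine_between assms(5))
  then show ?thesis by (simp add: segment_def)
qed

text \<open>The faces of a 2-simplex have unrelated meshes; they are moved to a common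
  \<open>N\<close> that is also fine enough for the grid on the simplex.\<close>

lemma sampling_bds:
  assumes "c \<in> (bds T :: (_ \<Rightarrow>\<^sub>0 'f::field) set)"
  shows "sampling c \<in> obds K"
  unfolding sampling_def
proof (rule linear_mem[OF subspace_obds assms[unfolded bds_span]])
  fix s assume "s \<in> (\<lambda>\<sigma>. gen (singular_face 2 0 \<sigma>) - gen (singular_face 2 1 \<sigma>)
    + gen (singular_face 2 2 \<sigma>) :: _ \<Rightarrow>\<^sub>0 'f) ` simplices T 2"
  then obtain \<tau> where \<tau>: "\<tau> \<in> simplices T 2"
    "s = gen (singular_face 2 0 \<tau>) - gen (singular_face 2 1 \<tau>) + gen (singular_face 2 2 \<tau>)" by blast
  obtain h :: "real \<times> real \<Rightarrow> 'a" where h: "continuous_map (top_of_set ({0..1} \<times> {0..1})) T h"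
    and f: "singular_face 2 0 \<tau> = path_simplex (\<lambda>t. h (1, t))"
    "singular_face 2 1 \<tau> = path_simplex (\<lambda>t. h (t, 1))"
    "singular_face 2 2 \<tau> = path_simplex (\<lambda>t. h (t, 0))"
    and h0: "\<And>t. h (0, t) = h (0, 0)"
    using simplex_square[OF \<tau>(1)] by blast
  have g: "pathin T (h \<circ> g)" if "continuous_on {0..1} g" "g \<in> {0..1} \<rightarrow> {0..1} \<times> {0..1}" for g
    using continuous_map_compose[OF _ h, of "top_of_set {0..1}" g] that
    by (simp add: pathin_def continuous_map_in_subtopology)
  have "continuous_on {0..1} (\<lambda>t::real. (1::real, t))" "continuous_on {0..1} (\<lambda>t::real. (t, 1::real))"
    "continuous_on {0..1} (\<lambda>t::real. (t, 0::real))"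
    by (intro continuous_intros)+
  from this[THEN g] have p: "pathin T (\<lambda>t. h (1, t))" "pathin T (\<lambda>t. h (t, 1))" "pathin T (\<lambda>t. h (t, 0))"
    by (auto simp: o_def)
  obtain N0 where N0: "\<And>N. N0 \<le> N \<Longrightarrow>
    (sample N (\<lambda>t. h (1, t)) - sample N (\<lambda>t. h (t, 1)) + sample N (\<lambda>t. h (t, 0)) :: _ \<Rightarrow>\<^sub>0 'f) \<in> obds K"
    using sample_square[OF h h0, where 'f = 'f] by blast
  obtain N1 where N1: "\<And>N. N1 \<le> N \<Longrightarrow> fine X \<epsilon> N (\<lambda>t. h (1, t))" using fine_exists[OF p(1)] by blast
  obtain N2 where N2: "\<And>N. N2 \<le> N \<Longrightarrow> fine X \<epsilon> N (\<lambda>t. h (t, 1))" using fine_exists[OF p(2)] by blast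
  obtain N3 where N3: "\<And>N. N3 \<le> N \<Longrightarrow> fine X \<epsilon> N (\<lambda>t. h (t, 0))" using fine_exists[OF p(3)] by blast
  define N where "N = N0 + N1 + N2 + N3"
  have N: "N0 \<le> N" "N1 \<le> N" "N2 \<le> N" "N3 \<le> N" by (auto simp: N_def)
  have 1: "sampling (gen (path_simplex (\<lambda>t. h (1, t)))) - sample N (\<lambda>t. h (1, t)) \<in> (obds K :: (_ \<Rightarrow>\<^sub>0 'f) set)"
    by (intro sampling_path p N1 N)
  have 2: "sampling (gen (path_simplex (\<lambda>t. h (t, 1)))) - sample N (\<lambda>t. h (t, 1)) \<in> (obds K :: (_ \<Rightarrow>\<^sub>0 'f) set)"
    by (intro sampling_path p N2 N)
  have 3: "sampling (gen (path_simplex (\<lambda>t. h (t, 0)))) - sample N (\<lambda>t. h (t, 0)) \<in> (obds K :: (_ \<Rightarrow>\<^sub>0 'f) set)"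
    by (intro sampling_path p N3 N)
  have "sampling s = sampling (gen (path_simplex (\<lambda>t. h (1, t)))) - sampling (gen (path_simplex (\<lambda>t. h (t, 1))))
    + sampling (gen (path_simplex (\<lambda>t. h (t, 0))))"
    unfolding \<tau>(2) f sampling_def by (simp only: lin_add lin_diff)
  also have "\<dots> \<in> obds K"
    using pm.subspace_add[OF subspace_obds N0[OF N(1)]
      pm.subspace_add[OF subspace_obds pm.subspace_diff[OF subspace_obds 1 2] 3]]
    by (simp add: algebra_simps)
  finally show "lin (\<lambda>\<sigma>. sample (mesh \<sigma>) (simplex_path \<sigma>)) s \<in> obds K" by (simp add: sampling_def)
qed

text \<open>Each arc supplied by \<open>K_fan\<close> samples to a single edge, and the resulting
  polygon is filled by the fan.\<close>

lemma sampling_loop: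
  assumes p: "short_curve X p D x x" and D: "kill (ennreal D)"
  shows "sampling (segment p 0 D) \<in> (obds K :: (_ \<Rightarrow>\<^sub>0 'f::field) set)"
proof -
  obtain n :: nat and t where t: "t 0 = 0" "t n = D" "\<And>i. i \<le> n \<Longrightarrow> t i \<in> {0..D}"
    "\<And>i. i < n \<Longrightarrow> t i \<le> t (Suc i)" "\<And>i. i < n \<Longrightarrow> {p (t 0), p (t i), p (t (Suc i))} \<in> K"
    and tK: "\<And>i a b c. i < n \<Longrightarrow> a \<in> {t i..t (Suc i)} \<Longrightarrow> b \<in> {t i..t (Suc i)} \<Longrightarrow> c \<in> {t i..t (Suc i)}
      \<Longrightarrow> {p a, p b, p c} \<in> K"
    using K_fan[OF p D] by metis
  note cp = short_curve_continuous[OF p]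
  have 1: "(\<Sum>i<n. segment p (t i) (t (Suc i))) - segment p (t 0) (t n) \<in> (bds T :: (_ \<Rightarrow>\<^sub>0 'f) set)"
    by (intro segment_sum[OF _ cp] t(3)) auto
  have 2: "(\<Sum>i<n. sampling (segment p (t i) (t (Suc i)))) - sampling (segment p 0 D) \<in> (obds K :: (_ \<Rightarrow>\<^sub>0 'f) set)"
    using sampling_bds[OF 1] t(1,2) by (simp add: sampling_def lin_diff lin_sum)
  have 3: "(\<Sum>i<n. sampling (segment p (t i) (t (Suc i))) - gen [p (t i), p (t (Suc i))]) \<in> (obds K :: (_ \<Rightarrow>\<^sub>0 'f) set)"
    using t(3,4) tK by (intro pm.subspace_sum[OF subspace_obds] sampling_segment[OF _ cp]) auto
  have 4: "(\<Sum>i<n. gen [p (t i), p (t (Suc i))]) \<in> (obds K :: (_ \<Rightarrow>\<^sub>0 'f) set)"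
    using obds_fan[of n "\<lambda>i. p (t i)" K] t p by (simp add: short_curve_def)
  from pm.subspace_diff[OF subspace_obds pm.subspace_add[OF subspace_obds 3 4] 2]
  show ?thesis by (simp add: sum_subtractf)
qed

lemma sampling_killed:
  assumes "c \<in> (killed_span :: (_ \<Rightarrow>\<^sub>0 'f::field) set)"
  shows "sampling c \<in> obds K"
  unfolding sampling_def
  by (rule linear_mem[OF subspace_obds assms[unfolded killed_span_def]])
    (use sampling_bds sampling_loop in \<open>auto simp: sampling_def\<close>)

text \<open>The third side is traversed backwards to close a loop at \<open>w\<close> whose
  parameter length is the perimeter.\<close>

lemma geod_triangle_killed:
  assumes M: "w \<in> mspace X" "a \<in> mspace X" "b \<in> mspace X"
    and k: "kill (ennreal (mdist X w a + mdist X a b + mdist X w b))"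
  shows "geod_chain w a + geod_chain a b - geod_chain w b \<in> (killed_span :: (_ \<Rightarrow>\<^sub>0 'f::field) set)"
proof -
  obtain r where r: "short_curve X r (mdist X w b) b w"
    "segment r 0 (mdist X w b) + segment (geod w b) 0 (mdist X w b) \<in> (bds T :: (_ \<Rightarrow>\<^sub>0 'f) set)"
    using short_curve_rev[OF geod[OF M(1,3)], where 'f = 'f] by blast
  obtain c where c: "short_curve X c (mdist X w a + mdist X a b) w b"
    "segment c 0 (mdist X w a + mdist X a b) - segment (geod w a) 0 (mdist X w a)
      - segment (geod a b) 0 (mdist X a b) \<in> (bds T :: (_ \<Rightarrow>\<^sub>0 'f) set)"
    using short_curve_join[OF geod[OF M(1,2)] geod[OF M(2,3)], where 'f = 'f] by blast
  obtain l where l: "short_curve X l (mdist X w a + mdist X a b + mdist X w b) w w"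
    "segment l 0 (mdist X w a + mdist X a b + mdist X w b) - segment c 0 (mdist X w a + mdist X a b)
      - segment r 0 (mdist X w b) \<in> (bds T :: (_ \<Rightarrow>\<^sub>0 'f) set)"
    using short_curve_join[OF c(1) r(1), where 'f = 'f] by blast
  note s = subspace_killed_span[where 'f = 'f]
  from pm.subspace_diff[OF s pm.subspace_diff[OF s pm.subspace_diff[OF s loop_killed[OF l(1) k]
    bds_killed[OF l(2)]] bds_killed[OF c(2)]] bds_killed[OF r(2)]]
  show ?thesis by (simp add: geod_chain_def algebra_simps)
qed

lemma realize_obds:
  assumes "z \<in> (obds K :: (_ \<Rightarrow>\<^sub>0 'f::field) set)"
  shows "realize z \<in> killed_span"
  unfolding realize_def
proof (rule linear_mem[OF subspace_killed_span assms[unfolded obds_span]])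
  fix s assume "s \<in> (\<lambda>(a, b, c). gen [b, c] - gen [a, c] + gen [a, b] :: _ \<Rightarrow>\<^sub>0 'f) ` {(a, b, c). {a, b, c} \<in> K}"
  then obtain a b c where abc: "{a, b, c} \<in> K" "s = gen [b, c] - gen [a, c] + gen [a, b]" by auto
  from K_cone[OF abc(1)] obtain w where w: "w \<in> mspace X"
    "\<And>u v. u \<in> {a, b, c} \<Longrightarrow> v \<in> {a, b, c} \<Longrightarrow> kill (ennreal (mdist X w u + mdist X u v + mdist X w v))" by blast
  have M: "a \<in> mspace X" "b \<in> mspace X" "c \<in> mspace X" using K_mspace[OF abc(1)] by auto
  have k: "geod_chain w u + geod_chain u v - geod_chain w v \<in> (killed_span :: (_ \<Rightarrow>\<^sub>0 'f) set)"
    if "u \<in> {a, b, c}" "v \<in> {a, b, c}" for u v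
    using that M by (intro geod_triangle_killed w) auto
  note S = subspace_killed_span[where 'f = 'f]
  have "realize s = geod_chain b c - geod_chain a c + geod_chain a b"
    unfolding abc(2) by (simp add: realize_def lin_add lin_diff)
  \<comment> \<open>The boundary of the triangle is an alternating sum of three loops through the
    apex \<open>w\<close>; each spoke occurs twice and cancels.\<close>
  also have "\<dots> \<in> killed_span"
    using pm.subspace_add[OF S pm.subspace_diff[OF S k[of b c] k[of a c]] k[of a b]] by (simp add: algebra_simps)
  finally show "lin (\<lambda>vs. geod_chain (vs ! 0) (vs ! 1)) s \<in> killed_span" by (simp add: realize_def)
qed

lemma ordered_simplices_1:
  assumes "vs \<in> ordered_simplices K 1"
  obtains x y where "vs = [x, y]" "{x, y} \<in> K" "x \<in> mspace X" "y \<in> mspace X"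
proof -
  obtain x y where "vs = [x, y]" using assms by (auto simp: ordered_simplices_def length_Suc_conv One_nat_def)
  then show ?thesis using assms K_mspace[of "{x, y}"] by (intro that) (auto simp: ordered_simplices_def)
qed

lemma pathin_geod:
  assumes "x \<in> mspace X" "y \<in> mspace X"
  shows "pathin T (\<lambda>t. geod x y (0 + t * (mdist X x y - 0)))"
  by (intro pathin_affine[OF _ short_curve_continuous[OF geod[OF assms]]]) auto

text \<open>By \<open>K_edge\<close> all points of the geodesic of an edge span simplices with each
  other, so sampling that geodesic returns the edge up to boundaries.\<close>

lemma sampling_realize:
  assumes "z \<in> pm.span (gen ` ordered_simplices K 1)"
  shows "sampling (realize z) - z \<in> obds K"
proof -
  have "lin (\<lambda>vs. sampling (geod_chain (vs ! 0) (vs ! 1))) z - lin gen z \<in> obds K"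
  proof (rule lin_diff_mem[OF subspace_obds assms])
    fix vs assume "vs \<in> ordered_simplices K 1"
    then obtain x y where v: "vs = [x, y]" "{x, y} \<in> K" "x \<in> mspace X" "y \<in> mspace X"
      by (rule ordered_simplices_1)
    note g = geod[OF v(3,4)]
    have "sampling (segment (geod x y) 0 (mdist X x y)) - gen [geod x y 0, geod x y (mdist X x y)] \<in> obds K"
      by (intro sampling_segment[OF _ short_curve_continuous[OF g]] K_edge[OF v(2) g]) auto
    then show "sampling (geod_chain (vs ! 0) (vs ! 1)) - gen vs \<in> obds K"
      using g by (simp add: v(1) geod_chain_def short_curve_def)
  qed
  then show ?thesis
    using chain_eq_lin[of z] by (simp add: sampling_def realize_def lin_lin)
qed

lemma realize_sampling:
  assumes "y \<in> pm.span (gen ` simplices T 1)"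
  shows "realize (sampling y) - y \<in> bds T"
proof -
  have "lin (\<lambda>\<sigma>. realize (sample (mesh \<sigma>) (simplex_path \<sigma>))) y - lin gen y \<in> bds T"
  proof (rule lin_diff_mem[OF subspace_bds assms])
    fix \<sigma> assume \<sigma>: "\<sigma> \<in> simplices T 1"
    show "realize (sample (mesh \<sigma>) (simplex_path \<sigma>)) - gen \<sigma> \<in> bds T"
      using realize_sample[OF simplex_path_pathin[OF \<sigma>] mesh(2)[OF \<sigma>]]
      by (simp add: path_simplex_simplex_path[OF \<sigma>])
  qed
  then show ?thesis
    using chain_eq_lin[of y] by (simp add: sampling_def realize_def lin_lin)
qed

lemma realize_cycle:
  assumes "z \<in> cycles (ordered_simplices K) ordered_face 1"
  shows "realize z \<in> cycles (simplices T) singular_face 1"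
  unfolding cycles_1
proof
  have z: "z \<in> pm.span (gen ` ordered_simplices K 1)" "boundary ordered_face 1 z = 0"
    using assms by (auto simp: cycles_1)
  show "realize z \<in> pm.span (gen ` simplices T 1)"
    unfolding realize_def
  proof (rule lin_mem[OF pm.subspace_span z(1)])
    fix vs assume "vs \<in> ordered_simplices K 1"
    then obtain x y where v: "vs = [x, y]" "{x, y} \<in> K" "x \<in> mspace X" "y \<in> mspace X"
      by (rule ordered_simplices_1)
    show "geod_chain (vs ! 0) (vs ! 1) \<in> pm.span (gen ` simplices T 1)"
      using path_simplex_in[OF pathin_geod[OF v(3,4)]]
      by (auto simp: v(1) geod_chain_def segment_def intro!: pm.span_base)
  qed
  have "boundary singular_face 1 (realize z) = lin (\<lambda>vs. boundary singular_face 1 (geod_chain (vs ! 0) (vs ! 1))) z"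
    unfolding boundary_1 realize_def by (rule lin_lin)
  \<comment> \<open>The companion map in degree 0 sends a vertex to its point simplex, which makes
    \<open>realize\<close> commute with the boundary.\<close>
  also have "\<dots> = lin (\<lambda>vs. lin (\<lambda>us. gen (point_simplex (hd us))) (gen (ordered_face 1 0 vs) - gen (ordered_face 1 1 vs))) z"
  proof (rule lin_eq[OF z(1)])
    fix vs assume "vs \<in> ordered_simplices K 1"
    then obtain x y where v: "vs = [x, y]" "{x, y} \<in> K" "x \<in> mspace X" "y \<in> mspace X"
      by (rule ordered_simplices_1)
    show "boundary singular_face 1 (geod_chain (vs ! 0) (vs ! 1)) =
      lin (\<lambda>us. gen (point_simplex (hd us))) (gen (ordered_face 1 0 vs) - gen (ordered_face 1 1 vs))"
      using geod[OF v(3,4)]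
      by (simp add: v(1) geod_chain_def segment_def boundary_gen_path_simplex lin_diff short_curve_def)
  qed
  also have "\<dots> = lin (\<lambda>us. gen (point_simplex (hd us))) (boundary ordered_face 1 z)"
    unfolding boundary_1 by (rule lin_lin[symmetric])
  finally show "boundary singular_face 1 (realize z) = 0" by (simp add: z(2) lin_zero)
qed

lemma sampling_cycle:
  assumes "y \<in> cycles (simplices T) singular_face 1"
  shows "sampling y \<in> cycles (ordered_simplices K) ordered_face 1"
  unfolding cycles_1
proof
  have y: "y \<in> pm.span (gen ` simplices T 1)" "boundary singular_face 1 y = 0"
    using assms by (auto simp: cycles_1)
  show "sampling y \<in> pm.span (gen ` ordered_simplices K 1)"
    unfolding sampling_def
  proof (rule lin_mem[OF pm.subspace_span y(1)])
    fix \<sigma> assume \<sigma>: "\<sigma> \<in> simplices T 1"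
    let ?p = "simplex_path \<sigma>" and ?N = "mesh \<sigma>"
    note p = simplex_path_pathin[OF \<sigma>] and N = mesh(1)[OF \<sigma>]
    have "gen [?p (i / ?N), ?p (Suc i / ?N)] \<in> pm.span (gen ` ordered_simplices K 1)" if "i < ?N" for i
    proof -
      have ab: "real i / ?N \<in> {0..1}" "Suc i / ?N \<in> {0..1}" "\<bar>real i / ?N - Suc i / ?N\<bar> \<le> 1 / ?N"
        using that by (auto simp: divide_le_eq_1 diff_divide_distrib[symmetric])
      have d: "mdist X (?p s) (?p t) < \<epsilon>" if "s \<in> {0..1}" "t \<in> {0..1}" "\<bar>s - t\<bar> \<le> 1 / ?N" for s t
        using N that by (simp add: fine_def)
      have "{?p (i / ?N), ?p (Suc i / ?N)} \<in> K"
      proof (rule small)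
        fix u v assume "u \<in> {?p (i / ?N), ?p (Suc i / ?N)}" "v \<in> {?p (i / ?N), ?p (Suc i / ?N)}"
        then obtain s t where st: "u = ?p s" "v = ?p t" "s \<in> {real i / ?N, Suc i / ?N}" "t \<in> {real i / ?N, Suc i / ?N}"
          by blast
        then have "\<bar>s - t\<bar> \<le> 1 / ?N" using ab(3) by auto
        then show "mdist X u v < \<epsilon>" using st ab unfolding st(1,2) by (intro d) auto
      qed (use path_mspace[OF p] ab in auto)
      then show ?thesis by (intro pm.span_base) (auto simp: ordered_simplices_def One_nat_def)
    qed
    then show "sample ?N ?p \<in> pm.span (gen ` ordered_simplices K 1)"
      unfolding sample_def by (intro pm.span_sum) auto
  qed
  have "boundary ordered_face 1 (sampling y) = lin (\<lambda>\<sigma>. boundary ordered_face 1 (sample (mesh \<sigma>) (simplex_path \<sigma>))) y"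
    unfolding boundary_1 sampling_def by (rule lin_lin)
  \<comment> \<open>In degree 0 a point simplex is sent to its value at the only point of the
    standard 0-simplex.\<close>
  also have "\<dots> = lin (\<lambda>\<sigma>. lin (\<lambda>\<rho>. gen [\<rho> (\<lambda>j. if j = 0 then 1 else 0)])
      (gen (singular_face 1 0 \<sigma>) - gen (singular_face 1 1 \<sigma>))) y"
  proof (rule lin_eq[OF y(1)])
    fix \<sigma> assume \<sigma>: "\<sigma> \<in> simplices T 1"
    have N: "0 < mesh \<sigma>" using mesh(1)[OF \<sigma>] by (simp add: fine_def)
    have *: "point_simplex u (\<lambda>j. if j = 0 then 1 else 0) = u" for u :: 'a
      by (simp add: point_simplex_def)
    show "boundary ordered_face 1 (sample (mesh \<sigma>) (simplex_path \<sigma>)) =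
      lin (\<lambda>\<rho>. gen [\<rho> (\<lambda>j. if j = 0 then 1 else 0)]) (gen (singular_face 1 0 \<sigma>) - gen (singular_face 1 1 \<sigma>))"
      using boundary_path_simplex[of "simplex_path \<sigma>"]
      by (simp add: boundary_sample[OF N] path_simplex_simplex_path[OF \<sigma>] lin_diff *)
  qed
  also have "\<dots> = lin (\<lambda>\<rho>. gen [\<rho> (\<lambda>j. if j = 0 then 1 else 0)]) (boundary singular_face 1 y)"
    unfolding boundary_1 by (rule lin_lin[symmetric])
  finally show "boundary ordered_face 1 (sampling y) = 0" by (simp add: y(2) lin_zero)
qed

text \<open>This identifies the kernel of the map from the homology of the complex to H_1(X) / L_r.
  \<open>sampling\<close> provides the inverse that brings killed cycles back to boundaries.\<close>

theorem obds_iff_realize_killed: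
  assumes "z \<in> cycles (ordered_simplices K) ordered_face 1"
  shows "z \<in> obds K \<longleftrightarrow> realize z \<in> killed_span"
proof
  assume "realize z \<in> killed_span"
  then have "sampling (realize z) \<in> obds K" by (rule sampling_killed)
  moreover have "sampling (realize z) - z \<in> obds K"
    using assms by (intro sampling_realize) (simp add: cycles_1)
  ultimately show "z \<in> obds K" using pm.subspace_diff[OF subspace_obds] by fastforce
qed (rule realize_obds)

text \<open>Classes are hit modulo \<open>bds T\<close>, not merely modulo
  \<open>killed_span\<close>, so the coordinates of \<open>realize z\<close> can be prescribed
  exactly.\<close>

theorem realize_onto:
  assumes "y \<in> cycles (simplices T) singular_face 1"
  shows "\<exists>z\<in>cycles (ordered_simplices K) ordered_face 1. realize z - y \<in> bds T"
  using sampling_cycle[OF assms] realize_sampling[of y] assms by (auto simp: cycles_1)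

text \<open>The loop need not be Lipschitz. The geodesic polygon through its sample points is
  homologous to it, is traced by a short curve, and is no longer than the loop, hence killed by
  \<open>kill_mono\<close>.\<close>

lemma short_loop_killed:
  assumes a: "is_loop X a" and k: "kill (path_length X a)"
  shows "gen (path_simplex a) \<in> (killed_span :: (_ \<Rightarrow>\<^sub>0 'f::field) set)"
proof -
  have p: "pathin T a" and a01: "a 0 = a 1" using a by (auto simp: is_loop_def)
  obtain N where N: "local_fine N a" using local_fine_exists[OF p] by blast
  then have N0: "0 < N" by (simp add: local_fine_def)
  let ?x = "\<lambda>i. a (real i / N)"
  let ?D = "\<Sum>i<N. mdist X (?x i) (?x (Suc i))"
  have x: "?x i \<in> mspace X" if "i \<le> N" for i
    using that by (intro path_mspace[OF p]) (auto simp: divide_le_eq_1)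
  obtain c where c: "short_curve X c ?D (?x 0) (?x N)"
    "segment c 0 ?D - (\<Sum>i<N. geod_chain (?x i) (?x (Suc i))) \<in> (bds T :: (_ \<Rightarrow>\<^sub>0 'f) set)"
    using geodesic_polygon[of N ?x, OF x, where 'f = 'f] by blast
  have "?x N = ?x 0" using N0 a01 by simp
  then have "short_curve X c ?D (?x 0) (?x 0)" using c(1) by simp
  moreover have "kill (ennreal ?D)"
    using polygon_le_path_length[OF N0] k by (rule kill_mono)
  ultimately have l: "segment c 0 ?D \<in> (killed_span :: (_ \<Rightarrow>\<^sub>0 'f) set)" by (rule loop_killed)
  have r: "realize (sample N a) - gen (path_simplex a) \<in> (bds T :: (_ \<Rightarrow>\<^sub>0 'f) set)"
    by (rule realize_sample[OF p N])
  have s: "realize (sample N a) = (\<Sum>i<N. geod_chain (?x i) (?x (Suc i)) :: _ \<Rightarrow>\<^sub>0 'f)"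
    by (simp add: sample_def realize_def lin_sum)
  note S = subspace_killed_span[where 'f = 'f]
  from pm.subspace_diff[OF S pm.subspace_diff[OF S l bds_killed[OF c(2)]] bds_killed[OF r]]
  show ?thesis unfolding s by (simp add: algebra_simps)
qed

end

section \<open>Homology as a vector space and lexicographically minimal bases\<close>

lemma field_field_ring: "field (field_ring :: 'f::field ring)"
proof (rule cring.cring_fieldI)
  show "cring (field_ring :: 'f ring)"
  proof (rule cringI)
    show "abelian_group (field_ring :: 'f ring)"
      by (rule abelian_groupI) (auto simp: algebra_simps intro: exI[of _ "- x" for x])
    show "Group.comm_monoid (field_ring :: 'f ring)"
      by (rule comm_monoidI) (auto simp: algebra_simps)
  qed (auto simp: algebra_simps)
  show "Units (field_ring :: 'f ring) = carrier field_ring - {\<zero>\<^bsub>field_ring\<^esub>}"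
    by (auto simp: Units_def intro: exI[of _ "inverse x" for x] right_inverse left_inverse)
qed

section \<open>Cosets of chains and homology as a vector space\<close>

lemma coset_eq_iff:
  fixes B :: "('x \<Rightarrow>\<^sub>0 'f::field) set"
  assumes B: "pm.subspace B"
  shows "z +o B = w +o B \<longleftrightarrow> z - w \<in> B"
proof
  assume "z +o B = w +o B"
  moreover have "z \<in> z +o B" using pm.subspace_0[OF B] by (force simp: elt_set_plus_def)
  ultimately obtain b where "b \<in> B" "z = w + b" by (auto simp: elt_set_plus_def)
  then show "z - w \<in> B" by simp
next
  assume zw: "z - w \<in> B"
  have "u +o B \<subseteq> v +o B" if "u - v \<in> B" for u v
  proof
    fix c assume "c \<in> u +o B"
    then obtain b where "b \<in> B" "c = u + b" by (auto simp: elt_set_plus_def)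
    then have "(u - v) + b \<in> B" "c = v + ((u - v) + b)" using that pm.subspace_add[OF B] by auto
    then show "c \<in> v +o B" unfolding elt_set_plus_def by blast
  qed
  from this[OF zw] this[of w z] pm.subspace_neg[OF B zw] show "z +o B = w +o B" by auto
qed

lemma coset_add:
  fixes B :: "('x \<Rightarrow>\<^sub>0 'f::field) set"
  assumes B: "pm.subspace B"
  shows "(z +o B) + (w +o B) = (z + w) +o B"
proof -
  have "\<exists>b\<in>B. z + b1 + (w + b2) = z + w + b" if "b1 \<in> B" "b2 \<in> B" for b1 b2
    using that by (intro bexI[of _ "b1 + b2"] pm.subspace_add[OF B]) (auto simp: algebra_simps)
  moreover have "\<exists>b1\<in>B. \<exists>b2\<in>B. z + w + b = z + b1 + (w + b2)" if "b \<in> B" for b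
    using that pm.subspace_0[OF B] by (intro bexI[of _ b] bexI[of _ 0]) (auto simp: algebra_simps)
  ultimately show ?thesis by (force simp: elt_set_plus_def set_plus_def)
qed

lemma coset_zero:
  fixes B :: "('x \<Rightarrow>\<^sub>0 'f::field) set"
  shows "0 +o B = B"
  by (simp add: elt_set_plus_def)

lemma coset_plus_subspace:
  fixes B :: "('x \<Rightarrow>\<^sub>0 'f::field) set"
  assumes B: "pm.subspace B" and "B' \<subseteq> B" "pm.subspace B'"
  shows "(z +o B') + B = z +o B"
proof -
  have "\<exists>b\<in>B. z + b1 + b2 = z + b" if "b1 \<in> B'" "b2 \<in> B" for b1 b2
    using that assms(2) by (intro bexI[of _ "b1 + b2"] pm.subspace_add[OF B]) (auto simp: algebra_simps)
  moreover have "\<exists>b1\<in>B'. \<exists>b2\<in>B. z + b = z + b1 + b2" if "b \<in> B" for b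
    using that pm.subspace_0[OF assms(3)] by (intro bexI[of _ 0] bexI[of _ b]) (auto simp: algebra_simps)
  ultimately show ?thesis by (force simp: elt_set_plus_def set_plus_def)
qed

lemma coset_scale:
  fixes B :: "('x \<Rightarrow>\<^sub>0 'f::field) set"
  assumes B: "pm.subspace B"
  shows "scl c ` (z +o B) + B = scl c z +o B"
proof -
  have "\<exists>b\<in>B. scl c (z + b1) + b2 = scl c z + b" if "b1 \<in> B" "b2 \<in> B" for b1 b2
    using that by (intro bexI[of _ "scl c b1 + b2"] pm.subspace_add[OF B] pm.subspace_scale[OF B])
      (auto simp: pm.scale_right_distrib)
  moreover have "\<exists>b1\<in>B. \<exists>b2\<in>B. scl c z + b = scl c (z + b1) + b2" if "b \<in> B" for b
    using that pm.subspace_0[OF B] by (intro bexI[of _ 0] bexI[of _ b]) auto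
  ultimately show ?thesis by (force simp: elt_set_plus_def set_plus_def)
qed

lemma subspace_boundaries_1: "pm.subspace (boundaries S d 1 :: ('x \<Rightarrow>\<^sub>0 'f::field) set)"
  unfolding boundaries_1 by (rule pm.subspace_span)

lemma homology_simps:
  "carrier (homology S d 1) = (\<lambda>z. z +o boundaries S d 1) ` cycles S d 1"
  "add (homology S d 1) = (+)"
  "zero (homology S d 1) = boundaries S d 1"
  "smult (homology S d 1) c C = scl c ` C + boundaries S d 1"
  by (simp_all add: homology_def scl_def[abs_def])

lemma homology_coset_simps:
  fixes S :: "nat \<Rightarrow> 'x set" and d and B :: "('x \<Rightarrow>\<^sub>0 'f::field) set"
  defines "B \<equiv> boundaries S d 1"
  shows "add (homology S d 1) (z +o B) (w +o B) = (z + w) +o B"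
    "smult (homology S d 1) c (z +o B) = scl c z +o B"
  unfolding homology_simps B_def by (simp_all add: coset_add coset_scale subspace_boundaries_1)

lemma vectorspace_homology:
  fixes S :: "nat \<Rightarrow> 'x set" and d
  shows "vectorspace field_ring (homology S d 1 :: ('f::field, ('x \<Rightarrow>\<^sub>0 'f) set) module)"
proof -
  let ?H = "homology S d 1 :: ('f, ('x \<Rightarrow>\<^sub>0 'f) set) module"
  let ?B = "boundaries S d 1 :: ('x \<Rightarrow>\<^sub>0 'f) set" and ?Z = "cycles S d 1 :: ('x \<Rightarrow>\<^sub>0 'f) set"
  note Z = subspace_cycles_1[of S d, where 'b = 'f]
  note simps = homology_simps(1) homology_coset_simps
  have zero: "\<zero>\<^bsub>?H\<^esub> = 0 +o ?B" unfolding homology_simps coset_zero ..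
  have "abelian_group ?H"
  proof (rule abelian_groupI)
    show "\<exists>y\<in>carrier ?H. y \<oplus>\<^bsub>?H\<^esub> x = \<zero>\<^bsub>?H\<^esub>" if x: "x \<in> carrier ?H" for x
    proof -
      obtain z where z: "z \<in> ?Z" "x = z +o ?B" using x unfolding homology_simps by blast
      have "(- z) +o ?B \<in> carrier ?H" using pm.subspace_neg[OF Z z(1)] unfolding homology_simps by blast
      moreover have "((- z) +o ?B) \<oplus>\<^bsub>?H\<^esub> x = \<zero>\<^bsub>?H\<^esub>" unfolding zero z(2) simps by simp
      ultimately show ?thesis by blast
    qed
  qed (use pm.subspace_0[OF Z] in \<open>auto simp: simps zero pm.subspace_add[OF Z] add_ac simp del: set_zero_plus\<close>)
  then have "Module.module field_ring ?H"
    using field_field_ring[where 'f = 'f]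
    by (intro moduleI)
      (auto simp: simps pm.subspace_scale[OF Z] pm.scale_left_distrib pm.scale_right_distrib field_def domain_def)
  then show ?thesis by (rule vectorspace.intro) (rule field_field_ring)
qed

text \<open>Transfers linear algebra from cosets to chains; each inclusion is the minimality of one
  of the two spans.\<close>

lemma span_homology:
  fixes S :: "nat \<Rightarrow> 'x set" and d and A :: "('x \<Rightarrow>\<^sub>0 'f::field) set"
  assumes A: "A \<subseteq> cycles S d 1"
  shows "LinearCombinations.module.span field_ring (homology S d 1) ((\<lambda>z. z +o boundaries S d 1) ` A) =
    (\<lambda>z. z +o boundaries S d 1) ` pm.span A"
proof -
  let ?H = "homology S d 1 :: ('f, ('x \<Rightarrow>\<^sub>0 'f) set) module"
  let ?B = "boundaries S d 1 :: ('x \<Rightarrow>\<^sub>0 'f) set" and ?Z = "cycles S d 1 :: ('x \<Rightarrow>\<^sub>0 'f) set"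
  let ?q = "\<lambda>z. z +o ?B"
  interpret H: vectorspace field_ring ?H by (rule vectorspace_homology)
  note Z = subspace_cycles_1[of S d, where 'b = 'f]
  have qA: "?q ` A \<subseteq> carrier ?H" using A unfolding homology_simps by blast
  have AZ: "pm.span A \<subseteq> ?Z" by (rule pm.span_minimal[OF A Z])
  have zero: "\<zero>\<^bsub>?H\<^esub> = 0 +o ?B" unfolding homology_simps coset_zero ..
  show ?thesis
  proof
    have "LinearCombinations.submodule field_ring (?q ` pm.span A) ?H"
      unfolding LinearCombinations.submodule_def
    proof (intro conjI)
      show "Module.module field_ring ?H" by (rule H.module_axioms)
      show "?q ` pm.span A \<subseteq> carrier ?H" using AZ unfolding homology_simps by blast
      show "\<zero>\<^bsub>?H\<^esub> \<in> ?q ` pm.span A" unfolding zero using pm.span_zero by blast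
    qed (auto simp: homology_coset_simps intro!: imageI pm.span_add pm.span_scale)
    then show "H.span (?q ` A) \<subseteq> ?q ` pm.span A"
      using pm.span_superset by (intro H.span_is_subset) blast
    have sub: "LinearCombinations.submodule field_ring (H.span (?q ` A)) ?H"
      by (rule H.span_is_submodule[OF qA])
    have "pm.subspace {z. ?q z \<in> H.span (?q ` A)}"
    proof (rule pm.subspaceI)
      show "0 \<in> {z. ?q z \<in> H.span (?q ` A)}"
        using sub unfolding LinearCombinations.submodule_def zero by simp
    next
      fix x y assume "x \<in> {z. ?q z \<in> H.span (?q ` A)}" "y \<in> {z. ?q z \<in> H.span (?q ` A)}"
      then have "add ?H (?q x) (?q y) \<in> H.span (?q ` A)"
        using sub unfolding LinearCombinations.submodule_def by blast
      then show "x + y \<in> {z. ?q z \<in> H.span (?q ` A)}" by (simp add: homology_coset_simps)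
    next
      fix c x assume "x \<in> {z. ?q z \<in> H.span (?q ` A)}"
      then have "smult ?H c (?q x) \<in> H.span (?q ` A)"
        using sub unfolding LinearCombinations.submodule_def by simp
      then show "scl c x \<in> {z. ?q z \<in> H.span (?q ` A)}" by (simp add: homology_coset_simps)
    qed
    then have "pm.span A \<subseteq> {z. ?q z \<in> H.span (?q ` A)}"
      using H.in_own_span[OF qA] by (intro pm.span_minimal) auto
    then show "?q ` pm.span A \<subseteq> H.span (?q ` A)" by blast
  qed
qed

text \<open>The right-hand side speaks of chains only, so replacing one loop of a base by another
  can be handled without quotients.\<close>

lemma span_homology_eq_carrier:
  fixes S :: "nat \<Rightarrow> 'x set" and d and A :: "('x \<Rightarrow>\<^sub>0 'f::field) set"
  assumes A: "A \<subseteq> cycles S d 1"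
  shows "LinearCombinations.module.span field_ring (homology S d 1) ((\<lambda>z. z +o boundaries S d 1) ` A) =
    carrier (homology S d 1) \<longleftrightarrow> cycles S d 1 \<subseteq> pm.span (A \<union> boundaries S d 1)"
proof -
  let ?B = "boundaries S d 1 :: ('x \<Rightarrow>\<^sub>0 'f) set" and ?Z = "cycles S d 1 :: ('x \<Rightarrow>\<^sub>0 'f) set"
  let ?q = "\<lambda>z. z +o ?B"
  note B = subspace_boundaries_1[of S d, where 'f = 'f]
  have AZ: "pm.span A \<subseteq> ?Z" by (rule pm.span_minimal[OF A subspace_cycles_1])
  have "?q ` pm.span A = ?q ` ?Z \<longleftrightarrow> (\<forall>z\<in>?Z. \<exists>a\<in>pm.span A. z - a \<in> ?B)"
  proof
    assume eq: "?q ` pm.span A = ?q ` ?Z"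
    show "\<forall>z\<in>?Z. \<exists>a\<in>pm.span A. z - a \<in> ?B"
    proof
      fix z assume "z \<in> ?Z"
      then have "?q z \<in> ?q ` pm.span A" unfolding eq by (rule imageI)
      then obtain a where "a \<in> pm.span A" "?q z = ?q a" by (rule imageE) blast
      then show "\<exists>a\<in>pm.span A. z - a \<in> ?B" using coset_eq_iff[OF B, of z a] by blast
    qed
  next
    assume *: "\<forall>z\<in>?Z. \<exists>a\<in>pm.span A. z - a \<in> ?B"
    have "?q ` ?Z \<subseteq> ?q ` pm.span A"
    proof
      fix C assume "C \<in> ?q ` ?Z"
      then obtain z where z: "z \<in> ?Z" "C = ?q z" by (rule imageE) blast
      with * obtain a where "a \<in> pm.span A" "z - a \<in> ?B" by blast
      then show "C \<in> ?q ` pm.span A" using coset_eq_iff[OF B, of z a] z(2) by blast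
    qed
    with AZ show "?q ` pm.span A = ?q ` ?Z" by blast
  qed
  also have "\<dots> \<longleftrightarrow> ?Z \<subseteq> pm.span (A \<union> ?B)"
  proof -
    have "z \<in> pm.span (A \<union> ?B) \<longleftrightarrow> (\<exists>a\<in>pm.span A. z - a \<in> ?B)" for z
    proof -
      have "z \<in> pm.span (A \<union> ?B) \<longleftrightarrow> (\<exists>a\<in>pm.span A. \<exists>b\<in>?B. z = a + b)"
        unfolding pm.span_Un pm.span_eq_iff[THEN iffD2, OF B] by blast
      also have "\<dots> \<longleftrightarrow> (\<exists>a\<in>pm.span A. z - a \<in> ?B)"
        by (metis add.commute add_diff_cancel_left' diff_add_cancel)
      finally show ?thesis .
    qed
    then show ?thesis by blast
  qed
  finally show ?thesis by (simp only: span_homology[OF A] homology_simps)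
qed

text \<open>The source of linear independence: a family with as many members as the dimension has no
  redundant generator.\<close>

lemma dim_homology_le:
  fixes S :: "nat \<Rightarrow> 'x set" and d and A :: "('x \<Rightarrow>\<^sub>0 'f::field) set"
  assumes A: "A \<subseteq> cycles S d 1" "finite A" "cycles S d 1 \<subseteq> pm.span (A \<union> boundaries S d 1)"
  shows "vectorspace.dim field_ring (homology S d 1 :: ('f, ('x \<Rightarrow>\<^sub>0 'f) set) module) \<le> card A"
proof -
  let ?H = "homology S d 1 :: ('f, ('x \<Rightarrow>\<^sub>0 'f) set) module"
  interpret H: vectorspace field_ring ?H by (rule vectorspace_homology)
  have "H.dim \<le> card ((\<lambda>z. z +o boundaries S d 1) ` A)"
  proof (rule H.gen_ge_dim)
    show "(\<lambda>z. z +o boundaries S d 1) ` A \<subseteq> carrier ?H" using A(1) unfolding homology_simps by blast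
  qed (use A span_homology_eq_carrier[OF A(1)] in auto)
  also have "\<dots> \<le> card A" by (rule card_image_le[OF A(2)])
  finally show ?thesis .
qed

section \<open>Exchange modulo a subspace, and its effect on sorted lists of lengths\<close>

lemma sum_gen_span:
  fixes B :: "('x \<Rightarrow>\<^sub>0 'f::field) set"
  assumes B: "pm.subspace B"
  shows "z \<in> pm.span (v ` I \<union> B) \<Longrightarrow> finite I \<Longrightarrow> \<exists>c. z - (\<Sum>i\<in>I. scl (c i) (v i)) \<in> B"
proof -
  assume z: "z \<in> pm.span (v ` I \<union> B)" and I: "finite I"
  have "pm.subspace {z. \<exists>c. z - (\<Sum>i\<in>I. scl (c i) (v i)) \<in> B}"
  proof (rule pm.subspaceI)
    show "0 \<in> {z. \<exists>c. z - (\<Sum>i\<in>I. scl (c i) (v i)) \<in> B}"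
      using pm.subspace_0[OF B] by (auto intro!: exI[of _ "\<lambda>_. 0"])
  next
    fix x y assume "x \<in> {z. \<exists>c. z - (\<Sum>i\<in>I. scl (c i) (v i)) \<in> B}" "y \<in> {z. \<exists>c. z - (\<Sum>i\<in>I. scl (c i) (v i)) \<in> B}"
    then obtain c c' where "x - (\<Sum>i\<in>I. scl (c i) (v i)) \<in> B" "y - (\<Sum>i\<in>I. scl (c' i) (v i)) \<in> B" by blast
    from pm.subspace_add[OF B this] have "x + y - (\<Sum>i\<in>I. scl (c i + c' i) (v i)) \<in> B"
      by (simp add: pm.scale_left_distrib sum.distrib algebra_simps)
    then show "x + y \<in> {z. \<exists>c. z - (\<Sum>i\<in>I. scl (c i) (v i)) \<in> B}" by (intro CollectI exI)
  next
    fix r x assume "x \<in> {z. \<exists>c. z - (\<Sum>i\<in>I. scl (c i) (v i)) \<in> B}"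
    then obtain c where "x - (\<Sum>i\<in>I. scl (c i) (v i)) \<in> B" by blast
    from pm.subspace_scale[OF B this, of r] have "scl r x - (\<Sum>i\<in>I. scl (r * c i) (v i)) \<in> B"
      by (simp add: pm.scale_right_diff_distrib pm.scale_sum_right)
    then show "scl r x \<in> {z. \<exists>c. z - (\<Sum>i\<in>I. scl (c i) (v i)) \<in> B}" by (intro CollectI exI)
  qed
  moreover have "v ` I \<union> B \<subseteq> {z. \<exists>c. z - (\<Sum>i\<in>I. scl (c i) (v i)) \<in> B}"
  proof
    fix x assume "x \<in> v ` I \<union> B"
    then show "x \<in> {z. \<exists>c. z - (\<Sum>i\<in>I. scl (c i) (v i)) \<in> B}"
    proof
      assume "x \<in> v ` I"
      then obtain j where j: "j \<in> I" "x = v j" by blast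
      have "(\<Sum>i\<in>I. scl (if i = j then 1 else 0) (v i)) = (\<Sum>i\<in>I. if i = j then v i else 0)"
        by (intro sum.cong) auto
      also have "\<dots> = x" using I j by (simp add: sum.delta)
      finally show ?thesis using pm.subspace_0[OF B] by (auto intro!: exI[of _ "\<lambda>i. if i = j then 1 else 0"])
    qed (auto intro!: exI[of _ "\<lambda>_. 0"])
  qed
  ultimately show ?thesis using z pm.span_minimal by blast
qed

text \<open>Steinitz exchange modulo \<open>B\<close>: the relation expressing \<open>y\<close> is
  solved for \<open>v j\<close>, whose coefficient is invertible.\<close>

lemma exchange_span:
  fixes B :: "('x \<Rightarrow>\<^sub>0 'f::field) set"
  assumes B: "pm.subspace B" and I: "finite I" "j \<in> I" and c: "y - (\<Sum>i\<in>I. scl (c i) (v i)) \<in> B" "c j \<noteq> 0"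
  shows "pm.span (v ` I \<union> B) \<subseteq> pm.span (insert y (v ` (I - {j})) \<union> B)"
proof (rule pm.span_minimal[OF _ pm.subspace_span])
  let ?W = "pm.span (insert y (v ` (I - {j})) \<union> B)"
  have i: "v i \<in> ?W" if "i \<in> I" "i \<noteq> j" for i using that by (intro pm.span_base) auto
  have "y - (y - (\<Sum>i\<in>I. scl (c i) (v i))) - (\<Sum>i\<in>I - {j}. scl (c i) (v i)) \<in> ?W"
  proof (intro pm.span_diff[OF pm.span_diff])
    show "y \<in> ?W" "y - (\<Sum>i\<in>I. scl (c i) (v i)) \<in> ?W" using c(1) by (auto intro: pm.span_base)
    show "(\<Sum>i\<in>I - {j}. scl (c i) (v i)) \<in> ?W" by (intro pm.span_sum pm.span_scale i) auto
  qed
  also have "y - (y - (\<Sum>i\<in>I. scl (c i) (v i))) - (\<Sum>i\<in>I - {j}. scl (c i) (v i)) = scl (c j) (v j)"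
    using I by (simp add: sum.remove[of I j])
  finally have "scl (inverse (c j)) (scl (c j) (v j)) \<in> ?W" by (rule pm.span_scale)
  then have "v j \<in> ?W" using c(2) by simp
  with i have "v ` I \<subseteq> ?W" by blast
  moreover have "B \<subseteq> ?W" using pm.span_superset by blast
  ultimately show "v ` I \<union> B \<subseteq> ?W" by blast
qed

text \<open>The new entry is sorted in no later than position \<open>j\<close> and pushes the
  entries in between one place up, so the leftmost entry that changes becomes smaller.\<close>

lemma lexordp_insort_drop:
  fixes xs :: "'a::linorder list"
  assumes "sorted xs" "j < length xs" "y < xs ! j"
  shows "ord_class.lexordp (insort y (take j xs @ drop (Suc j) xs)) xs"
  using assms
proof (induction xs arbitrary: j)
  case (Cons x xs)
  have s: "sorted xs" "\<And>u. u \<in> set xs \<Longrightarrow> x \<le> u" using Cons.prems(1) by auto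
  show ?case
  proof (cases j)
    case 0
    then have "insort y xs = y # xs" using Cons.prems(3) s by (intro insort_is_Cons) force
    then show ?thesis using 0 Cons.prems(3) by simp
  next
    case (Suc k)
    let ?r = "take k xs @ drop (Suc k) xs"
    have IH: "ord_class.lexordp (insort y ?r) xs" using Cons Suc s(1) by simp
    show ?thesis
    proof (cases y x rule: linorder_cases)
      \<comment> \<open>\<open>insort\<close> puts \<open>y\<close> before the equal head
        \<open>x\<close>. After the common head, \<open>x # ?r\<close> is compared with
        \<open>xs\<close>; as \<open>x = y\<close> is a lower bound of \<open>?r\<close>, that list
        is \<open>insort y ?r\<close> and the induction hypothesis applies.\<close>
      case equal
      have "y \<le> u" if "u \<in> set ?r" for u
        using s(2)[of u] equal that set_take_subset[of k xs] set_drop_subset[of "Suc k" xs] by auto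
      then have "insort y ?r = y # ?r" by (intro insort_is_Cons) auto
      then show ?thesis using IH Suc equal by simp
    next
      case less
      then show ?thesis using Suc by auto
    next
      case greater
      then show ?thesis using IH Suc by (simp add: not_le[symmetric])
    qed
  qed
qed simp

lemma sorted_take_drop:
  assumes "sorted xs" "j < length xs"
  shows "sorted (take j xs @ drop (Suc j) xs)"
proof -
  have "sorted (take j xs @ xs ! j # drop (Suc j) xs)"
    using assms(1) id_take_nth_drop[OF assms(2)] by simp
  then show ?thesis by (auto simp: sorted_append)
qed

lemma map_insort_key: "map f (insort_key f b xs) = insort (f b) (map f xs)"
  by (induction xs) auto

definition loop_chain :: "(real \<Rightarrow> 'a) \<Rightarrow> ((nat \<Rightarrow> real) \<Rightarrow> 'a) \<Rightarrow>\<^sub>0 'f::field"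
  where "loop_chain a = gen (path_simplex a)"

lemma is_loop_base_iff:
  fixes F :: "'f::field itself"
  shows "is_loop_base F X as \<longleftrightarrow>
    length as = vectorspace.dim field_ring (singular_homology 1 X :: ('f, _) module) \<and>
    (\<forall>a\<in>set as. is_loop X a) \<and> sorted (map (path_length X) as) \<and>
    cycles (simplices (mtopology_of X)) singular_face 1
      \<subseteq> (pm.span (loop_chain ` set as \<union> bds (mtopology_of X)) :: (_ \<Rightarrow>\<^sub>0 'f) set)"
proof -
  let ?S = "simplices (mtopology_of X)"
  have "loop_class X ` set as = (\<lambda>z. z +o (bds (mtopology_of X) :: (_ \<Rightarrow>\<^sub>0 'f) set)) ` loop_chain ` set as"
    by (auto simp: loop_class_def loop_chain_def path_simplex_def image_image)
  moreover have "loop_chain ` set as \<subseteq> (cycles ?S singular_face 1 :: (_ \<Rightarrow>\<^sub>0 'f) set)" if "\<forall>a\<in>set as. is_loop X a"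
    using that path_simplex_cycle by (fastforce simp: loop_chain_def is_loop_def)
  ultimately show ?thesis
    unfolding is_loop_base_def Let_def using span_homology_eq_carrier by metis
qed

section \<open>Coordinates with respect to a lexicographically minimal base\<close>

locale minimal_loop_base =
  fixes X :: "'a metric" and as :: "(real \<Rightarrow> 'a) list" and F :: "'f::field itself"
  assumes minimal: "lex_minimal_base F X as"
begin

abbreviation "n \<equiv> length as"
abbreviation "Z \<equiv> cycles (simplices (mtopology_of X)) singular_face 1 :: (((nat \<Rightarrow> real) \<Rightarrow> 'a) \<Rightarrow>\<^sub>0 'f) set"
abbreviation "B \<equiv> bds (mtopology_of X) :: (((nat \<Rightarrow> real) \<Rightarrow> 'a) \<Rightarrow>\<^sub>0 'f) set"
abbreviation "v \<equiv> \<lambda>i. loop_chain (as ! i) :: ((nat \<Rightarrow> real) \<Rightarrow> 'a) \<Rightarrow>\<^sub>0 'f"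
abbreviation "comb \<equiv> \<lambda>c. \<Sum>i<n. scl (c i) (v i)"

lemma base: "is_loop_base F X as"
  using minimal by (simp add: lex_minimal_base_def)

lemma loops: "a \<in> set as \<Longrightarrow> is_loop X a"
  using base by (simp add: is_loop_base_iff)

lemma loop_chain_cycle: "is_loop X a \<Longrightarrow> loop_chain a \<in> Z"
  by (auto simp: loop_chain_def is_loop_def intro: path_simplex_cycle)

lemma image_v: "v ` {..<n} = loop_chain ` set as"
  by (auto simp: set_conv_nth)

lemma generating: "Z \<subseteq> pm.span (v ` {..<n} \<union> B)"
  using base unfolding image_v by (simp add: is_loop_base_iff)

lemma v_cycle: "i < n \<Longrightarrow> v i \<in> Z"
  by (intro loop_chain_cycle loops) simp

lemma card_ge:
  assumes "A \<subseteq> Z" "finite A" "Z \<subseteq> pm.span (A \<union> B)"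
  shows "n \<le> card A"
  using dim_homology_le[OF assms] base by (simp add: is_loop_base_iff)

text \<open>A relation with a nonzero coefficient at \<open>i\<close> allows exchanging
  \<open>v i\<close> for the chain 0, which leaves fewer generators than the dimension.\<close>

lemma independent:
  assumes c: "comb c \<in> B" and i: "i < n"
  shows "c i = 0"
proof (rule ccontr)
  assume ci: "c i \<noteq> 0"
  have "0 - comb c \<in> B" using pm.subspace_neg[OF subspace_bds c] by simp
  from exchange_span[OF subspace_bds finite_lessThan _ this ci] i
  have "Z \<subseteq> pm.span (insert 0 (v ` ({..<n} - {i})) \<union> B)" using generating by blast
  also have "\<dots> = pm.span (v ` ({..<n} - {i}) \<union> B)"
    using pm.span_insert_0 by simp
  finally have "n \<le> card (v ` ({..<n} - {i}))"
    using v_cycle by (intro card_ge) auto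
  also have "\<dots> \<le> card ({..<n} - {i})" by (rule card_image_le) simp
  also have "\<dots> < n" using i by simp
  finally show False by simp
qed

text \<open>The choice is unique at indices below \<open>n\<close> by independence; at other indices
  the value is arbitrary.\<close>

definition coords :: "(((nat \<Rightarrow> real) \<Rightarrow> 'a) \<Rightarrow>\<^sub>0 'f) \<Rightarrow> nat \<Rightarrow> 'f"
  where "coords z = (SOME c. z - comb c \<in> B)"

lemma coords: "z \<in> Z \<Longrightarrow> z - comb (coords z) \<in> B"
proof -
  assume "z \<in> Z"
  then have "z \<in> pm.span (v ` {..<n} \<union> B)" using generating by blast
  then have "\<exists>c. z - comb c \<in> B" by (rule sum_gen_span[OF subspace_bds]) simp
  then show ?thesis unfolding coords_def by (rule someI_ex)
qed

lemma coords_unique: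
  assumes "z \<in> Z" "z - comb c \<in> B" "i < n"
  shows "coords z i = c i"
proof -
  have "comb (\<lambda>i. c i - coords z i) \<in> B"
    using pm.subspace_diff[OF subspace_bds coords[OF assms(1)] assms(2)]
    by (simp add: pm.scale_left_diff_distrib sum_subtractf)
  from independent[OF this assms(3)] show ?thesis by simp
qed

lemma coords_add:
  assumes "z \<in> Z" "w \<in> Z" "i < n"
  shows "coords (z + w) i = coords z i + coords w i"
proof (rule coords_unique[OF _ _ assms(3)])
  show "z + w \<in> Z" using assms by (intro pm.subspace_add[OF subspace_cycles_1])
  show "z + w - comb (\<lambda>i. coords z i + coords w i) \<in> B"
    using pm.subspace_add[OF subspace_bds coords[OF assms(1)] coords[OF assms(2)]]
    by (simp add: pm.scale_left_distrib sum.distrib algebra_simps)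
qed

lemma coords_scale:
  assumes "z \<in> Z" "i < n"
  shows "coords (scl r z) i = r * coords z i"
proof (rule coords_unique[OF _ _ assms(2)])
  show "scl r z \<in> Z" using assms by (intro pm.subspace_scale[OF subspace_cycles_1])
  show "scl r z - comb (\<lambda>i. r * coords z i) \<in> B"
    using pm.subspace_scale[OF subspace_bds coords[OF assms(1)], of r]
    by (simp add: pm.scale_right_diff_distrib pm.scale_sum_right)
qed

text \<open>This is where minimality enters. The strict inequality matters: an exchange with a loop
  of equal length contradicts nothing.\<close>

lemma short_loop_coords:
  assumes b: "is_loop X b" and j: "j < n" and l: "path_length X b < path_length X (as ! j)"
  shows "coords (loop_chain b) j = 0"
proof (rule ccontr)
  assume cj: "coords (loop_chain b) j \<noteq> 0"
  \<comment> \<open>A base has to be sorted by length, so \<open>b\<close> is inserted at its place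
    instead of taking the place of \<open>as ! j\<close>.\<close>
  define bs where "bs = insort_key (path_length X) b (take j as @ drop (Suc j) as)"
  have "insert (loop_chain b) (v ` ({..<n} - {j})) \<subseteq> loop_chain ` set bs"
  proof -
    have "as ! i \<in> set bs" if "i < n" "i \<noteq> j" for i
    proof (cases "i < j")
      case True
      then have "as ! i \<in> set (take j as)" using that by (auto simp: in_set_conv_nth)
      then show ?thesis by (simp add: bs_def set_insort_key)
    next
      case False
      then have "drop (Suc j) as ! (i - Suc j) = as ! i" "i - Suc j < length (drop (Suc j) as)" using that j by auto
      then have "as ! i \<in> set (drop (Suc j) as)" by (metis nth_mem)
      then show ?thesis by (simp add: bs_def set_insort_key)
    qed
    moreover have "b \<in> set bs" by (simp add: bs_def set_insort_key)
    ultimately show ?thesis by auto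
  qed
  then have "pm.span (insert (loop_chain b) (v ` ({..<n} - {j})) \<union> B) \<subseteq> pm.span (loop_chain ` set bs \<union> B)"
    by (intro pm.span_mono) auto
  moreover have "pm.span (v ` {..<n} \<union> B) \<subseteq> pm.span (insert (loop_chain b) (v ` ({..<n} - {j})) \<union> B)"
    using j by (intro exchange_span[OF subspace_bds _ _ coords[OF loop_chain_cycle[OF b]] cj]) auto
  ultimately have "Z \<subseteq> pm.span (loop_chain ` set bs \<union> B)" using generating by blast
  moreover have "length bs = n" using j by (simp add: bs_def)
  moreover have "\<forall>a\<in>set bs. is_loop X a"
  proof -
    have "set bs \<subseteq> insert b (set as)"
      by (auto simp: bs_def set_insort_key dest: in_set_takeD in_set_dropD)
    then show ?thesis using b loops by blast
  qed
  moreover have sas: "sorted (map (path_length X) as)" using base by (simp add: is_loop_base_iff)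
  have "sorted (map (path_length X) bs)"
    unfolding bs_def
    using sorted_take_drop[OF sas, of j] j by (simp add: sorted_insort_key take_map drop_map)
  ultimately have "is_loop_base F X bs" using base by (simp add: is_loop_base_iff)
  moreover have "ord_class.lexordp (map (path_length X) bs) (map (path_length X) as)"
    using lexordp_insort_drop[OF sas, of j "path_length X b"] j l
    by (simp add: bs_def map_insort_key take_map drop_map)
  ultimately show False using minimal by (auto simp: lex_minimal_base_def)
qed

end

section \<open>The Rips and Cech filtrations of a geodesic space\<close>

lemma diam_less_iff:
  assumes "finite \<sigma>" "\<sigma> \<noteq> {}"
  shows "diam X \<sigma> < r \<longleftrightarrow> (\<forall>x\<in>\<sigma>. \<forall>y\<in>\<sigma>. mdist X x y < r)"
    and "diam X \<sigma> \<le> r \<longleftrightarrow> (\<forall>x\<in>\<sigma>. \<forall>y\<in>\<sigma>. mdist X x y \<le> r)"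
proof -
  have "diam X \<sigma> = Max ((\<lambda>(x, y). mdist X x y) ` (\<sigma> \<times> \<sigma>))"
    using assms unfolding diam_def by (intro cSup_eq_Max) auto
  then show "diam X \<sigma> < r \<longleftrightarrow> (\<forall>x\<in>\<sigma>. \<forall>y\<in>\<sigma>. mdist X x y < r)"
    "diam X \<sigma> \<le> r \<longleftrightarrow> (\<forall>x\<in>\<sigma>. \<forall>y\<in>\<sigma>. mdist X x y \<le> r)"
    using assms by (auto simp: Max_less_iff Max_le_iff)
qed

text \<open>Open and closed filtrations are treated together: \<open>lt\<close> stands for \<open><\<close> or \<open>\<le>\<close>.\<close>

definition rips_complex :: "(real \<Rightarrow> real \<Rightarrow> bool) \<Rightarrow> 'a metric \<Rightarrow> real \<Rightarrow> 'a set set"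
  where "rips_complex lt X r =
    {\<sigma>. finite \<sigma> \<and> \<sigma> \<noteq> {} \<and> \<sigma> \<subseteq> mspace X \<and> (\<forall>x\<in>\<sigma>. \<forall>y\<in>\<sigma>. lt (mdist X x y) r)}"

definition cech_complex :: "(real \<Rightarrow> real \<Rightarrow> bool) \<Rightarrow> 'a metric \<Rightarrow> real \<Rightarrow> 'a set set"
  where "cech_complex lt X r =
    {\<sigma>. finite \<sigma> \<and> \<sigma> \<noteq> {} \<and> \<sigma> \<subseteq> mspace X \<and> (\<exists>w\<in>mspace X. \<forall>z\<in>\<sigma>. lt (mdist X z w) r)}"

lemma rips_eq: "rips X = rips_complex (<) X" "closed_rips X = rips_complex (\<le>) X"
  by (simp_all add: fun_eq_iff rips_def closed_rips_def rips_complex_def diam_less_iff cong: conj_cong)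

lemma INT_nonempty_iff:
  assumes "\<sigma> \<noteq> {}" "\<sigma> \<subseteq> M" and b: "\<And>z w. w \<in> b z \<longleftrightarrow> z \<in> M \<and> w \<in> M \<and> P z w"
  shows "(\<Inter>z\<in>\<sigma>. b z) \<noteq> {} \<longleftrightarrow> (\<exists>w\<in>M. \<forall>z\<in>\<sigma>. P z w)"
proof -
  have "(\<Inter>z\<in>\<sigma>. b z) \<noteq> {} \<longleftrightarrow> (\<exists>w. \<forall>z\<in>\<sigma>. w \<in> b z)" by auto
  also have "\<dots> \<longleftrightarrow> (\<exists>w\<in>M. \<forall>z\<in>\<sigma>. P z w)" unfolding b using assms(1,2) by blast
  finally show ?thesis .
qed

lemma cech_eq: "cech X = cech_complex (<) X" "closed_cech X = cech_complex (\<le>) X"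
proof -
  have "(\<Inter>z\<in>\<sigma>. mball_of X z r) \<noteq> {} \<longleftrightarrow> (\<exists>w\<in>mspace X. \<forall>z\<in>\<sigma>. mdist X z w < r)"
    "(\<Inter>z\<in>\<sigma>. mcball_of X z r) \<noteq> {} \<longleftrightarrow> (\<exists>w\<in>mspace X. \<forall>z\<in>\<sigma>. mdist X z w \<le> r)"
    if "\<sigma> \<noteq> {}" "\<sigma> \<subseteq> mspace X" for \<sigma> r
    by (rule INT_nonempty_iff[OF that], simp)+
  then show "cech X = cech_complex (<) X" "closed_cech X = cech_complex (\<le>) X"
    by (simp_all add: fun_eq_iff cech_def closed_cech_def cech_complex_def cong: conj_cong)
qed

lemma (in geodesic_slsc) rips_stage:
  assumes r: "0 < r" and lt: "lt = (<) \<or> lt = (\<le>)"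
    and kill: "\<And>D. 0 \<le> D \<Longrightarrow> kill (ennreal D) \<longleftrightarrow> lt (D / 3) r"
    and mono: "\<And>l l'. l \<le> l' \<Longrightarrow> kill l' \<Longrightarrow> kill l"
  shows "filtration_stage X (rips_complex lt X r) r kill"
proof unfold_locales
  have lt_le: "lt a r" if "a \<le> b" "lt b r" for a b using lt that by auto
  have mem: "S \<in> rips_complex lt X r"
    if "finite S" "S \<noteq> {}" "\<And>x. x \<in> S \<Longrightarrow> x \<in> mspace X" "\<And>x y. x \<in> S \<Longrightarrow> y \<in> S \<Longrightarrow> lt (mdist X x y) r" for S
    using that by (auto simp: rips_complex_def)
  have memD: "x \<in> S \<Longrightarrow> y \<in> S \<Longrightarrow> lt (mdist X x y) r" "S \<subseteq> mspace X" if "S \<in> rips_complex lt X r" for S x y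
    using that by (auto simp: rips_complex_def)
  show "0 < r" by (rule r)
  show "S \<in> rips_complex lt X r"
    if "finite S" "S \<noteq> {}" "S \<subseteq> mspace X" "\<And>x y. x \<in> S \<Longrightarrow> y \<in> S \<Longrightarrow> mdist X x y < r" for S
    using that lt by (intro mem) (auto intro: less_imp_le)
  show "S \<subseteq> mspace X" if "S \<in> rips_complex lt X r" for S by (rule memD(2)[OF that])
  show "kill l" if "l \<le> l'" "kill l'" for l l' by (rule mono[OF that])
  show "{p a, p b, p c} \<in> rips_complex lt X r"
    if xy: "{x, y} \<in> rips_complex lt X r" and p: "short_curve X p (mdist X x y) x y"
      and abc: "a \<in> {0..mdist X x y}" "b \<in> {0..mdist X x y}" "c \<in> {0..mdist X x y}" for x y p a b c
  proof (rule mem)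
    fix u v assume "u \<in> {p a, p b, p c}" "v \<in> {p a, p b, p c}"
    then obtain s t where st: "u = p s" "v = p t" "s \<in> {0..mdist X x y}" "t \<in> {0..mdist X x y}"
      using abc by blast
    then have "mdist X u v \<le> \<bar>s - t\<bar>" using short_curve_dist[OF p] by blast
    also have "\<dots> \<le> mdist X x y" using st by auto
    finally show "lt (mdist X u v) r" by (rule lt_le) (rule memD(1)[OF xy]; simp)
  qed (use p abc in \<open>auto simp: short_curve_def\<close>)
  show "\<exists>w\<in>mspace X. \<forall>a\<in>{x, y, z}. \<forall>b\<in>{x, y, z}. kill (ennreal (mdist X w a + mdist X a b + mdist X w b))"
    if S: "{x, y, z} \<in> rips_complex lt X r" for x y z
  \<comment> \<open>For Rips a corner of the triangle can serve as apex: the perimeter is then a sum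
    of three distances within the simplex.\<close>
  proof (intro bexI[of _ x] ballI)
    fix a b assume ab: "a \<in> {x, y, z}" "b \<in> {x, y, z}"
    have "lt (mdist X x a) r" "lt (mdist X a b) r" "lt (mdist X x b) r"
      using ab by (auto intro!: memD(1)[OF S])
    then have "lt ((mdist X x a + mdist X a b + mdist X x b) / 3) r" using lt by auto
    then show "kill (ennreal (mdist X x a + mdist X a b + mdist X x b))" by (subst kill) simp_all
  qed (use memD(2)[OF S] in auto)
  show "\<exists>(n::nat) t. t 0 = 0 \<and> t n = D \<and> (\<forall>i\<le>n. t i \<in> {0..D}) \<and>
      (\<forall>i<n. t i \<le> t (Suc i) \<and> {p (t 0), p (t i), p (t (Suc i))} \<in> rips_complex lt X r \<and>
        (\<forall>a\<in>{t i..t (Suc i)}. \<forall>b\<in>{t i..t (Suc i)}. \<forall>c\<in>{t i..t (Suc i)}. {p a, p b, p c} \<in> rips_complex lt X r))"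
    if p: "short_curve X p D x x" and k: "kill (ennreal D)" for p D x
  proof -
    have D: "0 \<le> D" and px: "p D = p 0" and pM: "\<And>t. t \<in> {0..D} \<Longrightarrow> p t \<in> mspace X"
      using p by (auto simp: short_curve_def)
    have D3: "lt (D / 3) r" using k kill[OF D] by simp
    have tri: "{p a, p b, p c} \<in> rips_complex lt X r"
      if "a \<in> {0..D}" "b \<in> {0..D}" "c \<in> {0..D}" "mdist X (p a) (p b) \<le> D / 3"
        "mdist X (p a) (p c) \<le> D / 3" "mdist X (p b) (p c) \<le> D / 3" for a b c
    proof (rule mem)
      fix u v assume "u \<in> {p a, p b, p c}" "v \<in> {p a, p b, p c}"
      then have "mdist X u v \<le> D / 3" using that D pM by (auto simp: commute)
      then show "lt (mdist X u v) r" using D3 by (rule lt_le)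
    qed (use that pM in auto)
    have d: "mdist X (p a) (p b) \<le> D / 3" if "a \<in> {0..D}" "b \<in> {0..D}" "\<bar>a - b\<bar> \<le> D / 3" for a b
      using short_curve_dist[OF p that(1,2)] that(3) by linarith
    let ?t = "\<lambda>i::nat. real i * D / 3"
    have "{p (?t 0), p (?t i), p (?t (Suc i))} \<in> rips_complex lt X r" if i: "i < 3" for i
    proof -
      \<comment> \<open>Measured across the base point, using \<open>p 0 = p D\<close>.\<close>
      have *: "mdist X (p 0) (p (2 * D / 3)) \<le> D / 3"
        using d[of D "2 * D / 3"] D px by (simp add: field_simps)
      consider "i = 0" | "i = 1" | "i = 2" using i by linarith
      then show ?thesis
      proof cases
        case 1
        have "{p 0, p 0, p (D / 3)} \<in> rips_complex lt X r" using D by (intro tri d) auto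
        then show ?thesis using 1 by simp
      next
        case 2
        have "{p 0, p (D / 3), p (2 * D / 3)} \<in> rips_complex lt X r" using D by (intro tri d *) auto
        then show ?thesis using 2 by simp
      next
        case 3
        have "mdist X (p (2 * D / 3)) (p 0) \<le> D / 3" using * by (simp add: commute)
        moreover have "mdist X (p 0) (p 0) \<le> D / 3" using D pM[of 0] by (intro d) auto
        ultimately have "{p 0, p (2 * D / 3), p 0} \<in> rips_complex lt X r" using D * by (intro tri) auto
        then show ?thesis using 3 px by simp
      qed
    qed
    moreover have "{p a, p b, p c} \<in> rips_complex lt X r"
      if i: "i < 3" and abc: "a \<in> {?t i..?t (Suc i)}" "b \<in> {?t i..?t (Suc i)}" "c \<in> {?t i..?t (Suc i)}" for i a b c
    proof -
      have "real (Suc i) * D \<le> 3 * D" using i D by (intro mult_right_mono) auto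
      moreover have e: "?t (Suc i) = ?t i + D / 3" by (simp add: field_simps)
      ultimately have u: "?t i + D / 3 \<le> D" by simp
      have "{p a, p b, p c} \<in> rips_complex lt X r"
        if "0 \<le> u" "u + D / 3 \<le> D" "a \<in> {u..u + D / 3}" "b \<in> {u..u + D / 3}" "c \<in> {u..u + D / 3}" for u
        using that by (intro tri d) (auto simp: abs_if)
      from this[OF _ u abc[unfolded e]] show ?thesis using D by simp
    qed
    moreover have "?t i \<in> {0..D}" if "i \<le> 3" for i
    proof -
      have "real i * D \<le> 3 * D" using that D by (intro mult_right_mono) auto
      then show ?thesis using D by simp
    qed
    moreover have "?t i \<le> ?t (Suc i)" for i using D by (simp add: field_simps)
    ultimately show ?thesis by (intro exI[of _ 3] exI[of _ ?t]) simp
  qed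
qed

lemma (in geodesic_slsc) cech_stage:
  assumes r: "0 < r" and lt: "lt = (<) \<or> lt = (\<le>)"
    and kill: "\<And>D. 0 \<le> D \<Longrightarrow> kill (ennreal D) \<longleftrightarrow> lt (D / 4) r"
    and mono: "\<And>l l'. l \<le> l' \<Longrightarrow> kill l' \<Longrightarrow> kill l"
  shows "filtration_stage X (cech_complex lt X r) r kill"
proof unfold_locales
  have lt_le: "lt a r" if "a \<le> b" "lt b r" for a b using lt that by auto
  have mem: "S \<in> cech_complex lt X r"
    if "finite S" "S \<noteq> {}" "\<And>x. x \<in> S \<Longrightarrow> x \<in> mspace X" "w \<in> mspace X" "\<And>x. x \<in> S \<Longrightarrow> lt (mdist X x w) r" for S w
    using that by (auto simp: cech_complex_def)
  show "0 < r" by (rule r)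
  show "S \<in> cech_complex lt X r"
    if S: "finite S" "S \<noteq> {}" "S \<subseteq> mspace X" "\<And>x y. x \<in> S \<Longrightarrow> y \<in> S \<Longrightarrow> mdist X x y < r" for S
  proof -
    obtain w where "w \<in> S" using S(2) by blast
    then show ?thesis using S lt by (intro mem[of S w]) (auto intro: less_imp_le)
  qed
  show SM: "S \<subseteq> mspace X" if "S \<in> cech_complex lt X r" for S using that by (auto simp: cech_complex_def)
  show "kill l" if "l \<le> l'" "kill l'" for l l' by (rule mono[OF that])
  show "{p a, p b, p c} \<in> cech_complex lt X r"
    if xy: "{x, y} \<in> cech_complex lt X r" and p: "short_curve X p (mdist X x y) x y"
      and abc: "a \<in> {0..mdist X x y}" "b \<in> {0..mdist X x y}" "c \<in> {0..mdist X x y}" for x y p a b c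
  proof (rule mem)
    \<comment> \<open>The midpoint of the curve is a common point of the balls: its distance to any
      point of the curve is at most \<open>?d / 2\<close>, which is at most the mean of the
      distances of \<open>x\<close> and \<open>y\<close> to a common centre
      \<open>w\<close>.\<close>
    let ?d = "mdist X x y"
    obtain w where w: "w \<in> mspace X" "lt (mdist X x w) r" "lt (mdist X y w) r" "x \<in> mspace X" "y \<in> mspace X"
      using xy by (auto simp: cech_complex_def)
    have "?d \<le> mdist X x w + mdist X y w" using triangle[OF w(4,1,5)] by (simp add: commute)
    then have d: "lt (?d / 2) r" using lt w(2,3) by auto
    have m: "?d / 2 \<in> {0..?d}" by simp
    then show "p (?d / 2) \<in> mspace X" using p by (simp add: short_curve_def)
    fix u assume "u \<in> {p a, p b, p c}"
    then obtain s where s: "u = p s" "s \<in> {0..?d}" using abc by blast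
    then have "mdist X u (p (?d / 2)) \<le> \<bar>s - ?d / 2\<bar>" using short_curve_dist[OF p _ m] by blast
    also have "\<dots> \<le> ?d / 2" using s(2) by (simp add: abs_if)
    finally show "lt (mdist X u (p (?d / 2))) r" using d by (rule lt_le)
  qed (use p abc in \<open>auto simp: short_curve_def\<close>)
  show "\<exists>w\<in>mspace X. \<forall>a\<in>{x, y, z}. \<forall>b\<in>{x, y, z}. kill (ennreal (mdist X w a + mdist X a b + mdist X w b))"
    if S: "{x, y, z} \<in> cech_complex lt X r" for x y z
  proof -
    obtain w where w: "w \<in> mspace X" "\<And>u. u \<in> {x, y, z} \<Longrightarrow> lt (mdist X u w) r"
      using S by (auto simp: cech_complex_def)
    show ?thesis
    proof (intro bexI[OF _ w(1)] ballI)
      fix a b assume ab: "a \<in> {x, y, z}" "b \<in> {x, y, z}"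
      then have M: "a \<in> mspace X" "b \<in> mspace X" using SM[OF S] by auto
      \<comment> \<open>The perimeter is thus at most twice the sum of two radii, so a quarter of it
        is at most their mean.\<close>
      have "mdist X a b \<le> mdist X a w + mdist X b w" using triangle[OF M(1) w(1) M(2)] by (simp add: commute)
      then have "lt ((mdist X w a + mdist X a b + mdist X w b) / 4) r"
        using lt w(2)[OF ab(1)] w(2)[OF ab(2)] by (auto simp: commute[of w])
      then show "kill (ennreal (mdist X w a + mdist X a b + mdist X w b))" by (subst kill) simp_all
    qed
  qed
  show "\<exists>(n::nat) t. t 0 = 0 \<and> t n = D \<and> (\<forall>i\<le>n. t i \<in> {0..D}) \<and>
      (\<forall>i<n. t i \<le> t (Suc i) \<and> {p (t 0), p (t i), p (t (Suc i))} \<in> cech_complex lt X r \<and>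
        (\<forall>a\<in>{t i..t (Suc i)}. \<forall>b\<in>{t i..t (Suc i)}. \<forall>c\<in>{t i..t (Suc i)}. {p a, p b, p c} \<in> cech_complex lt X r))"
    if p: "short_curve X p D x x" and k: "kill (ennreal D)" for p D x
  proof -
    have D: "0 \<le> D" and px: "p D = p 0" and pM: "\<And>t. t \<in> {0..D} \<Longrightarrow> p t \<in> mspace X"
      using p by (auto simp: short_curve_def)
    have D4: "lt (D / 4) r" using k kill[OF D] by simp
    have tri: "{p a, p b, p c} \<in> cech_complex lt X r"
      if m: "m \<in> {0..D}" and abc: "a \<in> {0..D}" "b \<in> {0..D}" "c \<in> {0..D}"
        "\<bar>a - m\<bar> \<le> D / 4" "\<bar>b - m\<bar> \<le> D / 4" "\<bar>c - m\<bar> \<le> D / 4" for a b c m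
    proof (rule mem)
      fix u assume "u \<in> {p a, p b, p c}"
      then obtain s where s: "u = p s" "s \<in> {0..D}" "\<bar>s - m\<bar> \<le> D / 4" using abc by blast
      then have "mdist X u (p m) \<le> D / 4" using short_curve_dist[OF p s(2) m] by simp
      then show "lt (mdist X u (p m)) r" using D4 by (rule lt_le)
    qed (use m abc pM in auto)
    let ?t = "\<lambda>i::nat. real i * D / 4"
    have "{p (?t 0), p (?t i), p (?t (Suc i))} \<in> cech_complex lt X r" if i: "i < 4" for i
    proof -
      \<comment> \<open>The fan triangles lie in two balls: the one about \<open>p (D / 4)\<close>
        serves \<open>i = 0, 1\<close>, the one about \<open>p (3 * D / 4)\<close> serves
        \<open>i = 2, 3\<close>, where the apex \<open>p 0\<close> is read as
        \<open>p D\<close>.\<close>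
      consider "i = 0" | "i = 1" | "i = 2" | "i = 3" using i by linarith
      then show ?thesis
      proof cases
        case 1 then show ?thesis using D tri[of "D / 4" 0 0 "D / 4"] by simp
      next
        case 2 then show ?thesis using D tri[of "D / 4" 0 "D / 4" "2 * D / 4"] by simp
      next
        case 3 then show ?thesis using D tri[of "3 * D / 4" D "2 * D / 4" "3 * D / 4"] px by simp
      next
        case 4 then show ?thesis using D tri[of "3 * D / 4" D "3 * D / 4" D] px by simp
      qed
    qed
    moreover have "{p a, p b, p c} \<in> cech_complex lt X r"
      if i: "i < 4" and abc: "a \<in> {?t i..?t (Suc i)}" "b \<in> {?t i..?t (Suc i)}" "c \<in> {?t i..?t (Suc i)}" for i a b c
    proof -
      have "real (Suc i) * D \<le> 4 * D" using i D by (intro mult_right_mono) auto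
      moreover have e: "?t (Suc i) = ?t i + D / 4" by (simp add: field_simps)
      ultimately have u: "?t i + D / 4 \<le> D" by simp
      \<comment> \<open>An arc of length \<open>D / 4\<close> lies in the ball about its starting
        point.\<close>
      have "{p a, p b, p c} \<in> cech_complex lt X r"
        if "0 \<le> u" "u + D / 4 \<le> D" "a \<in> {u..u + D / 4}" "b \<in> {u..u + D / 4}" "c \<in> {u..u + D / 4}" for u
        using that by (intro tri[of u]) (auto simp: abs_if)
      from this[OF _ u abc[unfolded e]] show ?thesis using D by simp
    qed
    moreover have "?t i \<in> {0..D}" if "i \<le> 4" for i
    proof -
      have "real i * D \<le> 4 * D" using that D by (intro mult_right_mono) auto
      then show ?thesis using D by simp
    qed
    moreover have "?t i \<le> ?t (Suc i)" for i using D by (simp add: field_simps)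
    ultimately show ?thesis by (intro exI[of _ 4] exI[of _ ?t]) simp
  qed
qed

section \<open>Metric graphs are geodesic and locally contractible\<close>

text \<open>\<open>g\<close> lives to the left of \<open>c\<close> and \<open>h\<close> to the
  right. Across \<open>c\<close> the two variations add up to at most the distance of the
  parameters, so the constant stays 1 and does not double.\<close>

lemma Lipschitz_diff_separated:
  fixes g h :: "real \<Rightarrow> real"
  assumes "\<And>t s. \<bar>g t - g s\<bar> \<le> \<bar>t - s\<bar>" "\<And>t s. \<bar>h t - h s\<bar> \<le> \<bar>t - s\<bar>"
    and "\<And>t. c \<le> t \<Longrightarrow> g t = 0" "\<And>t. t \<le> c \<Longrightarrow> h t = 0"
  shows "\<bar>(g t - h t) - (g s - h s)\<bar> \<le> \<bar>t - s\<bar>"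
proof (cases "t \<le> c")
  case True
  then show ?thesis
    using assms(1)[of t s] assms(1)[of t c] assms(2)[of s c] assms(3)[of s] assms(3)[of c] assms(4)[of t] assms(4)[of s]
      assms(4)[of c]
    by (cases "s \<le> c") auto
next
  case False
  then show ?thesis
    using assms(2)[of t s] assms(1)[of s c] assms(2)[of t c] assms(3)[of t] assms(3)[of s] assms(3)[of c] assms(4)[of s]
      assms(4)[of c]
    by (cases "s \<le> c") auto
qed

context metric_graph
begin

abbreviation "X \<equiv> metric_graph_space G len"
abbreviation "ep \<equiv> edge_point G len"

lemmas X_simps = mspace_metric_graph_space mdist_metric_graph_space

lemma graph_dist_le: "graph_path G len x L y \<Longrightarrow> graph_dist G len x y \<le> L"
  using graph_path_in[of x L y] by (auto simp: graph_dist_def intro!: cInf_lower graph_path_bdd)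

lemma graph_dist_edge:
  "e \<in> arcs G \<Longrightarrow> s \<in> {0..len e} \<Longrightarrow> t \<in> {0..len e} \<Longrightarrow> graph_dist G len (ep e s) (ep e t) \<le> \<bar>s - t\<bar>"
  using graph_dist_le[OF graph_path_edge[of e s t]] by (simp add: abs_minus_commute)

text \<open>Reduces the existence of geodesics to the attainment of the infimum in
  \<open>graph_dist\<close>.\<close>

lemma graph_path_curve: "graph_path G len x L y \<Longrightarrow> \<exists>p. short_curve X p L x y"
proof (induction rule: graph_path.induct)
  case (refl x)
  have "graph_dist G len x x \<le> 0" by (rule graph_dist_le[OF graph_path.refl[OF refl]])
  then have "short_curve X (\<lambda>_. x) 0 x x"
    using refl unfolding short_curve_def X_simps by simp
  then show ?case by blast
next
  case (step x L e s t)
  then obtain p where p: "short_curve X p L x (ep e s)" by blast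
  define q where "q u = ep e (if s \<le> t then s + u else s - u)" for u
  have "short_curve X q \<bar>t - s\<bar> (ep e s) (ep e t)"
    unfolding short_curve_def X_simps
  proof (intro conjI ballI)
    fix u v assume uv: "u \<in> {0..\<bar>t - s\<bar>}" "v \<in> {0..\<bar>t - s\<bar>}"
    show "graph_dist G len (q u) (q v) \<le> \<bar>u - v\<bar>"
    proof (cases "s \<le> t")
      case True
      have "graph_dist G len (ep e (s + u)) (ep e (s + v)) \<le> \<bar>(s + u) - (s + v)\<bar>"
        using step.hyps uv True by (intro graph_dist_edge) auto
      then show ?thesis using True by (simp add: q_def)
    next
      case False
      have "graph_dist G len (ep e (s - u)) (ep e (s - v)) \<le> \<bar>(s - u) - (s - v)\<bar>"
        using step.hyps uv False by (intro graph_dist_edge) auto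
      then show ?thesis using False by (simp add: q_def abs_minus_commute)
    qed
  qed (use step.hyps in \<open>auto simp: q_def edge_point_in\<close>)
  from short_curve_join[OF p this, where 'f = real] show ?case by metis
qed

section \<open>Existence of shortest paths in a metric graph\<close>

lemma edge_point_eqD:
  assumes "e \<in> arcs G" "e' \<in> arcs G" "s \<in> {0..len e}" "s' \<in> {0..len e'}" "ep e s = ep e' s'"
  shows "e = e' \<and> s = s' \<or> s \<in> {0, len e} \<and> s' \<in> {0, len e'}"
  using assms by (auto simp: edge_point_def split: if_splits)

text \<open>\<open>vertex_path x L y\<close>: \<open>L\<close> is the length of an edge path from \<open>x\<close> to the vertex \<open>y\<close>. Unlike all
  path lengths, these lengths form a locally finite set, which is why the distance is attained.\<close>

inductive vertex_path :: "('v, 'e) graph_point \<Rightarrow> real \<Rightarrow> ('v, 'e) graph_point \<Rightarrow> bool" for x where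
  base: "e \<in> arcs G \<Longrightarrow> a \<in> {0..len e} \<Longrightarrow> x = ep e a \<Longrightarrow> b \<in> {0, len e} \<Longrightarrow>
    vertex_path x \<bar>b - a\<bar> (ep e b)"
| step: "vertex_path x L (ep e b) \<Longrightarrow> e \<in> arcs G \<Longrightarrow> b \<in> {0, len e} \<Longrightarrow> b' \<in> {0, len e} \<Longrightarrow> b \<noteq> b' \<Longrightarrow>
    vertex_path x (L + len e) (ep e b')"

lemma vertex_path_path: "vertex_path x L y \<Longrightarrow> graph_path G len x L y"
proof (induction rule: vertex_path.induct)
  case (base e a b)
  then show ?case using graph_path_edge[of e a b] len_pos[of e] by auto
next
  case (step L e b b')
  then have "graph_path G len x (L + \<bar>b' - b\<bar>) (ep e b')"
    using len_pos[of e] by (intro graph_path.step) auto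
  moreover have "\<bar>b' - b\<bar> = len e" using step.hyps len_pos[of e] by auto
  ultimately show ?case by simp
qed

text \<open>Has two elements when \<open>e\<close> is a loop at the vertex \<open>x\<close>,
  otherwise at most one.\<close>

definition rep :: "'e \<Rightarrow> ('v, 'e) graph_point \<Rightarrow> real set"
  where "rep e x = {a \<in> {0..len e}. ep e a = x}"

lemma finite_rep: "finite (rep e x)"
proof (rule finite_subset)
  show "rep e x \<subseteq> {0, len e} \<union> (case x of Vertex _ \<Rightarrow> {} | Inner _ t \<Rightarrow> {t})"
    by (auto simp: rep_def edge_point_def split: if_splits)
  show "finite ({0, len e} \<union> (case x of Vertex _ \<Rightarrow> {} | Inner _ t \<Rightarrow> {t}))"
    by (simp split: graph_point.split)
qed

text \<open>The possible lengths of the partial edge with which a vertex path starts.\<close>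

definition offsets :: "('v, 'e) graph_point \<Rightarrow> real set"
  where "offsets x = (\<Union>e\<in>arcs G. \<Union>a\<in>rep e x. {\<bar>0 - a\<bar>, \<bar>len e - a\<bar>})"

lemma finite_offsets: "finite (offsets x)"
  by (simp add: offsets_def finite_rep)

lemma vertex_path_length:
  "vertex_path x L y \<Longrightarrow> \<exists>c\<in>offsets x. \<exists>k. L = c + (\<Sum>e\<in>arcs G. real (k e) * len e)"
proof (induction rule: vertex_path.induct)
  case (base e a b)
  then have "a \<in> rep e x" "\<bar>b - a\<bar> \<in> {\<bar>0 - a\<bar>, \<bar>len e - a\<bar>}" by (auto simp: rep_def)
  with base have "\<bar>b - a\<bar> \<in> offsets x" unfolding offsets_def by blast
  then show ?case by (intro bexI[of _ "\<bar>b - a\<bar>"] exI[of _ "\<lambda>_. 0"]) auto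
next
  case (step L e b b')
  then obtain c k where c: "c \<in> offsets x" "L = c + (\<Sum>e\<in>arcs G. real (k e) * len e)" by blast
  have "(\<Sum>e'\<in>arcs G. real ((k(e := Suc (k e))) e') * len e') = (\<Sum>e\<in>arcs G. real (k e) * len e) + len e"
    using step.hyps(2) by (simp add: sum.remove[of "arcs G" e] algebra_simps)
  then have "L + len e = c + (\<Sum>e'\<in>arcs G. real ((k(e := Suc (k e))) e') * len e')"
    using c(2) by simp
  then show ?case using c(1) by blast
qed

text \<open>Such a length is an offset plus a combination of edge lengths with coefficients in the
  natural numbers, and the bound \<open>C\<close> limits the coefficient of \<open>e\<close> by
  \<open>C / len e\<close>.\<close>

lemma finite_vertex_path_lengths: "finite {L. vertex_path x L y \<and> L \<le> C}"
proof (rule finite_subset)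
  let ?P = "PiE (arcs G) (\<lambda>e. {..nat \<lfloor>C / len e\<rfloor>})"
  let ?f = "\<lambda>(c, k). c + (\<Sum>e\<in>arcs G. real (k e) * len e)"
  show "{L. vertex_path x L y \<and> L \<le> C} \<subseteq> ?f ` (offsets x \<times> ?P)"
  proof
    fix L assume "L \<in> {L. vertex_path x L y \<and> L \<le> C}"
    then obtain c k where L: "L \<le> C" "c \<in> offsets x" "L = c + (\<Sum>e\<in>arcs G. real (k e) * len e)"
      using vertex_path_length by blast
    have c: "0 \<le> c" using L(2) by (auto simp: offsets_def)
    have "k e \<le> nat \<lfloor>C / len e\<rfloor>" if e: "e \<in> arcs G" for e
    proof -
      have "real (k e) * len e \<le> (\<Sum>e\<in>arcs G. real (k e) * len e)"
        using e by (intro member_le_sum) (auto intro!: mult_nonneg_nonneg less_imp_le[OF len_pos])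
      then have "real (k e) \<le> C / len e" using L c len_pos[OF e] by (simp add: field_simps)
      then show ?thesis by (simp add: le_nat_floor)
    qed
    then have "restrict k (arcs G) \<in> ?P" by auto
    moreover have "L = ?f (c, restrict k (arcs G))" using L(3) by simp
    ultimately show "L \<in> ?f ` (offsets x \<times> ?P)" using L(2) by blast
  qed
  show "finite (?f ` (offsets x \<times> ?P))" by (intro finite_imageI finite_cartesian_product finite_offsets finite_PiE) auto
qed

text \<open>Turning around inside an edge only costs length, so a path can be shortened to a stretch
  of one edge or to a vertex path followed by a stretch of the last edge.\<close>

lemma graph_path_normal_form:
  "graph_path G len x L y \<Longrightarrow> y = x \<or> (\<exists>e\<in>arcs G. \<exists>t\<in>rep e y.
    (\<exists>a\<in>rep e x. \<bar>t - a\<bar> \<le> L) \<or> (\<exists>b\<in>{0, len e}. \<exists>L'. vertex_path x L' (ep e b) \<and> L' + \<bar>t - b\<bar> \<le> L))"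
proof (induction rule: graph_path.induct)
  case (step x L e s t)
  have L: "0 \<le> L" using graph_path_in[OF step.hyps(1)] by simp
  have t: "t \<in> rep e (ep e t)" using step.hyps by (simp add: rep_def)
  consider "ep e s = x" | e1 t1 where "e1 \<in> arcs G" "t1 \<in> rep e1 (ep e s)"
      "(\<exists>a\<in>rep e1 x. \<bar>t1 - a\<bar> \<le> L) \<or>
        (\<exists>b\<in>{0, len e1}. \<exists>L'. vertex_path x L' (ep e1 b) \<and> L' + \<bar>t1 - b\<bar> \<le> L)"
    using step.IH by blast
  then show ?case
  proof cases
    case 1
    then have "s \<in> rep e x" using step.hyps by (simp add: rep_def)
    moreover have "\<bar>t - s\<bar> \<le> L + \<bar>t - s\<bar>" using L by simp
    ultimately show ?thesis using t step.hyps(2) by blast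
  next
    case (2 e1 t1)
    note e1 = 2(1) and t1 = 2(2)
    have alt: "(\<exists>a\<in>rep e1 x. \<bar>t1 - a\<bar> \<le> L) \<or>
        (\<exists>b\<in>{0, len e1}. \<exists>L'. vertex_path x L' (ep e1 b) \<and> L' + \<bar>t1 - b\<bar> \<le> L)" by (rule 2(3))
    have "e1 = e \<and> t1 = s \<or> t1 \<in> {0, len e1} \<and> s \<in> {0, len e}"
      using t1 step.hyps e1 by (intro edge_point_eqD) (auto simp: rep_def)
    then show ?thesis
    proof
      assume *: "e1 = e \<and> t1 = s"
      from alt show ?thesis
      proof (elim disjE bexE exE conjE)
        fix a assume "a \<in> rep e1 x" "\<bar>t1 - a\<bar> \<le> L"
        then have "a \<in> rep e x" "\<bar>t - a\<bar> \<le> L + \<bar>t - s\<bar>" using * by auto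
        then show ?thesis using t step.hyps(2) by blast
      next
        fix b L' assume "b \<in> {0, len e1}" "vertex_path x L' (ep e1 b)" "L' + \<bar>t1 - b\<bar> \<le> L"
        then have "b \<in> {0, len e}" "vertex_path x L' (ep e b)" "L' + \<bar>t - b\<bar> \<le> L + \<bar>t - s\<bar>" using * by auto
        then show ?thesis using t step.hyps(2) by blast
      qed
    next
      \<comment> \<open>The path changes edges at a vertex, so its part up to there can be shortened
        to a vertex path and the new step becomes the last stretch.\<close>
      assume *: "t1 \<in> {0, len e1} \<and> s \<in> {0, len e}"
      have t1s: "ep e1 t1 = ep e s" using t1 by (simp add: rep_def)
      have "\<exists>L''\<le>L. vertex_path x L'' (ep e1 t1)"
        using alt
      proof (elim disjE bexE exE conjE)
        fix a assume a: "a \<in> rep e1 x" "\<bar>t1 - a\<bar> \<le> L"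
        have "vertex_path x \<bar>t1 - a\<bar> (ep e1 t1)"
          using a e1 * by (intro vertex_path.base) (auto simp: rep_def)
        then show ?thesis using a by blast
      next
        fix b L' assume b: "b \<in> {0, len e1}" "vertex_path x L' (ep e1 b)" "L' + \<bar>t1 - b\<bar> \<le> L"
        show ?thesis
        proof (cases "b = t1")
          case True then show ?thesis using b by auto
        next
          case False
          have "vertex_path x (L' + len e1) (ep e1 t1)"
            using b e1 * False by (intro vertex_path.step[OF b(2)]) auto
          moreover have "\<bar>t1 - b\<bar> = len e1" using b(1) * False len_pos[OF e1] by auto
          ultimately show ?thesis using b(3) by auto
        qed
      qed
      then obtain L'' where "L'' \<le> L" "vertex_path x L'' (ep e s)" unfolding t1s by blast
      moreover from this have "L'' + \<bar>t - s\<bar> \<le> L + \<bar>t - s\<bar>" by simp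
      ultimately show ?thesis using t step.hyps(2) * by blast
    qed
  qed
qed simp

lemma graph_dist_attained:
  assumes "x \<in> graph_points G len" "y \<in> graph_points G len"
  shows "graph_path G len x (graph_dist G len x y) y"
proof (cases "y = x")
  case True
  interpret Metric_space "graph_points G len" "graph_dist G len" by (rule Metric_space_graph_dist)
  show ?thesis using True assms graph_path.refl[of x] by simp
next
  case False
  \<comment> \<open>The lengths of paths in normal form. Every path length is at least some element
    of \<open>M\<close>, and \<open>M\<close> is finite below any bound, so the infimum is a
    minimum.\<close>
  define M where "M = (\<Union>e\<in>arcs G. \<Union>t\<in>rep e y. (\<Union>a\<in>rep e x. {\<bar>t - a\<bar>}) \<union>
    (\<Union>b\<in>{0, len e}. (\<lambda>L'. L' + \<bar>t - b\<bar>) ` {L'. vertex_path x L' (ep e b)}))"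
  have path: "graph_path G len x L y" if "L \<in> M" for L
  proof -
    obtain e t where e: "e \<in> arcs G" "t \<in> rep e y" and alt: "(\<exists>a\<in>rep e x. L = \<bar>t - a\<bar>) \<or>
      (\<exists>b\<in>{0, len e}. \<exists>L'. vertex_path x L' (ep e b) \<and> L = L' + \<bar>t - b\<bar>)"
      using \<open>L \<in> M\<close> unfolding M_def by blast
    from alt show ?thesis
    proof (elim disjE bexE exE conjE)
      fix a assume "a \<in> rep e x" "L = \<bar>t - a\<bar>"
      then show ?thesis using graph_path_edge[of e a t] e by (auto simp: rep_def)
    next
      fix b L' assume b: "b \<in> {0, len e}" "vertex_path x L' (ep e b)" "L = L' + \<bar>t - b\<bar>"
      have "graph_path G len x (L' + \<bar>t - b\<bar>) (ep e t)"
        using b(1) e len_pos[OF e(1)]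
        by (intro graph_path.step[OF vertex_path_path[OF b(2)]]) (auto simp: rep_def)
      then show ?thesis using e b(3) by (simp add: rep_def)
    qed
  qed
  have below: "\<exists>L'\<in>M. L' \<le> L" if "graph_path G len x L y" for L
    using graph_path_normal_form[OF that] False unfolding M_def by force
  obtain C where C: "graph_path G len x C y" using graph_path_exists[OF assms] by blast
  have fin: "finite {L\<in>M. L \<le> C}"
  proof (rule finite_subset)
    show "{L\<in>M. L \<le> C} \<subseteq> (\<Union>e\<in>arcs G. \<Union>t\<in>rep e y. (\<Union>a\<in>rep e x. {\<bar>t - a\<bar>}) \<union>
      (\<Union>b\<in>{0, len e}. (\<lambda>L'. L' + \<bar>t - b\<bar>) ` {L'. vertex_path x L' (ep e b) \<and> L' \<le> C}))"
      unfolding M_def by fastforce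
  qed (simp add: finite_rep finite_vertex_path_lengths)
  have ne: "{L\<in>M. L \<le> C} \<noteq> {}" using below[OF C] by blast
  define m where "m = Min {L\<in>M. L \<le> C}"
  have m: "m \<in> M" using Min_in[OF fin ne] by (simp add: m_def)
  have "m \<le> L" if L: "graph_path G len x L y" for L
  proof -
    obtain L' where L': "L' \<in> M" "L' \<le> L" using below[OF L] by blast
    show ?thesis
    proof (cases "L' \<le> C")
      case True
      then have "m \<le> L'" using L' fin by (simp add: m_def)
      then show ?thesis using L' by simp
    next
      case False
      have "m \<le> C" using Min_in[OF fin ne] by (simp add: m_def)
      then show ?thesis using False L' by simp
    qed
  qed
  then have "Inf {L. graph_path G len x L y} = m"
    using path[OF m] by (intro cInf_eq_minimum) auto
  then show ?thesis using path[OF m] assms by (simp add: graph_dist_def)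
qed

section \<open>Small balls as stars of branches\<close>

definition tent :: "real \<Rightarrow> real \<Rightarrow> real"
  where "tent \<epsilon> u = max 0 (min u (2 * \<epsilon> - u))"

text \<open>A branch \<open>(e, a, \<sigma>)\<close> at \<open>w\<close> is a germ of a unit speed curve \<open>u \<mapsto> ep e (a + \<sigma> * u)\<close> that
  leaves \<open>w\<close>.\<close>

definition branches :: "real \<Rightarrow> ('v, 'e) graph_point \<Rightarrow> ('e \<times> real \<times> real) set"
  where "branches \<epsilon> w = {(e, a, \<sigma>). e \<in> arcs G \<and> a \<in> rep e w \<and> \<sigma> \<in> {1, -1} \<and> a + \<sigma> * (4 * \<epsilon>) \<in> {0..len e}}"

text \<open>A test function that equals the branch parameter up to \<open>\<epsilon>\<close> and
  falls back to 0 at \<open>2 * \<epsilon>\<close>. Branches extend to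
  \<open>4 * \<epsilon>\<close>, so the tents at both ends of a loop edge do not overlap.\<close>

definition bump :: "real \<Rightarrow> 'e \<times> real \<times> real \<Rightarrow> ('v, 'e) graph_point \<Rightarrow> real"
  where "bump \<epsilon> = (\<lambda>(e, a, \<sigma>) z. case z of Vertex _ \<Rightarrow> 0
    | Inner e' t \<Rightarrow> if e' = e then tent \<epsilon> (\<sigma> * (t - a)) else 0)"

lemma bump_edge_point:
  assumes "0 < \<epsilon>" "(e, a, \<sigma>) \<in> branches \<epsilon> w" "e' \<in> arcs G" "t \<in> {0..len e'}"
  shows "bump \<epsilon> (e, a, \<sigma>) (ep e' t) = (if e' = e then tent \<epsilon> (\<sigma> * (t - a)) else 0)"
  using assms len_pos[of e']
  by (auto simp: bump_def edge_point_def branches_def rep_def tent_def)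

text \<open>The difference of the two bumps is 1-Lipschitz along every edge and takes the values
  \<open>r'\<close> and \<open>- r\<close> at the two points; this bounds their distance from
  below.\<close>

lemma branch_dist_ge:
  assumes \<epsilon>: "0 < \<epsilon>" and b: "(e, a, \<sigma>) \<in> branches \<epsilon> w" "(e', a', \<sigma>') \<in> branches \<epsilon> w" "(e, a, \<sigma>) \<noteq> (e', a', \<sigma>')"
    and r: "0 \<le> r" "r < \<epsilon>" "0 \<le> r'" "r' < \<epsilon>"
  shows "r + r' \<le> graph_dist G len (ep e (a + \<sigma> * r)) (ep e' (a' + \<sigma>' * r'))"
proof -
  define f where "f z = bump \<epsilon> (e', a', \<sigma>') z - bump \<epsilon> (e, a, \<sigma>) z" for z
  have f: "f (ep e'' t) = (if e'' = e' then tent \<epsilon> (\<sigma>' * (t - a')) else 0) - (if e'' = e then tent \<epsilon> (\<sigma> * (t - a)) else 0)"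
    if "e'' \<in> arcs G" "t \<in> {0..len e''}" for e'' t
    unfolding f_def using bump_edge_point[OF \<epsilon> b(1) that] bump_edge_point[OF \<epsilon> b(2) that] by simp
  have B: "e \<in> arcs G" "a \<in> {0..len e}" "ep e a = w" "\<sigma> = 1 \<or> \<sigma> = -1" "a + \<sigma> * (4 * \<epsilon>) \<in> {0..len e}"
    "e' \<in> arcs G" "a' \<in> {0..len e'}" "ep e' a' = w" "\<sigma>' = 1 \<or> \<sigma>' = -1" "a' + \<sigma>' * (4 * \<epsilon>) \<in> {0..len e'}"
    using b by (auto simp: branches_def rep_def)
  \<comment> \<open>Distinct branches on one edge either leave an interior point \<open>w\<close> in
    opposite directions or start at the two ends of a loop edge at \<open>w\<close>.\<close>
  have same: "a = a' \<and> \<sigma>' = - \<sigma> \<or> a = 0 \<and> a' = len e \<and> \<sigma> = 1 \<and> \<sigma>' = -1 \<and> 4 * \<epsilon> \<le> len e \<or>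
    a = len e \<and> a' = 0 \<and> \<sigma> = -1 \<and> \<sigma>' = 1 \<and> 4 * \<epsilon> \<le> len e" if "e = e'"
  proof (cases "a = a'")
    case True then show ?thesis using b(3) B that by auto
  next
    case False
    then have "a \<in> {0, len e}" "a' \<in> {0, len e}"
      using edge_point_eqD[of e e' a a'] B that by auto
    then show ?thesis using B that False \<epsilon> by auto
  qed
  have in1: "a + \<sigma> * r \<in> {0..len e}" and in2: "a' + \<sigma>' * r' \<in> {0..len e'}"
    using B r \<epsilon> by auto
  have lip1: "\<bar>tent \<epsilon> (\<rho> * (t - c)) - tent \<epsilon> (\<rho> * (s - c))\<bar> \<le> \<bar>t - s\<bar>" if "\<rho> = 1 \<or> \<rho> = -1" for \<rho> t s c
    using that by (auto simp: tent_def max_def min_def abs_if)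
  have lip: "f (ep e'' t) - f (ep e'' s) \<le> \<bar>t - s\<bar>"
    if e'': "e'' \<in> arcs G" and s: "s \<in> {0..len e''}" and t: "t \<in> {0..len e''}" for e'' s t
  proof (cases "e'' = e \<and> e'' = e'")
    case True
    then have ee: "e = e'" "e'' = e'" by auto
    let ?g = "\<lambda>t. tent \<epsilon> (\<sigma> * (t - a))" and ?g' = "\<lambda>t. tent \<epsilon> (\<sigma>' * (t - a'))"
    consider "a = a'" "\<sigma> = 1" "\<sigma>' = -1" | "a = a'" "\<sigma> = -1" "\<sigma>' = 1"
      | "a = 0" "a' = len e" "\<sigma> = 1" "\<sigma>' = -1" "4 * \<epsilon> \<le> len e"
      | "a = len e" "a' = 0" "\<sigma> = -1" "\<sigma>' = 1" "4 * \<epsilon> \<le> len e"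
      using same[OF ee(1)] B(4,9) by auto
    then have "\<bar>(?g t - ?g' t) - (?g s - ?g' s)\<bar> \<le> \<bar>t - s\<bar> \<or> \<bar>(?g' t - ?g t) - (?g' s - ?g s)\<bar> \<le> \<bar>t - s\<bar>"
    proof cases
      case 1
      then show ?thesis using B(4,9)
        by (intro disjI2[OF Lipschitz_diff_separated[of "?g'" "?g" a, OF lip1[OF B(9)] lip1[OF B(4)]]]) (auto simp: tent_def)
    next
      case 2
      then show ?thesis using B(4,9)
        by (intro disjI1[OF Lipschitz_diff_separated[of "?g" "?g'" a, OF lip1[OF B(4)] lip1[OF B(9)]]]) (auto simp: tent_def)
    next
      case 3
      then show ?thesis using B(4,9) \<epsilon>
        by (intro disjI1[OF Lipschitz_diff_separated[of "?g" "?g'" "2 * \<epsilon>", OF lip1[OF B(4)] lip1[OF B(9)]]]) (auto simp: tent_def)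
    next
      case 4
      then show ?thesis using B(4,9) \<epsilon>
        by (intro disjI2[OF Lipschitz_diff_separated[of "?g'" "?g" "2 * \<epsilon>", OF lip1[OF B(9)] lip1[OF B(4)]]]) (auto simp: tent_def)
    qed
    then have "(?g' t - ?g t) - (?g' s - ?g s) \<le> \<bar>t - s\<bar>" by linarith
    then show ?thesis using ee f[OF e'' t] f[OF e'' s] by simp
  next
    case False
    then show ?thesis using lip1[OF B(4), of t a s] lip1[OF B(9), of t a' s]
      by (auto simp: f[OF e'' t] f[OF e'' s] abs_minus_commute)
  qed
  have "f (ep e' (a' + \<sigma>' * r')) - f (ep e (a + \<sigma> * r)) \<le> graph_dist G len (ep e (a + \<sigma> * r)) (ep e' (a' + \<sigma>' * r'))"
    using B lip by (intro graph_dist_lipschitz edge_point_in) auto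
  moreover have "f (ep e' (a' + \<sigma>' * r')) = r'"
  proof -
    have "tent \<epsilon> (\<sigma>' * (a' + \<sigma>' * r' - a')) = r'" using B(9) r by (auto simp: tent_def)
    moreover have "tent \<epsilon> (\<sigma> * (a' + \<sigma>' * r' - a)) = 0" if "e = e'"
      using same[OF that] B(4) r by (auto simp: tent_def)
    ultimately show ?thesis using f[OF B(6) in2] by auto
  qed
  moreover have "f (ep e (a + \<sigma> * r)) = - r"
  proof -
    have "tent \<epsilon> (\<sigma> * (a + \<sigma> * r - a)) = r" using B(4) r by (auto simp: tent_def)
    moreover have "tent \<epsilon> (\<sigma>' * (a + \<sigma> * r - a')) = 0" if "e = e'"
      using same[OF that] B(4) r by (auto simp: tent_def)
    ultimately show ?thesis using f[OF B(1) in1] by auto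
  qed
  ultimately show ?thesis by simp
qed

lemma branch_radius_exists:
  "\<exists>\<epsilon>>0. (\<forall>e\<in>arcs G. 4 * \<epsilon> \<le> len e \<and>
    (\<forall>a\<in>rep e w. (a = 0 \<or> 4 * \<epsilon> \<le> a) \<and> (a = len e \<or> 4 * \<epsilon> \<le> len e - a)))"
proof -
  \<comment> \<open>These are the lengths that, if positive, have to be at least
    \<open>4 * \<epsilon>\<close>. They are finitely many, and the 1 added in \<open>S\<close> keeps
    the minimum meaningful for a graph without edges.\<close>
  define S0 where "S0 = (\<Union>e\<in>arcs G. insert (len e) (\<Union>a\<in>rep e w. {a, len e - a}))"
  define S where "S = insert 1 {u \<in> S0. 0 < u}"
  have "finite S0" by (simp add: S0_def finite_rep)
  then have S: "finite S" "\<And>u. u \<in> S \<Longrightarrow> 0 < u" by (auto simp: S_def)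
  have "S \<noteq> {}" by (simp add: S_def)
  then have "0 < Min S" by (rule S(2)[OF Min_in[OF S(1)]])
  have le: "4 * (Min S / 4) \<le> u" if "u \<in> S0" "0 < u" for u
  proof -
    have "u \<in> S" using that by (simp add: S_def)
    then show ?thesis using Min_le[OF S(1)] by simp
  qed
  show ?thesis
  proof (intro exI[of _ "Min S / 4"] conjI ballI)
    fix e assume e: "e \<in> arcs G"
    then have "len e \<in> S0" unfolding S0_def by blast
    then show "4 * (Min S / 4) \<le> len e" using len_pos[OF e] by (rule le)
    fix a assume a: "a \<in> rep e w"
    have "a \<in> S0" "len e - a \<in> S0" using e a unfolding S0_def by blast+
    moreover have "0 \<le> a" "0 \<le> len e - a" using a by (auto simp: rep_def)
    ultimately show "a = 0 \<or> 4 * (Min S / 4) \<le> a" "a = len e \<or> 4 * (Min S / 4) \<le> len e - a"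
      using le[of a] le[of "len e - a"] by linarith+
  qed (use \<open>0 < Min S\<close> in simp)
qed

lemma branch_cover:
  assumes \<epsilon>: "0 < \<epsilon>" "\<And>e. e \<in> arcs G \<Longrightarrow> 4 * \<epsilon> \<le> len e"
      "\<And>e a. e \<in> arcs G \<Longrightarrow> a \<in> rep e w \<Longrightarrow> (a = 0 \<or> 4 * \<epsilon> \<le> a) \<and> (a = len e \<or> 4 * \<epsilon> \<le> len e - a)"
    and w: "w \<in> graph_points G len" and x: "x \<in> graph_points G len" "x \<noteq> w"
    and d: "graph_dist G len w x < \<epsilon>"
  shows "\<exists>(e, a, \<sigma>)\<in>branches \<epsilon> w. x = ep e (a + \<sigma> * graph_dist G len w x)"
proof -
  let ?d = "graph_dist G len w x"
  have "\<exists>e\<in>arcs G. \<exists>t\<in>rep e x. \<exists>a\<in>rep e w. \<bar>t - a\<bar> \<le> ?d"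
  proof -
    obtain e t where e: "e \<in> arcs G" "t \<in> rep e x" and alt: "(\<exists>a\<in>rep e w. \<bar>t - a\<bar> \<le> ?d) \<or>
      (\<exists>b\<in>{0, len e}. \<exists>L'. vertex_path w L' (ep e b) \<and> L' + \<bar>t - b\<bar> \<le> ?d)"
      using graph_path_normal_form[OF graph_dist_attained[OF w x(1)]] x(2) by blast
    \<comment> \<open>A vertex path shorter than \<open>\<epsilon>\<close> cannot leave
      \<open>w\<close>: a complete edge, or a nonzero partial edge from \<open>w\<close> to an end,
      has length at least \<open>4 * \<epsilon>\<close>.\<close>
    have vp: "ep e b = w \<and> 0 \<le> L'" if "vertex_path w L' (ep e b)" "L' < \<epsilon>" for b L'
      using that(1)
    proof (cases rule: vertex_path.cases)
      case (base e1 a1 b1)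
      then have "a1 \<in> rep e1 w" by (simp add: rep_def)
      then have "b1 = a1" using \<epsilon>(1) \<epsilon>(3)[OF base(3), of a1] base that(2) by (auto simp: rep_def)
      then show ?thesis using base by simp
    next
      case (step L1 e1 b1 b1')
      have "0 \<le> L1" using graph_path_in[OF vertex_path_path[OF step(3)]] by simp
      then show ?thesis using step \<epsilon>(1) \<epsilon>(2)[OF step(4)] that(2) by linarith
    qed
    from alt show ?thesis
    proof (elim disjE bexE exE conjE)
      fix a assume "a \<in> rep e w" "\<bar>t - a\<bar> \<le> ?d"
      then show ?thesis using e by blast
    next
      fix b L' assume b: "b \<in> {0, len e}" "vertex_path w L' (ep e b)" "L' + \<bar>t - b\<bar> \<le> ?d"
      have "L' < \<epsilon>" using b(3) d by linarith
      then have "ep e b = w" "0 \<le> L'" using vp[OF b(2)] by auto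
      then have "b \<in> rep e w" "\<bar>t - b\<bar> \<le> ?d" using b len_pos[OF e(1)] by (auto simp: rep_def)
      then show ?thesis using e by blast
    qed
  qed
  then obtain e t a where e: "e \<in> arcs G" "t \<in> rep e x" "a \<in> rep e w" "\<bar>t - a\<bar> \<le> ?d" by blast
  have ta: "t \<in> {0..len e}" "a \<in> {0..len e}" "x = ep e t" "w = ep e a" using e by (auto simp: rep_def)
  \<comment> \<open>With the opposite bound this makes the distance from \<open>w\<close> equal to
    the branch parameter of \<open>x\<close>.\<close>
  have "?d \<le> \<bar>a - t\<bar>" unfolding ta(3,4) by (rule graph_dist_edge[OF e(1) ta(2,1)])
  then have dt: "?d = \<bar>t - a\<bar>" using e(4) by simp
  show ?thesis
  proof (cases "a < t")
    case True
    have "(e, a, 1) \<in> branches \<epsilon> w" using e ta True \<epsilon>(1) \<epsilon>(3)[OF e(1,3)] by (auto simp: branches_def)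
    moreover have "x = ep e (a + 1 * ?d)" using True dt ta by simp
    ultimately show ?thesis by blast
  next
    case False
    have "t \<noteq> a" using x(2) ta by auto
    then have "(e, a, - 1) \<in> branches \<epsilon> w" using e ta False \<epsilon>(1) \<epsilon>(3)[OF e(1,3)] by (auto simp: branches_def)
    moreover have "x = ep e (a + (- 1) * ?d)" using False dt ta by simp
    ultimately show ?thesis by blast
  qed
qed

text \<open>Each point slides to \<open>w\<close> along its branch, proportionally to its distance.
  Between different branches the distance is the sum of the distances to \<open>w\<close>, so the
  detour through \<open>w\<close> costs nothing.\<close>

lemma contractible_ball_graph:
  assumes w: "w \<in> graph_points G len"
  shows "\<exists>\<epsilon>. contractible_ball X w \<epsilon>"
proof -
  interpret Metric_space "graph_points G len" "graph_dist G len" by (rule Metric_space_graph_dist)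
  let ?d = "graph_dist G len"
  obtain \<epsilon> where \<epsilon>: "0 < \<epsilon>" "\<And>e. e \<in> arcs G \<Longrightarrow> 4 * \<epsilon> \<le> len e"
      "\<And>e a. e \<in> arcs G \<Longrightarrow> a \<in> rep e w \<Longrightarrow> (a = 0 \<or> 4 * \<epsilon> \<le> a) \<and> (a = len e \<or> 4 * \<epsilon> \<le> len e - a)"
    using branch_radius_exists[of w] by blast
  have "\<exists>e a \<sigma>. (e, a, \<sigma>) \<in> branches \<epsilon> w \<and> x = ep e (a + \<sigma> * ?d w x)"
    if "x \<in> graph_points G len" "x \<noteq> w" "?d w x < \<epsilon>" for x
    using branch_cover[OF \<epsilon> w that] by blast
  then obtain E A \<Sigma> where br: "\<And>x. x \<in> graph_points G len \<Longrightarrow> x \<noteq> w \<Longrightarrow> ?d w x < \<epsilon> \<Longrightarrow>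
    (E x, A x, \<Sigma> x) \<in> branches \<epsilon> w \<and> x = ep (E x) (A x + \<Sigma> x * ?d w x)" by metis
  define H where "H x s = (if x = w then w else ep (E x) (A x + \<Sigma> x * (s * ?d w x)))" for x s
  have brD: "e \<in> arcs G" "a \<in> {0..len e}" "w = ep e a" "\<sigma> = 1 \<or> \<sigma> = -1"
    "u \<in> {0..\<epsilon>} \<Longrightarrow> a + \<sigma> * u \<in> {0..len e}"
    if "(e, a, \<sigma>) \<in> branches \<epsilon> w" for e a \<sigma> u
    using that by (auto simp: branches_def rep_def)
  have wd: "?d w (ep e (a + \<sigma> * u)) \<le> u" if b: "(e, a, \<sigma>) \<in> branches \<epsilon> w" and u: "u \<in> {0..\<epsilon>}" for e a \<sigma> u
  proof -
    have "?d (ep e a) (ep e (a + \<sigma> * u)) \<le> \<bar>a - (a + \<sigma> * u)\<bar>"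
      by (intro graph_dist_edge brD[OF b] u)
    also have "\<dots> = u" using brD(4)[OF b] u by auto
    finally show ?thesis using brD(3)[OF b] by simp
  qed
  have ball: "x \<in> graph_points G len" "?d w x < \<epsilon>" if "x \<in> mball_of X w \<epsilon>" for x
    using that by (auto simp: X_simps)
  have su: "s * ?d w x \<in> {0..\<epsilon>}" "s * ?d w x \<le> ?d w x" if "x \<in> mball_of X w \<epsilon>" "s \<in> {0..1}" for s x
    using that(2) ball[OF that(1)] mult_left_le_one_le[of "?d w x" s] by auto
  have HM: "H x s \<in> graph_points G len" if "x \<in> mball_of X w \<epsilon>" "s \<in> {0..1}" for x s
    using w br[OF ball(1)[OF that(1)] _ ball(2)[OF that(1)]] brD(1) by (auto simp: H_def intro!: edge_point_in)
  have H0: "H x 0 = w" and H1: "H x 1 = x" if "x \<in> mball_of X w \<epsilon>" for x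
    using br[OF ball(1)[OF that] _ ball(2)[OF that]] brD(3) by (auto simp: H_def)
  have wH: "?d w (H x s) \<le> s * ?d w x" if "x \<in> mball_of X w \<epsilon>" "s \<in> {0..1}" for x s
  proof (cases "x = w")
    case False
    then show ?thesis using wd[OF _ su(1)[OF that]] br[OF ball(1)[OF that(1)] _ ball(2)[OF that(1)]] by (auto simp: H_def)
  qed (use w in \<open>simp add: H_def\<close>)
  have "?d (H x s) (H y t) \<le> ?d x y + \<epsilon> * \<bar>s - t\<bar>"
    if xy: "x \<in> mball_of X w \<epsilon>" "y \<in> mball_of X w \<epsilon>" and st: "s \<in> {0..1}" "t \<in> {0..1}" for x y s t
  proof -
    note x = ball[OF xy(1)] and y = ball[OF xy(2)]
    have via_w: "?d (H x s) (H y t) \<le> ?d w x + ?d w y"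
      using triangle[OF HM[OF xy(1) st(1)] w HM[OF xy(2) st(2)]] wH[OF xy(1) st(1)] wH[OF xy(2) st(2)]
        su(2)[OF xy(1) st(1)] su(2)[OF xy(2) st(2)] by (simp add: commute)
    have e0: "0 \<le> \<epsilon> * \<bar>s - t\<bar>" using \<epsilon>(1) by simp
    consider "x = w" | "y = w" | "x \<noteq> w" "y \<noteq> w" "(E x, A x, \<Sigma> x) \<noteq> (E y, A y, \<Sigma> y)"
      | "x \<noteq> w" "y \<noteq> w" "(E x, A x, \<Sigma> x) = (E y, A y, \<Sigma> y)" by blast
    then show ?thesis
    proof cases
      case 1
      then have "?d (H x s) (H y t) \<le> ?d x y" using via_w w by simp
      then show ?thesis using e0 by linarith
    next
      case 2
      then have "?d (H x s) (H y t) \<le> ?d x y" using via_w w by (simp add: commute)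
      then show ?thesis using e0 by linarith
    next
      case 3
      note bx = br[OF x(1) 3(1) x(2)] and by' = br[OF y(1) 3(2) y(2)]
      have "?d w x + ?d w y \<le> ?d x y"
        using branch_dist_ge[OF \<epsilon>(1) conjunct1[OF bx] conjunct1[OF by'] 3(3), of "?d w x" "?d w y"]
          bx by' x(2) y(2) by simp
      then show ?thesis using via_w e0 by linarith
    next
      case 4
      note bx = br[OF x(1) 4(1) x(2)]
      define u v where "u = s * ?d w x" and "v = t * ?d w y"
      have uv: "u \<in> {0..\<epsilon>}" "v \<in> {0..\<epsilon>}" unfolding u_def v_def by (intro su xy st)+
      have "?d (H x s) (H y t) = ?d (ep (E x) (A x + \<Sigma> x * u)) (ep (E x) (A x + \<Sigma> x * v))"
        using 4 by (simp add: H_def u_def v_def)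
      also have "\<dots> \<le> \<bar>(A x + \<Sigma> x * u) - (A x + \<Sigma> x * v)\<bar>"
        by (intro graph_dist_edge brD[OF conjunct1[OF bx]] uv)
      also have "\<dots> = \<bar>u - v\<bar>" using brD(4)[OF conjunct1[OF bx]] by auto
      \<comment> \<open>Separates the change of the point, bounded by \<open>?d x y\<close>, from
        the change of the contraction parameter, bounded by
        \<open>\<epsilon> * \<bar>s - t\<bar>\<close>.\<close>
      also have "u - v = s * (?d w x - ?d w y) + (s - t) * ?d w y" by (simp add: u_def v_def algebra_simps)
      also have "\<bar>\<dots>\<bar> \<le> \<bar>s * (?d w x - ?d w y)\<bar> + \<bar>(s - t) * ?d w y\<bar>" by (rule abs_triangle_ineq)
      also have "\<bar>s * (?d w x - ?d w y)\<bar> \<le> \<bar>?d w x - ?d w y\<bar>"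
        using st(1) by (simp add: abs_mult mult_left_le_one_le)
      also have "\<bar>?d w x - ?d w y\<bar> \<le> ?d x y"
        using triangle[OF w x(1) y(1)] triangle[OF w y(1) x(1)] by (simp add: commute abs_le_iff)
      also have "\<bar>(s - t) * ?d w y\<bar> \<le> \<epsilon> * \<bar>s - t\<bar>"
        using y(2) mult_left_mono[of "?d w y" \<epsilon> "\<bar>s - t\<bar>"] by (simp add: abs_mult mult.commute)
      finally show ?thesis by simp
    qed
  qed
  then have "contractible_ball X w \<epsilon>"
    unfolding contractible_ball_def X_simps
    by (intro conjI exI[of _ H] ballI \<epsilon>(1) w HM H0 H1)
  then show ?thesis by blast
qed

lemma geodesic_slsc_graph: "geodesic_slsc X"
proof
  show "\<exists>p. short_curve X p (mdist X x y) x y" if "x \<in> mspace X" "y \<in> mspace X" for x y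
    using that graph_path_curve[OF graph_dist_attained[of x y]] by (simp add: X_simps)
  show "\<exists>e. contractible_ball X w e" if "w \<in> mspace X" for w
    using that by (intro contractible_ball_graph) (simp add: X_simps)
qed

end

section \<open>The persistence module of a filtration\<close>

text \<open>The killed \<open>a_i\<close> lie in \<open>killed_span\<close>, which settles one
  direction. Conversely, the chains whose coordinates vanish at the surviving \<open>a_i\<close>
  form a subspace \<open>W\<close> that contains all generators of
  \<open>killed_span\<close>.\<close>

lemma (in filtration_stage) killed_span_iff_coords:
  fixes z :: "((nat \<Rightarrow> real) \<Rightarrow> 'a) \<Rightarrow>\<^sub>0 'f::field"
  assumes base: "minimal_loop_base X as TYPE('f)" and z: "z \<in> cycles (simplices T) singular_face 1"
  shows "z \<in> killed_span \<longleftrightarrow>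
    (\<forall>i<length as. \<not> kill (path_length X (as ! i)) \<longrightarrow> minimal_loop_base.coords X as z i = 0)"
proof -
  interpret M: minimal_loop_base X as "TYPE('f)" by (rule base)
  define ok where "ok c \<longleftrightarrow> (\<forall>i<M.n. \<not> kill (path_length X (as ! i)) \<longrightarrow> c i = 0)" for c :: "nat \<Rightarrow> 'f"
  define W where "W = {z. \<exists>c. ok c \<and> z - M.comb c \<in> M.B}"
  have "pm.subspace W"
  proof (rule pm.subspaceI)
    show "0 \<in> W"
      using pm.subspace_0[OF subspace_bds] by (auto simp: W_def ok_def intro!: exI[of _ "\<lambda>_. 0"])
  next
    fix x y assume "x \<in> W" "y \<in> W"
    then obtain c c' where c: "ok c" "ok c'" "x - M.comb c \<in> M.B" "y - M.comb c' \<in> M.B"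
      unfolding W_def by blast
    have "x + y - M.comb (\<lambda>i. c i + c' i) \<in> M.B"
      using pm.subspace_add[OF subspace_bds c(3,4)]
      by (simp add: pm.scale_left_distrib sum.distrib algebra_simps)
    moreover have "ok (\<lambda>i. c i + c' i)" using c(1,2) by (simp add: ok_def)
    ultimately show "x + y \<in> W" unfolding W_def by blast
  next
    fix r x assume "x \<in> W"
    then obtain c where c: "ok c" "x - M.comb c \<in> M.B" unfolding W_def by blast
    have "scl r x - M.comb (\<lambda>i. r * c i) \<in> M.B"
      using pm.subspace_scale[OF subspace_bds c(2), of r]
      by (simp add: pm.scale_right_diff_distrib pm.scale_sum_right)
    moreover have "ok (\<lambda>i. r * c i)" using c(1) by (simp add: ok_def)
    ultimately show "scl r x \<in> W" unfolding W_def by blast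
  qed
  moreover have "M.B \<subseteq> W"
    by (auto simp: W_def ok_def intro!: exI[of _ "\<lambda>_. 0"])
  moreover have "segment p 0 D \<in> W" if p: "short_curve X p D x x" and k: "kill (ennreal D)" for p D x
  proof -
    define a where "a = (\<lambda>t. p (0 + t * (D - 0)))"
    note a = path_length_short_curve[OF p, folded a_def]
    have e: "segment p 0 D = (loop_chain a :: _ \<Rightarrow>\<^sub>0 'f)" by (simp add: segment_def loop_chain_def a_def)
    have "ok (M.coords (loop_chain a))"
      unfolding ok_def
    proof (intro allI impI)
      fix i assume i: "i < M.n" "\<not> kill (path_length X (as ! i))"
      \<comment> \<open>If the surviving \<open>as ! i\<close> were no longer than the killed loop
        \<open>a\<close>, then \<open>kill_mono\<close> would kill it too.\<close>
      have "path_length X a < path_length X (as ! i)"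
        using i(2) kill_mono[OF _ kill_mono[OF a(2) k]] by (auto simp: not_le[symmetric])
      then show "M.coords (loop_chain a) i = 0" by (rule M.short_loop_coords[OF a(1) i(1)])
    qed
    then show ?thesis
      unfolding W_def e using M.coords[OF M.loop_chain_cycle[OF a(1)]] by blast
  qed
  ultimately have sub: "killed_span \<subseteq> W"
    unfolding killed_span_def by (intro pm.span_minimal) auto
  have "ok (M.coords z)" if zk: "z \<in> killed_span"
  proof -
    obtain c where c: "ok c" "z - M.comb c \<in> M.B" using subsetD[OF sub zk] unfolding W_def by blast
    then show ?thesis using M.coords_unique[OF z c(2)] by (simp add: ok_def)
  qed
  moreover have "z \<in> killed_span" if "ok (M.coords z)"
  proof -
    have "scl (M.coords z i) (M.v i) \<in> killed_span" if i: "i < M.n" for i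
    proof (cases "kill (path_length X (as ! i))")
      case True
      have "M.v i \<in> killed_span"
        unfolding loop_chain_def using i True by (intro short_loop_killed M.loops) auto
      then show ?thesis by (rule pm.subspace_scale[OF subspace_killed_span])
    next
      case False
      then have "M.coords z i = 0" using \<open>ok (M.coords z)\<close> i by (simp add: ok_def)
      then show ?thesis using pm.subspace_0[OF subspace_killed_span] by simp
    qed
    then have "M.comb (M.coords z) \<in> killed_span"
      by (intro pm.subspace_sum[OF subspace_killed_span]) auto
    from pm.subspace_add[OF subspace_killed_span bds_killed[OF M.coords[OF z]] this]
    show ?thesis by simp
  qed
  ultimately show ?thesis unfolding ok_def by blast
qed

lemma obds_mono: "K \<subseteq> L \<Longrightarrow> obds K \<subseteq> obds L"
  unfolding obds_span by (intro pm.span_mono image_mono) auto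

lemma ordered_cycles_mono:
  "K \<subseteq> L \<Longrightarrow> cycles (ordered_simplices K) ordered_face 1 \<subseteq> cycles (ordered_simplices L) ordered_face 1"
  by (auto simp: cycles_def chain_space_def ordered_simplices_def)

text \<open>The isomorphism at scale \<open>r\<close> takes the coordinates of the realized cycle at
  the indices alive at \<open>r\<close>; \<open>alive_mono\<close> says that no class is born after
  the start, so all summands are intervals beginning at 0.\<close>

theorem (in geodesic_slsc) persistence_filtration:
  fixes as :: "(real \<Rightarrow> 'a) list" and K :: "real \<Rightarrow> 'a set set"
  assumes base: "lex_minimal_base TYPE('f::field) X as"
    and stage: "\<And>r. 0 < r \<Longrightarrow> filtration_stage X (K r) r (\<lambda>l. \<not> alive r l)"
    and K_mono: "\<And>r s. 0 < r \<Longrightarrow> r \<le> s \<Longrightarrow> K r \<subseteq> K s"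
    and alive_mono: "\<And>r s l. 0 < r \<Longrightarrow> r \<le> s \<Longrightarrow> alive s l \<Longrightarrow> alive r l"
  shows "persistence_iso (homology_persistence 1 K :: ('f, _) persistence)
    (persistence_sum (length as) (\<lambda>i. interval_module {r. 0 < r \<and> alive r (path_length X (as ! i))}))"
proof -
  interpret M: minimal_loop_base X as "TYPE('f)" by unfold_locales (rule base)
  define Zo where "Zo r = (cycles (ordered_simplices (K r)) ordered_face 1 :: ('a list \<Rightarrow>\<^sub>0 'f) set)" for r
  define Bo where "Bo r = (obds (K r) :: ('a list \<Rightarrow>\<^sub>0 'f) set)" for r
  define A where "A r i \<longleftrightarrow> alive r (path_length X (as ! i))" for r i
  define I where "I i = {r. 0 < r \<and> A r i}" for i
  define \<psi> where "\<psi> r z = (\<lambda>i\<in>{..<M.n}. if A r i then M.coords (realize z) i else 0)" for r and z :: "'a list \<Rightarrow>\<^sub>0 'f"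
  \<comment> \<open>\<open>\<psi>\<close> is carried to cosets by choosing a representative;
    \<open>\<psi>_eq_iff\<close> yields both independence of this choice and injectivity.\<close>
  define \<phi> where "\<phi> r C = \<psi> r (SOME z. z \<in> Zo r \<and> C = z +o Bo r)" for r C
  have sZ: "pm.subspace (Zo r)" and sB: "pm.subspace (Bo r)" for r
    unfolding Zo_def Bo_def by (rule subspace_cycles_1 subspace_obds)+
  have rZ: "realize z \<in> M.Z" if "0 < r" "z \<in> Zo r" for r z
    using filtration_stage.realize_cycle[OF stage[OF that(1)]] that(2) unfolding Zo_def by blast
  have real_diff: "realize (z - w) = realize z - (realize w :: _ \<Rightarrow>\<^sub>0 'f)" for z w
    by (simp add: realize_def lin_diff)
  have real_add: "realize (z + w) = realize z + (realize w :: _ \<Rightarrow>\<^sub>0 'f)" for z w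
    by (simp add: realize_def lin_add)
  have real_scl: "realize (scl c z) = scl c (realize z :: _ \<Rightarrow>\<^sub>0 'f)" for c z
    by (simp add: realize_def lin_scl)
  have \<psi>_eq_iff: "\<psi> r z = \<psi> r w \<longleftrightarrow> z - w \<in> Bo r" if r: "0 < r" and zw: "z \<in> Zo r" "w \<in> Zo r" for r z w
  proof -
    interpret S: filtration_stage X "K r" r "\<lambda>l. \<not> alive r l" by (rule stage[OF r])
    have d: "z - w \<in> Zo r" by (rule pm.subspace_diff[OF sZ zw])
    have "M.coords (realize z) i = M.coords (realize (z - w)) i + M.coords (realize w) i" if "i < M.n" for i
      using M.coords_add[OF rZ[OF r d] rZ[OF r zw(2)] that] by (simp add: real_diff)
    then have "\<psi> r z = \<psi> r w \<longleftrightarrow> (\<forall>i<M.n. A r i \<longrightarrow> M.coords (realize (z - w)) i = 0)"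
      unfolding \<psi>_def by (auto simp: fun_eq_iff restrict_def)
    also have "\<dots> \<longleftrightarrow> realize (z - w) \<in> S.killed_span"
      using S.killed_span_iff_coords[OF M.minimal_loop_base_axioms rZ[OF r d]] by (simp add: A_def)
    also have "\<dots> \<longleftrightarrow> z - w \<in> Bo r"
      using S.obds_iff_realize_killed[of "z - w"] d unfolding Zo_def Bo_def by simp
    finally show ?thesis .
  qed
  have \<phi>: "\<phi> r (z +o Bo r) = \<psi> r z" if r: "0 < r" and z: "z \<in> Zo r" for r z
  proof -
    have "\<exists>w. w \<in> Zo r \<and> z +o Bo r = w +o Bo r" using z by blast
    from someI_ex[OF this] obtain w where w: "w \<in> Zo r" "z +o Bo r = w +o Bo r" "\<phi> r (z +o Bo r) = \<psi> r w"
      unfolding \<phi>_def by blast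
    have "w - z \<in> Bo r" using coset_eq_iff[OF sB[of r], of w z] w(2) by (simp only: HOL.simp_thms)
    then show ?thesis using \<psi>_eq_iff[OF r w(1) z] w(3) by simp
  qed
  let ?P = "homology_persistence 1 K :: ('f, _) persistence"
  let ?Q = "persistence_sum M.n (\<lambda>i. interval_module (I i)) :: ('f, _) persistence"
  have P: "carrier (vspace ?P r) = (\<lambda>z. z +o Bo r) ` Zo r"
    "z \<in> Zo r \<Longrightarrow> w \<in> Zo r \<Longrightarrow> add (vspace ?P r) (z +o Bo r) (w +o Bo r) = (z + w) +o Bo r"
    "z \<in> Zo r \<Longrightarrow> smult (vspace ?P r) c (z +o Bo r) = scl c z +o Bo r" for r c z w
    unfolding Zo_def Bo_def by (simp_all add: homology_persistence_def homology_simps(1) homology_coset_simps)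
  have bondP: "bond ?P r s (z +o Bo r) = z +o Bo s" if "0 < r" "r \<le> s" for r s z
    using coset_plus_subspace[OF sB[of s] _ sB[of r], of z] obds_mono[OF K_mono[OF that]]
    by (simp add: homology_persistence_def Bo_def)
  have Q: "carrier (vspace ?Q r) = (\<Pi>\<^sub>E i\<in>{..<M.n}. if r \<in> I i then UNIV else {0})"
    "add (vspace ?Q r) f g = (\<lambda>i\<in>{..<M.n}. f i + g i)"
    "smult (vspace ?Q r) c f = (\<lambda>i\<in>{..<M.n}. c * f i)"
    "bond ?Q r s f = (\<lambda>i\<in>{..<M.n}. if r \<in> I i \<and> s \<in> I i then f i else 0)" for r s c f g
    by (simp_all add: persistence_sum_def interval_module_def)
  have \<psi>Q: "\<psi> r z \<in> carrier (vspace ?Q r)" if "0 < r" for r z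
    unfolding Q \<psi>_def using that by (auto simp: I_def)
  have hom: "\<phi> r \<in> LinearCombinations.module_hom field_ring (vspace ?P r) (vspace ?Q r)" if r: "0 < r" for r
    unfolding LinearCombinations.module_hom_def
  proof (intro CollectI conjI allI impI Pi_I)
    fix C assume "C \<in> carrier (vspace ?P r)"
    then show "\<phi> r C \<in> carrier (vspace ?Q r)" unfolding P using \<phi>[OF r] \<psi>Q[OF r] by auto
  next
    fix C D assume "C \<in> carrier (vspace ?P r) \<and> D \<in> carrier (vspace ?P r)"
    then obtain z w where z: "z \<in> Zo r" "C = z +o Bo r" and w: "w \<in> Zo r" "D = w +o Bo r" unfolding P by blast
    have "\<phi> r (add (vspace ?P r) C D) = \<psi> r (z + w)"
      unfolding z(2) w(2) P(2)[OF z(1) w(1)] by (rule \<phi>[OF r pm.subspace_add[OF sZ z(1) w(1)]])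
    also have "\<dots> = add (vspace ?Q r) (\<psi> r z) (\<psi> r w)"
      unfolding Q \<psi>_def real_add using M.coords_add[OF rZ[OF r z(1)] rZ[OF r w(1)]]
      by (auto simp: fun_eq_iff restrict_def)
    finally show "\<phi> r (add (vspace ?P r) C D) = add (vspace ?Q r) (\<phi> r C) (\<phi> r D)"
      unfolding z(2) w(2) \<phi>[OF r z(1)] \<phi>[OF r w(1)] .
  next
    fix c C assume "c \<in> carrier (field_ring :: 'f ring) \<and> C \<in> carrier (vspace ?P r)"
    then obtain z where z: "z \<in> Zo r" "C = z +o Bo r" unfolding P by blast
    have "\<phi> r (smult (vspace ?P r) c C) = \<psi> r (scl c z)"
      unfolding z(2) P(3)[OF z(1)] by (rule \<phi>[OF r pm.subspace_scale[OF sZ z(1)]])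
    also have "\<dots> = smult (vspace ?Q r) c (\<psi> r z)"
      unfolding Q \<psi>_def real_scl using M.coords_scale[OF rZ[OF r z(1)]]
      by (auto simp: fun_eq_iff restrict_def)
    finally show "\<phi> r (smult (vspace ?P r) c C) = smult (vspace ?Q r) c (\<phi> r C)"
      unfolding z(2) \<phi>[OF r z(1)] .
  qed
  have bij: "bij_betw (\<phi> r) (carrier (vspace ?P r)) (carrier (vspace ?Q r))" if r: "0 < r" for r
    unfolding bij_betw_def
  proof
    show "inj_on (\<phi> r) (carrier (vspace ?P r))"
    proof (rule inj_onI)
      fix C D assume "C \<in> carrier (vspace ?P r)" "D \<in> carrier (vspace ?P r)" and eq: "\<phi> r C = \<phi> r D"
      then obtain z w where z: "z \<in> Zo r" "C = z +o Bo r" and w: "w \<in> Zo r" "D = w +o Bo r" unfolding P by blast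
      have "\<psi> r z = \<psi> r w" using eq unfolding z(2) w(2) \<phi>[OF r z(1)] \<phi>[OF r w(1)] .
      then show "C = D" using \<psi>_eq_iff[OF r z(1) w(1)] coset_eq_iff[OF sB] z(2) w(2) by blast
    qed
    show "\<phi> r ` carrier (vspace ?P r) = carrier (vspace ?Q r)"
    proof
      show "\<phi> r ` carrier (vspace ?P r) \<subseteq> carrier (vspace ?Q r)"
        using LinearCombinations.module_hom_closed[OF hom[OF r]] by blast
      show "carrier (vspace ?Q r) \<subseteq> \<phi> r ` carrier (vspace ?P r)"
      proof
        fix f assume f: "f \<in> carrier (vspace ?Q r)"
        interpret S: filtration_stage X "K r" r "\<lambda>l. \<not> alive r l" by (rule stage[OF r])
        have "M.comb f \<in> M.Z"
          using M.v_cycle by (intro pm.subspace_sum[OF subspace_cycles_1] pm.subspace_scale[OF subspace_cycles_1]) auto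
        then obtain z where z: "z \<in> Zo r" "realize z - M.comb f \<in> M.B"
          using S.realize_onto unfolding Zo_def by blast
        have "M.coords (realize z) i = f i" if "i < M.n" for i
          by (rule M.coords_unique[OF rZ[OF r z(1)] z(2) that])
        then have "\<psi> r z = f"
          using f[unfolded Q] r unfolding \<psi>_def
          by (auto simp: I_def fun_eq_iff restrict_def PiE_iff extensional_def split: if_splits)
        then have "f = \<phi> r (z +o Bo r)" using \<phi>[OF r z(1)] by simp
        then show "f \<in> \<phi> r ` carrier (vspace ?P r)" unfolding P using z(1) by blast
      qed
    qed
  qed
  have nat: "\<phi> s (bond ?P r s C) = bond ?Q r s (\<phi> r C)" if rs: "0 < r" "r \<le> s" and C: "C \<in> carrier (vspace ?P r)" for r s C
  proof -
    obtain z where z: "z \<in> Zo r" "C = z +o Bo r" using C unfolding P by blast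
    have zs: "z \<in> Zo s" using z(1) ordered_cycles_mono[OF K_mono[OF rs]] unfolding Zo_def by blast
    have s: "0 < s" using rs by simp
    have "A r i" if "A s i" for i using alive_mono[OF rs] that by (simp add: A_def)
    \<comment> \<open>Both sides are the coordinates at the indices alive at \<open>s\<close>, since
      these are alive at \<open>r\<close> as well; \<open>realize\<close> is the same map at both
      scales.\<close>
    then show ?thesis
      unfolding z(2) bondP[OF rs] \<phi>[OF rs(1) z(1)] \<phi>[OF s zs] Q \<psi>_def
      using rs s by (auto simp: I_def fun_eq_iff restrict_def)
  qed
  have "persistence_iso ?P ?Q"
    unfolding persistence_iso_def using hom bij nat by blast
  then show ?thesis by (simp add: I_def A_def)
qed

lemma divide_ennreal_numeral:
  "0 \<le> D \<Longrightarrow> ennreal D / 3 = ennreal (D / 3)" "0 \<le> D \<Longrightarrow> ennreal D / 4 = ennreal (D / 4)"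
  using divide_ennreal[of D 3] divide_ennreal[of D 4] by simp_all

theorem theorem11p3:
  fixes G :: "('v, 'e) pre_digraph" and len :: "'e \<Rightarrow> real"
    and X :: "('v, 'e) graph_point metric"
    and as :: "(real \<Rightarrow> ('v, 'e) graph_point) list"
  assumes "metric_graph G len"
    and "X = metric_graph_space G len"
    and "lex_minimal_base TYPE('f::field) X as"
  shows "persistence_iso
      (homology_persistence 1 (rips X) :: ('f, _) persistence)
      (persistence_sum (length as)
        (\<lambda>i. interval_module {r. 0 < r \<and> ennreal r \<le> path_length X (as ! i) / 3}))
    \<and> persistence_iso
      (homology_persistence 1 (closed_rips X) :: ('f, _) persistence)
      (persistence_sum (length as)
        (\<lambda>i. interval_module {r. 0 < r \<and> ennreal r < path_length X (as ! i) / 3}))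
    \<and> persistence_iso
      (homology_persistence 1 (cech X) :: ('f, _) persistence)
      (persistence_sum (length as)
        (\<lambda>i. interval_module {r. 0 < r \<and> ennreal r \<le> path_length X (as ! i) / 4}))
    \<and> persistence_iso
      (homology_persistence 1 (closed_cech X) :: ('f, _) persistence)
      (persistence_sum (length as)
        (\<lambda>i. interval_module {r. 0 < r \<and> ennreal r < path_length X (as ! i) / 4}))"
proof -
  interpret geodesic_slsc X
    unfolding assms(2) by (rule metric_graph.geodesic_slsc_graph[OF assms(1)])
  show ?thesis
    unfolding rips_eq cech_eq
  proof (intro conjI persistence_filtration[OF assms(3)] rips_stage cech_stage)
    \<comment> \<open>Translates survival, stated for extended lengths, into the real inequality of
      the matching complex: \<open>\<le>\<close> for survival goes with the open complex,
      \<open><\<close> with the closed one.\<close>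
    show "\<not> ennreal r \<le> ennreal D / 3 \<longleftrightarrow> D / 3 < r" "\<not> ennreal r < ennreal D / 3 \<longleftrightarrow> D / 3 \<le> r"
      "\<not> ennreal r \<le> ennreal D / 4 \<longleftrightarrow> D / 4 < r" "\<not> ennreal r < ennreal D / 4 \<longleftrightarrow> D / 4 \<le> r"
      if "0 < r" "0 \<le> D" for r D
      using that by (auto simp: divide_ennreal_numeral ennreal_less_iff not_less not_le)
    show "\<not> ennreal r \<le> l / 3" if "l \<le> l'" "\<not> ennreal r \<le> l' / 3" for r l l'
      using that divide_right_mono_ennreal[of l l' 3] by (meson order_trans)
    show "\<not> ennreal r < l / 3" if "l \<le> l'" "\<not> ennreal r < l' / 3" for r l l'
      using that divide_right_mono_ennreal[of l l' 3] by (meson less_le_trans)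
    show "\<not> ennreal r \<le> l / 4" if "l \<le> l'" "\<not> ennreal r \<le> l' / 4" for r l l'
      using that divide_right_mono_ennreal[of l l' 4] by (meson order_trans)
    show "\<not> ennreal r < l / 4" if "l \<le> l'" "\<not> ennreal r < l' / 4" for r l l'
      using that divide_right_mono_ennreal[of l l' 4] by (meson less_le_trans)
    show "rips_complex (<) X r \<subseteq> rips_complex (<) X s" "rips_complex (\<le>) X r \<subseteq> rips_complex (\<le>) X s"
      "cech_complex (<) X r \<subseteq> cech_complex (<) X s" "cech_complex (\<le>) X r \<subseteq> cech_complex (\<le>) X s"
      if "r \<le> s" for r s
      using that by (auto simp: rips_complex_def cech_complex_def intro: less_le_trans order_trans)
  qed (auto intro: order_trans[OF ennreal_leI] le_less_trans[OF ennreal_leI])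
qed

end
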